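(* Let $n\ge 1$, $0<q<1$, $\lambda>0$, $t=q^{\lambda}$ (so $0<t<1$), let $a,b$ be real and let $\eta\in\mathbb{Z}_{\ge 0}^n$ be a composition. Then $$\frac{\mathrm{CT}\left(\prod_{i=1}^{n}(x_i;q)_a\left(\tfrac{q}{x_i};q\right)_b\,E_\eta(x;q,t)\,W(x)\right)}{\mathrm{CT}\left(\prod_{i=1}^{n}(x_i;q)_a\left(\tfrac{q}{x_i};q\right)_b\,W(x)\right)}=q^{(b+1)|\eta|}\,E_\eta(t^{\underline{\delta}};q,t)\,\frac{[q^{-b}]_{\eta^+}}{[q^{1+a+\lambda(n-1)}]_{\eta^+}}.$$
   Context: Non-symmetric Macdonald polynomials. $s_i$ interchanges $x_i$ and $x_{i+1}$ ($1\le i\le n-1$); $(\tau_i f)(x_1,\ldots,x_n)=f(x_1,\ldots,qx_i,\ldots,x_n)$; $T_i=t+\frac{tx_i-x_{i+1}}{x_i-x_{i+1}}(s_i-1)$; $\omega=s_{n-1}\cdots s_1\tau_1$; $Y_i=t^{-n+i}T_i\cdots T_{n-1}\,\omega\,T_1^{-1}\cdots T_{i-1}^{-1}$ for $1\le i\le n$. For $\eta\in\mathbb{Z}_{\ge0}^n$ let $x^\eta=x_1^{\eta_1}\cdots x_n^{\eta_n}$, $|\eta|=\sum_i\eta_i$, $\eta^+$ the partition obtained by permuting the parts of $\eta$, and $l'_\eta(i)=\#\{k<i:\eta_k\ge\eta_i\}+\#\{k>i:\eta_k>\eta_i\}$. Dominance order on $n$-tuples: $\nu<\eta$ iff $\nu\ne\eta$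 and $\sum_{i=1}^p(\eta_i-\nu_i)\ge0$ for all $1\le p\le n$. For $|\nu|=|\eta|$: $\nu\prec\eta$ iff $\nu^+<\eta^+$, or $\nu^+=\eta^+$ and $\nu<\eta$. $E_\eta(x;q,t)$ is the unique polynomial of the form $x^\eta+\sum_{\nu\prec\eta}b_{\eta\nu}x^\nu$ with $Y_iE_\eta=q^{\eta_i}t^{-l'_\eta(i)}E_\eta$ for all $1\le i\le n$. Further notation. $(z;q)_\infty=\prod_{i\ge0}(1-zq^i)$, $(z;q)_r=(z;q)_\infty/(zq^r;q)_\infty$ for real $r$. $W(x)=\prod_{1\le i<j\le n}\left(\frac{x_i}{x_j};q\right)_\lambda\left(q\frac{x_j}{x_i};q\right)_\lambda$. $t^{\underline\delta}=(1,t,\ldots,t^{n-1})$. For a partition $\kappa=(\kappa_1,\ldots,\kappa_n)$, $[q^u]_\kappa=\prod_{i=1}^n\prod_{j=1}^{\kappa_i}\left(t^{i-1}-q^{j-1+u}\right)$. $\mathrm{CT}(f)$ denotes the constant term in the Laurent expansion of $f$ in $x_1,\ldots,x_n$ if $f$ is a Laurent polynomial, and otherwise the corresponding Fourier integral.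
   Formalization: CT is taken on |x_i|=r for any r>0 with r<q^{-a} (unless a is a nonnegative integer) and q^{b+1}<r (unless b is one), and the denominator CT is assumed nonzero; for arbitrary real a, b on the unit torus the claim fails (n=1, a=-1/2, b=0, η=(1)). *)

theory Defs
  imports "HOL-Analysis.Analysis"
begin

text \<open>
  Points of $n$-space and exponent vectors are functions on \<^typ>\<open>nat\<close> of which only the
  coordinates \<open>1, \<dots>, n\<close> matter. Polynomials and rational functions in
  \<open>x\<^sub>1, \<dots>, x\<^sub>n\<close> are represented by the functions they induce.
\<close>

subsection \<open>Compositions and orders\<close>

definition compositions :: "nat \<Rightarrow> (nat \<Rightarrow> nat) set" where
  "compositions n = {\<eta>. \<forall>i. i \<notin> {1..n} \<longrightarrow> \<eta> i = 0}"

definition weight :: "nat \<Rightarrow> (nat \<Rightarrow> nat) \<Rightarrow> nat" where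
  "weight n \<eta> = (\<Sum>i=1..n. \<eta> i)"

definition sorted_parts :: "nat \<Rightarrow> (nat \<Rightarrow> nat) \<Rightarrow> nat \<Rightarrow> nat" where
  "sorted_parts n \<eta> i =
     (if i \<in> {1..n} then rev (sort (map \<eta> [1..<Suc n])) ! (i - 1) else 0)"

definition leg' :: "nat \<Rightarrow> (nat \<Rightarrow> nat) \<Rightarrow> nat \<Rightarrow> nat" where
  "leg' n \<eta> i =
     card {k \<in> {1..n}. k < i \<and> \<eta> k \<ge> \<eta> i} + card {k \<in> {1..n}. k > i \<and> \<eta> k > \<eta> i}"

definition dom_less :: "nat \<Rightarrow> (nat \<Rightarrow> nat) \<Rightarrow> (nat \<Rightarrow> nat) \<Rightarrow> bool" where
  "dom_less n \<nu> \<eta> \<longleftrightarrow>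
     \<nu> \<noteq> \<eta> \<and> (\<forall>p\<in>{1..n}. (\<Sum>i=1..p. int (\<eta> i) - int (\<nu> i)) \<ge> 0)"

definition comp_less :: "nat \<Rightarrow> (nat \<Rightarrow> nat) \<Rightarrow> (nat \<Rightarrow> nat) \<Rightarrow> bool" where
  "comp_less n \<nu> \<eta> \<longleftrightarrow>
     \<nu> \<in> compositions n \<and> \<eta> \<in> compositions n \<and> weight n \<nu> = weight n \<eta> \<and>
     (dom_less n (sorted_parts n \<nu>) (sorted_parts n \<eta>) \<or>
      sorted_parts n \<nu> = sorted_parts n \<eta> \<and> dom_less n \<nu> \<eta>)"

lemma finite_comp_less: "finite {\<nu>. comp_less n \<nu> \<eta>}"
proof -
  have "{\<nu>. comp_less n \<nu> \<eta>} \<subseteq>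
        {\<nu>. \<forall>i. (i \<in> {1..n} \<longrightarrow> \<nu> i \<in> {..weight n \<eta>}) \<and> (i \<notin> {1..n} \<longrightarrow> \<nu> i = 0)}"
  proof
    fix \<nu> assume "\<nu> \<in> {\<nu>. comp_less n \<nu> \<eta>}"
    then have c: "\<nu> \<in> compositions n" and w: "weight n \<nu> = weight n \<eta>"
      by (auto simp: comp_less_def)
    have "\<nu> i \<le> weight n \<eta>" if "i \<in> {1..n}" for i
      using w member_le_sum[of i "{1..n}" \<nu>] that by (simp add: weight_def)
    then show "\<nu> \<in> {\<nu>. \<forall>i. (i \<in> {1..n} \<longrightarrow> \<nu> i \<in> {..weight n \<eta>}) \<and> (i \<notin> {1..n} \<longrightarrow> \<nu> i = 0)}"
      using c by (auto simp: compositions_def)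
  qed
  moreover have "finite \<dots>"
    by (rule finite_set_of_finite_funs) auto
  ultimately show ?thesis by (rule finite_subset)
qed

subsection \<open>Operators\<close>

definition s_op :: "nat \<Rightarrow> ((nat \<Rightarrow> complex) \<Rightarrow> complex) \<Rightarrow> (nat \<Rightarrow> complex) \<Rightarrow> complex" where
  "s_op i f x = f (x(i := x (Suc i), Suc i := x i))"

definition tau_op :: "real \<Rightarrow> nat \<Rightarrow> ((nat \<Rightarrow> complex) \<Rightarrow> complex) \<Rightarrow> (nat \<Rightarrow> complex) \<Rightarrow> complex" where
  "tau_op q i f x = f (x(i := of_real q * x i))"

text \<open>
  On the hyperplane \<open>x\<^sub>i = x\<^sub>i\<^sub>+\<^sub>1\<close> the totalized division makes this
  formula return \<open>t f\<close>, which is not the value of the polynomial \<open>T\<^sub>i f\<close> there;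
  see \<open>generic_point\<close>.
\<close>

definition T_op :: "real \<Rightarrow> nat \<Rightarrow> ((nat \<Rightarrow> complex) \<Rightarrow> complex) \<Rightarrow> (nat \<Rightarrow> complex) \<Rightarrow> complex" where
  "T_op t i f x = of_real t * f x +
     (of_real t * x i - x (Suc i)) / (x i - x (Suc i)) * (s_op i f x - f x)"

text \<open>
  For \<open>t \<noteq> 0\<close> the operator \<^term>\<open>T_op t i\<close> is bijective on the space of all functions,
  so \<^term>\<open>inv (T_op t i)\<close> is its inverse; its value at a point off the hyperplane only
  depends on the function at that point and at the swapped point.
\<close>

lemma T_op_T_op:
  assumes "x i \<noteq> x (Suc i)"
  shows "T_op t i (T_op t i f) x = (of_real t - 1) * T_op t i f x + of_real t * f x"
proof -
  let ?y = "x(i := x (Suc i), Suc i := x i)"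
  have y: "?y i = x (Suc i)" "?y (Suc i) = x i" by auto
  have yy: "?y(i := ?y (Suc i), Suc i := ?y i) = x" by (auto simp: fun_eq_iff)
  define a where "a = x i"
  define b where "b = x (Suc i)"
  define u where "u = f x"
  define v where "v = f ?y"
  define w where "w = complex_of_real t"
  have ne: "a \<noteq> b" using assms by (simp add: a_def b_def)
  have 1: "T_op t i f x = w * u + (w * a - b) / (a - b) * (v - u)"
    by (simp add: T_op_def s_op_def a_def b_def u_def v_def w_def)
  have 2: "T_op t i f ?y = w * v + (w * b - a) / (b - a) * (u - v)"
    unfolding T_op_def s_op_def yy unfolding y a_def b_def u_def v_def w_def ..
  have 3: "T_op t i (T_op t i f) x = w * T_op t i f x +
             (w * a - b) / (a - b) * (T_op t i f ?y - T_op t i f x)"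
    by (subst T_op_def) (simp add: s_op_def a_def b_def w_def)
  define d where "d = a - b"
  have d: "d \<noteq> 0" "b - a = - d" "a = b + d" using ne by (auto simp: d_def)
  show ?thesis
    unfolding 3 unfolding 1 2 w_def[symmetric] u_def[symmetric] d_def[symmetric] d(2)
    using d(1) unfolding d(3) by (simp add: divide_simps) algebra
qed

lemma bij_T_op:
  assumes "t \<noteq> 0"
  shows "bij (T_op t i)"
proof (rule bijI')
  fix f g
  show "T_op t i f = T_op t i g \<longleftrightarrow> f = g"
  proof
    assume eq: "T_op t i f = T_op t i g"
    show "f = g"
    proof
      fix x
      show "f x = g x"
      proof (cases "x i = x (Suc i)")
        case True
        then show ?thesis using assms fun_cong[OF eq, of x] by (simp add: T_op_def)
      next
        case False
        show ?thesis
          using T_op_T_op[OF False, of t f] T_op_T_op[OF False, of t g] eq assms by simp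
      qed
    qed
  qed simp
next
  fix g :: "(nat \<Rightarrow> complex) \<Rightarrow> complex"
  define f where "f = (\<lambda>x. if x i = x (Suc i) then g x / of_real t
                      else (T_op t i g x - (of_real t - 1) * g x) / of_real t)"
  have "T_op t i f x = g x" for x
  proof (cases "x i = x (Suc i)")
    case True
    then show ?thesis using assms by (simp add: T_op_def f_def)
  next
    case False
    let ?y = "x(i := x (Suc i), Suc i := x i)"
    have "?y i \<noteq> ?y (Suc i)" using False by auto
    then have fx: "f x = (T_op t i g x - (of_real t - 1) * g x) / of_real t"
      and fy: "f ?y = (T_op t i g ?y - (of_real t - 1) * g ?y) / of_real t"
      using False by (simp_all add: f_def)
    define K where "K = (of_real t * x i - x (Suc i)) / (x i - x (Suc i))"
    have T: "T_op t i h x = of_real t * h x + K * (h ?y - h x)" for h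
      by (simp add: T_op_def s_op_def K_def)
    have "T_op t i f x = (T_op t i (T_op t i g) x - (of_real t - 1) * T_op t i g x) / of_real t"
      unfolding T[of f] T[of "T_op t i g"] fx fy T[of g]
      using assms by (simp add: divide_simps) (simp add: algebra_simps)
    then show ?thesis using T_op_T_op[OF False, of t g] assms by simp
  qed
  then show "\<exists>x. g = T_op t i x" by (metis ext)
qed

definition omega_op :: "nat \<Rightarrow> real \<Rightarrow> ((nat \<Rightarrow> complex) \<Rightarrow> complex) \<Rightarrow> (nat \<Rightarrow> complex) \<Rightarrow> complex" where
  "omega_op n q = foldr (\<circ>) (map s_op (rev [1..<n])) id \<circ> tau_op q 1"

definition Y_op ::
  "nat \<Rightarrow> real \<Rightarrow> real \<Rightarrow> nat \<Rightarrow> ((nat \<Rightarrow> complex) \<Rightarrow> complex) \<Rightarrow> (nat \<Rightarrow> complex) \<Rightarrow> complex" where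
  "Y_op n q t i f x = of_real (t powi (int i - int n)) *
     (foldr (\<circ>) (map (T_op t) [i..<n]) id \<circ> omega_op n q \<circ>
      foldr (\<circ>) (map (\<lambda>j. inv (T_op t j)) [1..<i]) id) f x"

subsection \<open>Non-symmetric Macdonald polynomials\<close>

definition monomial_fn :: "nat \<Rightarrow> (nat \<Rightarrow> nat) \<Rightarrow> (nat \<Rightarrow> complex) \<Rightarrow> complex" where
  "monomial_fn n \<eta> x = (\<Prod>i=1..n. x i ^ \<eta> i)"

text \<open>
  Away from the hyperplanes \<open>x\<^sub>i = q\<^sup>k x\<^sub>j\<close> no denominator arising in
  \<open>Y\<^sub>i f\<close> vanishes. These points are dense, so the eigenvalue equation on them is
  the equality of polynomials.
\<close>

definition generic_point :: "nat \<Rightarrow> real \<Rightarrow> (nat \<Rightarrow> complex) \<Rightarrow> bool" where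
  "generic_point n q x \<longleftrightarrow>
     (\<forall>i\<in>{1..n}. \<forall>j\<in>{1..n}. i \<noteq> j \<longrightarrow> (\<forall>k::int. x i \<noteq> of_real (q powi k) * x j))"

definition is_nonsym_macdonald ::
  "nat \<Rightarrow> real \<Rightarrow> real \<Rightarrow> (nat \<Rightarrow> nat) \<Rightarrow> ((nat \<Rightarrow> complex) \<Rightarrow> complex) \<Rightarrow> bool" where
  "is_nonsym_macdonald n q t \<eta> E \<longleftrightarrow>
     (\<exists>b. \<forall>x. E x = monomial_fn n \<eta> x + (\<Sum>\<nu> | comp_less n \<nu> \<eta>. b \<nu> * monomial_fn n \<nu> x)) \<and>
     (\<forall>i\<in>{1..n}. \<forall>x. generic_point n q x \<longrightarrow>
        Y_op n q t i E x = of_real (q ^ \<eta> i * t powi (- int (leg' n \<eta> i))) * E x)"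

definition nonsym_macdonald ::
  "nat \<Rightarrow> real \<Rightarrow> real \<Rightarrow> (nat \<Rightarrow> nat) \<Rightarrow> (nat \<Rightarrow> complex) \<Rightarrow> complex" where
  "nonsym_macdonald n q t \<eta> = (THE E. is_nonsym_macdonald n q t \<eta> E)"

subsection \<open>q-factorials and the weight function\<close>

definition qpoch_inf :: "complex \<Rightarrow> real \<Rightarrow> complex" where
  "qpoch_inf z q = (\<Prod>i. 1 - z * of_real q ^ i)"

definition qpoch :: "complex \<Rightarrow> real \<Rightarrow> real \<Rightarrow> complex" where
  "qpoch z q r = qpoch_inf z q / qpoch_inf (z * of_real (q powr r)) q"

definition W_weight :: "nat \<Rightarrow> real \<Rightarrow> real \<Rightarrow> (nat \<Rightarrow> complex) \<Rightarrow> complex" where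
  "W_weight n q lam x =
     (\<Prod>(i, j) \<in> {(i, j). 1 \<le> i \<and> i < j \<and> j \<le> n}.
        qpoch (x i / x j) q lam * qpoch (of_real q * (x j / x i)) q lam)"

definition morris_factor :: "nat \<Rightarrow> real \<Rightarrow> real \<Rightarrow> real \<Rightarrow> (nat \<Rightarrow> complex) \<Rightarrow> complex" where
  "morris_factor n q a b x = (\<Prod>i=1..n. qpoch (x i) q a * qpoch (of_real q / x i) q b)"

definition q_bracket :: "nat \<Rightarrow> real \<Rightarrow> real \<Rightarrow> real \<Rightarrow> (nat \<Rightarrow> nat) \<Rightarrow> real" where
  "q_bracket n q t u \<kappa> = (\<Prod>i=1..n. \<Prod>j=1..\<kappa> i. t ^ (i - 1) - q powr (real j - 1 + u))"

subsection \<open>Constant terms\<close>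

text \<open>
  Constant terms are taken with respect to the torus \<open>|x\<^sub>1| = \<dots> = |x\<^sub>n| = r\<close>, the radius
  selecting the region of Laurent expansion; \<open>r = 1\<close> is the usual Fourier integral. The
  factor \<^term>\<open>qpoch z q a\<close> has the convergent q-binomial expansion in powers of \<open>z\<close> on
  \<open>|z| = r\<close> iff \<open>r < q powr (- a)\<close>, unless it is a polynomial (\<open>a \<in> \<nat>\<close>); likewise
  \<^term>\<open>qpoch (of_real q / z) q b\<close> in powers of \<open>1 / z\<close> iff \<open>q powr (b + 1) < r\<close>, unless
  \<open>b \<in> \<nat>\<close>. Outside these regions the torus integral picks up additional residues.
\<close>

definition torus_point :: "real \<Rightarrow> (nat \<Rightarrow> real) \<Rightarrow> nat \<Rightarrow> complex" where
  "torus_point r \<theta> i = of_real r * cis (2 * pi * \<theta> i)"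

text \<open>
  \<open>c\<close> is the coefficient family of a Laurent polynomial agreeing with \<open>f\<close> on the torus
  \<open>|x\<^sub>1| = \<dots> = |x\<^sub>n| = r\<close>. Agreement is required almost everywhere only, because
  at removable singularities of \<open>f\<close> (such as \<open>z = 1\<close> for \<^term>\<open>qpoch z q 0\<close>) the
  quotient \<open>0 / 0\<close> evaluates to \<open>0\<close>.
\<close>

definition is_laurent_expansion ::
  "nat \<Rightarrow> real \<Rightarrow> ((nat \<Rightarrow> complex) \<Rightarrow> complex) \<Rightarrow> ((nat \<Rightarrow> int) \<Rightarrow> complex) \<Rightarrow> bool" where
  "is_laurent_expansion n r f c \<longleftrightarrow>
     finite {\<alpha>. c \<alpha> \<noteq> 0} \<and>
     (\<forall>\<alpha>. c \<alpha> \<noteq> 0 \<longrightarrow> (\<forall>i. i \<notin> {1..n} \<longrightarrow> \<alpha> i = 0)) \<and>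
     (AE \<theta> in PiM {1..n} (\<lambda>_. lborel).
        f (torus_point r \<theta>) =
          (\<Sum>\<alpha> | c \<alpha> \<noteq> 0. c \<alpha> * (\<Prod>i=1..n. torus_point r \<theta> i powi \<alpha> i)))"

definition fourier_integral :: "nat \<Rightarrow> real \<Rightarrow> ((nat \<Rightarrow> complex) \<Rightarrow> complex) \<Rightarrow> complex" where
  "fourier_integral n r f =
     (LINT \<theta>:(PiE {1..n} (\<lambda>_. {- 1/2..1/2}))|PiM {1..n} (\<lambda>_. lborel). f (torus_point r \<theta>))"

definition CT :: "nat \<Rightarrow> real \<Rightarrow> ((nat \<Rightarrow> complex) \<Rightarrow> complex) \<Rightarrow> complex" where
  "CT n r f =
     (if \<exists>c. is_laurent_expansion n r f c
      then (THE z. \<exists>c. is_laurent_expansion n r f c \<and> z = c (\<lambda>_. 0))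
      else fourier_integral n r f)"

end

theory Submission
  imports Defs "HOL-Complex_Analysis.Complex_Analysis" "HOL-Library.Multiset"
begin

text \<open>
  The polynomials \<open>E\<^sub>\<eta>\<close> are generated from \<open>E\<^sub>0 = 1\<close> by the intertwiners
  \<open>E\<^bsub>s\<^sub>i\<eta>\<^esub> \<propto> (T\<^sub>i + c) E\<^sub>\<eta>\<close> (for \<open>\<eta>\<^sub>i < \<eta>\<^sub>i\<^sub>+\<^sub>1\<close>) and by the raising operator \<open>\<Phi> = x\<^sub>n \<omega>\<close>, for
  which \<open>E\<^bsub>\<Phi>\<eta>\<^esub> \<propto> \<Phi> E\<^sub>\<eta>\<close> with \<open>\<Phi>\<eta> = (\<eta>\<^sub>2, \<dots>, \<eta>\<^sub>n, \<eta>\<^sub>1 + 1)\<close>. Both sides of the claim are linear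
  functionals of \<open>E\<^sub>\<eta>\<close>: the weighted constant term \<open>L\<close> and the evaluation at \<open>(1, t, \<dots>, t\<^sup>n\<^sup>-\<^sup>1)\<close>.
  Both satisfy \<open>\<Lambda>(T\<^sub>i f) = t \<Lambda>(f)\<close>, so they change by the same factor under the intertwiners, and
  \<open>\<Lambda>(\<omega> E\<^sub>\<eta>) = y \<Lambda>(E\<^sub>\<eta>)\<close> and \<open>\<Lambda>(\<Phi> E\<^sub>\<eta>) = t\<^sup>n\<^sup>-\<^sup>1 y \<Lambda>(x\<^sub>1 E\<^sub>\<eta>)\<close>, where \<open>y\<close> is the eigenvalue of \<open>Y\<^sub>1\<close>.
  Moving the contour of one variable from radius \<open>q r\<close> to \<open>r\<close> gives
  \<open>L(\<omega> h) - q\<^sup>a L(\<Phi> h) = q\<^sup>b L(h) - q\<^sup>-\<^sup>1 L(x\<^sub>1 h)\<close>. Together these determine the effect of \<open>\<Phi>\<close> on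
  both sides.
\<close>

subsection \<open>Ranks of the parts of a composition\<close>

text \<open>The point (1, t, ..., t^(n-1)) enters because t x_i = x_(i+1) there, so the coefficient
  of s_i - 1 in T_i vanishes and evaluation satisfies \<Lambda>(T_i f) = t \<Lambda>(f). For the
  constant term the same coefficient cancels the part of the weight that is not symmetric in x_i,
  x_(i+1), so the term with s_i - 1 integrates to 0.

  Three obstacles shape the proof. The order \<open>comp_less\<close> is not stable under raising,
  so existence is proved with triangularity in a finer order, and uniqueness in
  \<open>comp_less\<close>. With totalized division the operators have their intended values only at
  generic points, so the operator calculus runs on functions cut off there, and a density argument
  returns to polynomials. Finally, the bracket in the denominator can vanish when a < 0; the
  recursion is therefore solved in a form without division, and at a zero of the denominator the
  constant term is shown to vanish by varying a. For integral a or b the quotients defining the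
  q-factorials may read 0 / 0 on the torus, so they are replaced by holomorphic functions that
  satisfy the same q-difference equations.\<close>

definition part_before :: "(nat \<Rightarrow> nat) \<Rightarrow> nat \<Rightarrow> nat \<Rightarrow> bool" where
  "part_before \<eta> j k \<longleftrightarrow> \<eta> j > \<eta> k \<or> (\<eta> j = \<eta> k \<and> j < k)"

text \<open>The relation \<open>part_before\<close> is a strict total order on positions (larger
  parts first, ties from the left), and \<open>leg'\<close> counts predecessors in it. So
  \<open>Suc (leg' n \<eta> k)\<close> is a rank: the place that the part at k takes in
  \<eta>^+.\<close>

lemma leg'_eq_card: "leg' n \<eta> k = card {j \<in> {1..n}. part_before \<eta> j k}"
proof -
  let ?A = "{j \<in> {1..n}. j < k \<and> \<eta> j \<ge> \<eta> k}" and ?B = "{j \<in> {1..n}. j > k \<and> \<eta> j > \<eta> k}"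
  have "part_before \<eta> j k \<longleftrightarrow> (j < k \<and> \<eta> j \<ge> \<eta> k) \<or> (j > k \<and> \<eta> j > \<eta> k)" for j
    unfolding part_before_def by (cases j k rule: linorder_cases) auto
  then have "{j \<in> {1..n}. part_before \<eta> j k} = ?A \<union> ?B" by auto
  moreover have "card (?A \<union> ?B) = card ?A + card ?B"
    by (rule card_Un_disjoint) auto
  ultimately show ?thesis
    unfolding leg'_def by (simp only:)
qed

lemma leg'_less:
  assumes "part_before \<eta> j k" "j \<in> {1..n}"
  shows "leg' n \<eta> j < leg' n \<eta> k"
  unfolding leg'_eq_card
proof (rule psubset_card_mono)
  have "part_before \<eta> i k" if "part_before \<eta> i j" for i
    using that assms(1) unfolding part_before_def by linarith
  moreover have "\<not> part_before \<eta> j j" by (simp add: part_before_def)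
  ultimately show "{i \<in> {1..n}. part_before \<eta> i j} \<subset> {i \<in> {1..n}. part_before \<eta> i k}"
    using assms by blast
qed simp

lemma part_before_total: "j \<noteq> k \<Longrightarrow> part_before \<eta> j k \<or> part_before \<eta> k j"
  by (auto simp: part_before_def)

lemma leg'_lt:
  assumes "k \<in> {1..n}" shows "leg' n \<eta> k < n"
proof -
  have "leg' n \<eta> k \<le> card ({1..n} - {k})"
    unfolding leg'_eq_card by (rule card_mono) (auto simp: part_before_def)
  also have "\<dots> < n" using assms by (auto simp: card_Diff_singleton_if)
  finally show ?thesis .
qed

lemma bij_betw_rank: "bij_betw (\<lambda>k. Suc (leg' n \<eta> k)) {1..n} {1..n}"
proof -
  have inj: "inj_on (\<lambda>k. Suc (leg' n \<eta> k)) {1..n}"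
  proof (rule inj_onI, rule ccontr)
    fix j k assume "j \<in> {1..n}" "k \<in> {1..n}" "Suc (leg' n \<eta> j) = Suc (leg' n \<eta> k)" "j \<noteq> k"
    then show False using part_before_total[of j k \<eta>] leg'_less[of \<eta> j k n] leg'_less[of \<eta> k j n] by auto
  qed
  moreover have "(\<lambda>k. Suc (leg' n \<eta> k)) ` {1..n} \<subseteq> {1..n}"
    using leg'_lt[of _ n \<eta>] by (auto simp: Suc_le_eq)
  ultimately show ?thesis
    by (simp add: bij_betw_def endo_inj_surj)
qed

lemma leg'_less_iff:
  assumes "j \<in> {1..n}" "k \<in> {1..n}"
  shows "leg' n \<eta> j < leg' n \<eta> k \<longleftrightarrow> part_before \<eta> j k"
proof
  assume less: "leg' n \<eta> j < leg' n \<eta> k"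
  then have "\<not> part_before \<eta> k j" "j \<noteq> k"
    using leg'_less[of \<eta> k j n] assms by auto
  then show "part_before \<eta> j k" using part_before_total by blast
qed (use leg'_less assms in blast)

text \<open>Read in order of rank, the parts form a weakly decreasing list with the same multiset as
  \<eta>, and sorting is unique. This permutation carries sums and products over \<eta>^+ back to
  \<eta>.\<close>

lemma sorted_parts_rank:
  assumes "k \<in> {1..n}"
  shows "sorted_parts n \<eta> (Suc (leg' n \<eta> k)) = \<eta> k"
proof -
  define \<rho> where "\<rho> = (\<lambda>k. Suc (leg' n \<eta> k))"
  define g where "g = inv_into {1..n} \<rho>"
  have bij: "bij_betw \<rho> {1..n} {1..n}" unfolding \<rho>_def by (rule bij_betw_rank)
  have bijg: "bij_betw g {1..n} {1..n}" unfolding g_def by (rule bij_betw_inv_into[OF bij])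
  have \<rho>g: "\<rho> (g i) = i" "g i \<in> {1..n}" if "i \<in> {1..n}" for i
    using bij_betw_inv_into_right[OF bij that] bij_betwE[OF bijg] that by (simp_all add: g_def)
  define ys where "ys = map (\<eta> \<circ> g) [1..<Suc n]"
  have anti: "\<eta> (g i) \<ge> \<eta> (g j)" if "i \<in> {1..n}" "j \<in> {1..n}" "i < j" for i j
  proof -
    have "leg' n \<eta> (g i) < leg' n \<eta> (g j)"
      using \<rho>g(1)[OF that(1)] \<rho>g(1)[OF that(2)] that(3) unfolding \<rho>_def by linarith
    then have "part_before \<eta> (g i) (g j)" using leg'_less_iff[OF \<rho>g(2)[OF that(1)] \<rho>g(2)[OF that(2)]] by blast
    then show ?thesis by (auto simp: part_before_def)
  qed
  have "mset (map g [1..<Suc n]) = mset [1..<Suc n]"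
  proof -
    have "image_mset g (mset_set {1..n}) = mset_set (g ` {1..n})"
      by (rule image_mset_mset_set[OF bij_betw_imp_inj_on[OF bijg]])
    also have "g ` {1..n} = {1..n}" by (rule bij_betw_imp_surj_on[OF bijg])
    finally show ?thesis unfolding mset_map mset_upt atLeastLessThanSuc_atLeastAtMost .
  qed
  then have "image_mset \<eta> (mset (map g [1..<Suc n])) = image_mset \<eta> (mset [1..<Suc n])"
    by (rule arg_cong)
  then have ms: "mset (rev ys) = mset (map \<eta> [1..<Suc n])"
    unfolding ys_def mset_rev mset_map image_mset.compositionality .
  have "sorted_wrt (\<lambda>x y. y \<le> x) ys"
    unfolding sorted_wrt_iff_nth_less
  proof (intro allI impI)
    fix i j assume ij: "i < j" "j < length ys"
    then have "ys ! i = \<eta> (g (Suc i))" "ys ! j = \<eta> (g (Suc j))" by (simp_all add: ys_def del: upt_Suc)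
    moreover have "\<eta> (g (Suc j)) \<le> \<eta> (g (Suc i))"
      by (rule anti) (use ij in \<open>auto simp: ys_def simp del: upt_Suc\<close>)
    ultimately show "ys ! j \<le> ys ! i" by simp
  qed
  then have "sorted (rev ys)" by (simp add: sorted_wrt_rev)
  with ms have "sort (map \<eta> [1..<Suc n]) = rev ys" by (rule properties_for_sort)
  then have "rev (sort (map \<eta> [1..<Suc n])) = ys" by simp
  moreover have "\<rho> k \<in> {1..n}" using bij_betwE[OF bij] assms by blast
  moreover have "ys ! (\<rho> k - 1) = \<eta> k"
  proof -
    have "\<rho> k - 1 < n" "1 + (\<rho> k - 1) = \<rho> k" using \<open>\<rho> k \<in> {1..n}\<close> by auto
    moreover have "g (\<rho> k) = k" unfolding g_def by (rule bij_betw_inv_into_left[OF bij assms])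
    ultimately show ?thesis by (simp add: ys_def del: upt_Suc)
  qed
  ultimately have "sorted_parts n \<eta> (\<rho> k) = \<eta> k" unfolding sorted_parts_def by (simp only: if_True)
  then show ?thesis by (simp only: \<rho>_def)
qed

lemma sorted_parts_antimono:
  assumes "1 \<le> i" "i \<le> j" "j \<le> n"
  shows "sorted_parts n \<eta> j \<le> sorted_parts n \<eta> i"
proof -
  have "i \<in> (\<lambda>k. Suc (leg' n \<eta> k)) ` {1..n}" "j \<in> (\<lambda>k. Suc (leg' n \<eta> k)) ` {1..n}"
    unfolding bij_betw_imp_surj_on[OF bij_betw_rank[of n \<eta>]] using assms by auto
  then obtain k l where k: "k \<in> {1..n}" "i = Suc (leg' n \<eta> k)" and l: "l \<in> {1..n}" "j = Suc (leg' n \<eta> l)"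
    by auto
  show ?thesis
  proof (cases "i = j")
    case False
    then have "leg' n \<eta> k < leg' n \<eta> l" using k l assms by simp
    then have "part_before \<eta> k l" using leg'_less_iff k l by blast
    then show ?thesis using sorted_parts_rank[OF k(1), of \<eta>] sorted_parts_rank[OF l(1), of \<eta>] k l
      by (auto simp: part_before_def)
  qed simp
qed

lemma sum_sorted_parts: "(\<Sum>i=1..n. f (sorted_parts n \<eta> i)) = (\<Sum>k=1..n. f (\<eta> k))"
proof -
  have "(\<Sum>k=1..n. f (\<eta> k)) = (\<Sum>k=1..n. f (sorted_parts n \<eta> (Suc (leg' n \<eta> k))))"
    by (rule sum.cong) (simp_all add: sorted_parts_rank)
  also have "\<dots> = (\<Sum>i=1..n. f (sorted_parts n \<eta> i))"
    using sum.reindex_bij_betw[OF bij_betw_rank, of "\<lambda>i. f (sorted_parts n \<eta> i)" n \<eta>] .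
  finally show ?thesis ..
qed

text \<open>Reindexing by rank turns the row index i - 1 into \<open>leg' n \<eta> k\<close>, so the
  bracket of \<eta>^+ can be followed through changes of single parts of \<eta>.\<close>

lemma q_bracket_sorted_parts:
  "q_bracket n q t u (sorted_parts n \<eta>) =
     (\<Prod>k=1..n. \<Prod>j=1..\<eta> k. t ^ leg' n \<eta> k - q powr (real j - 1 + u))"
proof -
  have "(\<Prod>k=1..n. \<Prod>j=1..\<eta> k. t ^ leg' n \<eta> k - q powr (real j - 1 + u)) =
    (\<Prod>k=1..n. \<Prod>j=1..sorted_parts n \<eta> (Suc (leg' n \<eta> k)).
       t ^ (Suc (leg' n \<eta> k) - 1) - q powr (real j - 1 + u))"
  proof (rule prod.cong[OF refl])
    fix k assume "k \<in> {1..n}"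
    then show "(\<Prod>j=1..\<eta> k. t ^ leg' n \<eta> k - q powr (real j - 1 + u)) =
      (\<Prod>j=1..sorted_parts n \<eta> (Suc (leg' n \<eta> k)). t ^ (Suc (leg' n \<eta> k) - 1) - q powr (real j - 1 + u))"
      by (subst sorted_parts_rank) simp_all
  qed
  also have "\<dots> = (\<Prod>i=1..n. \<Prod>j=1..sorted_parts n \<eta> i. t ^ (i - 1) - q powr (real j - 1 + u))"
    using prod.reindex_bij_betw[OF bij_betw_rank,
        of "\<lambda>i. \<Prod>j=1..sorted_parts n \<eta> i. t ^ (i - 1) - q powr (real j - 1 + u)" n \<eta>] .
  finally show ?thesis unfolding q_bracket_def ..
qed

subsection \<open>An affine Bruhat order on compositions\<close>

text \<open>
  Extend \<open>\<nu>\<close> to all integers by \<open>\<nu>\<^bsub>k+n\<^esub> = \<nu>\<^sub>k + 1\<close>. Then \<open>affine_count n \<nu> p m\<close> is the number of \<open>k \<le> p\<close>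
  with \<open>\<nu>\<^sub>k \<ge> m\<close> (so the subtraction is meant to be truncated), and the raising operation is a shift.
  Unlike the order \<open>comp_less\<close>, the order defined by these counts is preserved by the raising operation:
  \<open>(3,1,1)\<close> precedes \<open>(0,3,2)\<close> in \<open>comp_less\<close>, but \<open>(1,1,4)\<close> does not precede \<open>(3,2,1)\<close>.
\<close>

definition affine_count :: "nat \<Rightarrow> (nat \<Rightarrow> nat) \<Rightarrow> nat \<Rightarrow> nat \<Rightarrow> nat" where
  "affine_count n \<nu> p m = (\<Sum>k=1..n. \<nu> k + (if k \<le> p then 1 else 0) - m)"

definition affine_le :: "nat \<Rightarrow> (nat \<Rightarrow> nat) \<Rightarrow> (nat \<Rightarrow> nat) \<Rightarrow> bool" where
  "affine_le n \<nu> \<eta> \<longleftrightarrow> \<nu> \<in> compositions n \<and> \<eta> \<in> compositions n \<and> weight n \<nu> = weight n \<eta> \<and>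
     (\<forall>p m. affine_count n \<nu> p m \<le> affine_count n \<eta> p m)"

lemma affine_count_0: "affine_count n \<nu> 0 m = (\<Sum>k=1..n. \<nu> k - m)"
  unfolding affine_count_def by (rule sum.cong) auto

text \<open>Under truncated subtraction the added 1 matters exactly when m \<le> \<nu> k. So a count
  splits into a term that depends only on the multiset of parts and a level count over the first p
  positions.\<close>

lemma affine_count_step:
  assumes "p \<le> n"
  shows "affine_count n \<nu> p m = affine_count n \<nu> 0 m + (\<Sum>k=1..p. if m \<le> \<nu> k then 1 else 0)"
proof -
  have "affine_count n \<nu> p m = (\<Sum>k=1..n. (\<nu> k - m) + (if k \<in> {1..p} then if m \<le> \<nu> k then 1 else 0 else 0))"
    unfolding affine_count_def by (intro sum.cong) auto
  also have "\<dots> = (\<Sum>k=1..n. \<nu> k - m) + (\<Sum>k\<in>{1..n} \<inter> {1..p}. if m \<le> \<nu> k then 1 else 0)"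
    unfolding sum.distrib by (subst sum.inter_restrict[symmetric]) auto
  also have "{1..n} \<inter> {1..p} = {1..p}" using assms by auto
  finally show ?thesis by (simp add: affine_count_def)
qed

lemma affine_count_beyond: "p \<ge> n \<Longrightarrow> affine_count n \<nu> p m = affine_count n \<nu> n m"
  unfolding affine_count_def by (intro sum.cong) auto

lemma affine_le_refl: "\<nu> \<in> compositions n \<Longrightarrow> affine_le n \<nu> \<nu>"
  by (simp add: affine_le_def)

lemma sum_eq_sum_levels:
  assumes "\<And>k. k \<in> S \<Longrightarrow> \<nu> k \<le> (M::nat)"
  shows "sum \<nu> S = (\<Sum>m=1..M. \<Sum>k\<in>S. if m \<le> \<nu> k then 1 else 0)"
proof -
  have "(\<Sum>m=1..M. if m \<le> \<nu> k then 1 else 0) = \<nu> k" if "k \<in> S" for k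
  proof -
    have "(\<Sum>m=1..M. if m \<le> \<nu> k then 1 else 0) = card {m \<in> {1..M}. m \<le> \<nu> k}"
      by (simp add: sum.If_cases Int_def)
    also have "{m \<in> {1..M}. m \<le> \<nu> k} = {1..\<nu> k}" using assms[OF that] by auto
    finally show ?thesis by simp
  qed
  then show ?thesis by (subst sum.swap) simp
qed

text \<open>For every m, the sum of the p largest parts is at most p m plus the truncated sum of all
  differences (part minus m). For \<eta> this is an equality when m is its p-th largest part, and
  that is the level chosen.\<close>

lemma sum_sorted_parts_mono:
  assumes H: "\<And>m. affine_count n \<nu> 0 m \<le> affine_count n \<eta> 0 m" and "p \<in> {1..n}"
  shows "(\<Sum>i=1..p. sorted_parts n \<nu> i) \<le> (\<Sum>i=1..p. sorted_parts n \<eta> i)"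
proof -
  define m where "m = sorted_parts n \<eta> p"
  have H0: "affine_count n \<mu> 0 m = (\<Sum>i=1..n. sorted_parts n \<mu> i - m)" for \<mu>
    unfolding sum_sorted_parts[of "\<lambda>x. x - m"] by (rule affine_count_0)
  have sp: "{1..n} = {1..p} \<union> {Suc p..n}" using assms by auto
  have "(\<Sum>i=1..p. sorted_parts n \<nu> i) \<le> (\<Sum>i=1..p. m + (sorted_parts n \<nu> i - m))"
    by (rule sum_mono) auto
  also have "\<dots> \<le> p * m + affine_count n \<nu> 0 m"
    unfolding H0 sum.distrib sp by (subst sum.union_disjoint) auto
  also have "\<dots> \<le> p * m + affine_count n \<eta> 0 m" using H by simp
  also have "\<dots> = (\<Sum>i=1..p. m + (sorted_parts n \<eta> i - m))"
  proof -
    have "(\<Sum>i=Suc p..n. sorted_parts n \<eta> i - m) = 0"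
      using sorted_parts_antimono[of p _ n \<eta>] assms by (auto simp: m_def)
    then show ?thesis unfolding H0 sum.distrib sp by (subst sum.union_disjoint) auto
  qed
  also have "\<dots> = (\<Sum>i=1..p. sorted_parts n \<eta> i)"
    using sorted_parts_antimono[of _ p n \<eta>] assms by (intro sum.cong) (auto simp: m_def)
  finally show ?thesis .
qed

lemma dom_less_iff:
  "dom_less n \<nu> \<eta> \<longleftrightarrow> \<nu> \<noteq> \<eta> \<and> (\<forall>p\<in>{1..n}. (\<Sum>i=1..p. \<nu> i) \<le> (\<Sum>i=1..p. \<eta> i))"
proof -
  have "(\<Sum>i=1..p. int (\<eta> i) - int (\<nu> i)) = int (\<Sum>i=1..p. \<eta> i) - int (\<Sum>i=1..p. \<nu> i)" for p
    by (simp add: sum_subtractf)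
  then show ?thesis unfolding dom_less_def by (simp only: diff_ge_0_iff_ge of_nat_le_iff)
qed

text \<open>Counts at p = 0 see only the multiset of parts and give dominance of the sorted
  compositions. If these agree, the counts reduce to the number of k \<le> p whose part is at least
  m, and summing over m \<ge> 1 gives the partial sums.\<close>

lemma affine_le_imp_comp_less:
  assumes le: "affine_le n \<nu> \<eta>" and ne: "\<nu> \<noteq> \<eta>"
  shows "comp_less n \<nu> \<eta>"
proof -
  have c: "\<nu> \<in> compositions n \<and> \<eta> \<in> compositions n \<and> weight n \<nu> = weight n \<eta>"
    using le by (simp add: affine_le_def)
  have G: "affine_count n \<nu> p m \<le> affine_count n \<eta> p m" for p m
    using le unfolding affine_le_def by blast
  show ?thesis
  proof (cases "sorted_parts n \<nu> = sorted_parts n \<eta>")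
    case False
    then have "dom_less n (sorted_parts n \<nu>) (sorted_parts n \<eta>)"
      unfolding dom_less_iff using sum_sorted_parts_mono[OF G] by blast
    then show ?thesis using c unfolding comp_less_def by blast
  next
    case True
    have H: "affine_count n \<mu> 0 m = (\<Sum>i=1..n. sorted_parts n \<mu> i - m)" for \<mu> m
      unfolding sum_sorted_parts[of "\<lambda>x. x - m"] by (rule affine_count_0)
    have H0: "affine_count n \<nu> 0 m = affine_count n \<eta> 0 m" for m unfolding H True ..
    have "(\<Sum>i=1..p. \<nu> i) \<le> (\<Sum>i=1..p. \<eta> i)" if p: "p \<in> {1..n}" for p
    proof -
      have le: "(\<Sum>k=1..p. if m \<le> \<nu> k then 1 else 0) \<le> (\<Sum>k=1..p. if m \<le> \<eta> k then 1 else (0::nat))" for m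
        using G[of p m] affine_count_step[of p n \<nu> m] affine_count_step[of p n \<eta> m] H0[of m] p by simp
      define M where "M = weight n \<eta>"
      have b: "\<mu> k \<le> M" if "k \<in> {1..p}" "weight n \<mu> = M" for k \<mu>
        using member_le_sum[of k "{1..n}" \<mu>] that p unfolding weight_def by simp
      show ?thesis
        using sum_mono[OF le, of "\<lambda>m. m" "{1..M}"]
          sum_eq_sum_levels[of "{1..p}" \<nu> M] sum_eq_sum_levels[of "{1..p}" \<eta> M] b c
        unfolding M_def by simp
    qed
    then have "dom_less n \<nu> \<eta>" unfolding dom_less_iff using ne by blast
    then show ?thesis using c True unfolding comp_less_def by blast
  qed
qed

text \<open>Partial sums up to n determine only the coordinates 1, ..., n. The third hypothesis
  supplies the others, so that \<nu> = \<mu> would force \<nu> = \<eta>.\<close>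

lemma dom_less_trans:
  assumes "dom_less n \<nu> \<eta>" "dom_less n \<eta> \<mu>" "\<And>i. i \<notin> {1..n} \<Longrightarrow> \<nu> i = \<eta> i"
  shows "dom_less n \<nu> \<mu>"
proof -
  have a: "(\<Sum>i=1..p. \<nu> i) \<le> (\<Sum>i=1..p. \<eta> i)" "(\<Sum>i=1..p. \<eta> i) \<le> (\<Sum>i=1..p. \<mu> i)"
    if "p \<in> {1..n}" for p
    using assms(1,2) that unfolding dom_less_iff by blast+
  have "\<nu> \<noteq> \<mu>"
  proof
    assume \<nu>\<mu>: "\<nu> = \<mu>"
    have eq: "(\<Sum>i=1..p. \<nu> i) = (\<Sum>i=1..p. \<eta> i)" if "p \<le> n" for p
    proof (cases "p = 0")
      case False
      then show ?thesis using a[of p] that unfolding \<nu>\<mu> by simp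
    qed simp
    have "\<nu> i = \<eta> i" for i
    proof (cases "i \<in> {1..n}")
      case True
      then obtain p where p: "i = Suc p" by (cases i) auto
      then have "p \<le> n" "Suc p \<le> n" using True by auto
      then show ?thesis using eq[of p] eq[of "Suc p"] p by simp
    qed (rule assms)
    then have "\<nu> = \<eta>" by blast
    then show False using assms(1) unfolding dom_less_iff by blast
  qed
  moreover have "(\<Sum>i=1..p. \<nu> i) \<le> (\<Sum>i=1..p. \<mu> i)" if "p \<in> {1..n}" for p
    using a[OF that] by (rule order_trans)
  ultimately show ?thesis unfolding dom_less_iff by blast
qed

lemma comp_less_irrefl: "\<not> comp_less n \<eta> \<eta>"
  by (auto simp: comp_less_def dom_less_def)

lemma comp_less_trans:
  assumes "comp_less n \<nu> \<eta>" "comp_less n \<eta> \<mu>"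
  shows "comp_less n \<nu> \<mu>"
proof -
  have s: "sorted_parts n \<nu> i = sorted_parts n \<eta> i" if "i \<notin> {1..n}" for i
    unfolding sorted_parts_def if_not_P[OF that] ..
  have c: "\<nu> i = \<eta> i" if "i \<notin> {1..n}" for i
    using that assms unfolding comp_less_def compositions_def by simp
  have "dom_less n (sorted_parts n \<nu>) (sorted_parts n \<eta>) \<Longrightarrow> dom_less n (sorted_parts n \<eta>) (sorted_parts n \<mu>)
      \<Longrightarrow> dom_less n (sorted_parts n \<nu>) (sorted_parts n \<mu>)"
    by (rule dom_less_trans[OF _ _ s])
  moreover have "dom_less n \<nu> \<eta> \<Longrightarrow> dom_less n \<eta> \<mu> \<Longrightarrow> dom_less n \<nu> \<mu>"
    by (rule dom_less_trans[OF _ _ c])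
  ultimately show ?thesis
    using assms unfolding comp_less_def by auto
qed

text \<open>Induction on the number of predecessors, which is finite and drops strictly because the
  order is transitive and irreflexive.\<close>

lemma comp_less_induct [consumes 1, case_names less]:
  assumes "\<eta> \<in> compositions n"
    and "\<And>\<eta>. \<eta> \<in> compositions n \<Longrightarrow> (\<And>\<nu>. comp_less n \<nu> \<eta> \<Longrightarrow> P \<nu>) \<Longrightarrow> P \<eta>"
  shows "P \<eta>"
  using assms(1)
proof (induction "card {\<nu>. comp_less n \<nu> \<eta>}" arbitrary: \<eta> rule: less_induct)
  case (less \<eta>)
  show ?case
  proof (rule assms(2)[OF less.prems])
    fix \<nu> assume \<nu>: "comp_less n \<nu> \<eta>"
    show "P \<nu>"
    proof (rule less.hyps)
      show "card {\<mu>. comp_less n \<mu> \<nu>} < card {\<mu>. comp_less n \<mu> \<eta>}"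
        by (rule psubset_card_mono[OF finite_comp_less])
          (use \<nu> comp_less_trans comp_less_irrefl in blast)
      show "\<nu> \<in> compositions n" using \<nu> by (simp add: comp_less_def)
    qed
  qed
qed

subsection \<open>The raising operation and adjacent transpositions\<close>

definition raise_comp :: "nat \<Rightarrow> (nat \<Rightarrow> nat) \<Rightarrow> nat \<Rightarrow> nat" where
  "raise_comp n \<nu> k = (if k \<in> {1..<n} then \<nu> (Suc k) else if k = n then Suc (\<nu> 1) else 0)"

definition swap_comp :: "nat \<Rightarrow> (nat \<Rightarrow> nat) \<Rightarrow> nat \<Rightarrow> nat" where
  "swap_comp i \<nu> = \<nu>(i := \<nu> (Suc i), Suc i := \<nu> i)"

lemma sum_raise_comp:
  assumes "n \<ge> 1"
  shows "(\<Sum>k=1..n. f k (raise_comp n \<nu> k)) = (\<Sum>k=2..n. f (k - 1) (\<nu> k)) + f n (Suc (\<nu> 1))"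
proof -
  obtain m where m: "n = Suc m" using assms by (cases n) auto
  have "(\<Sum>k=1..m. f k (\<nu> (Suc k))) = (\<Sum>k=Suc 1..Suc m. f (k - 1) (\<nu> k))"
    unfolding sum.shift_bounds_cl_Suc_ivl by simp
  then show ?thesis unfolding m by (simp add: raise_comp_def numeral_2_eq_2)
qed

lemma raise_comp_compositions:
  assumes "n \<ge> 1" shows "raise_comp n \<nu> \<in> compositions n"
  using assms by (auto simp: raise_comp_def compositions_def)

lemma weight_raise_comp:
  assumes "n \<ge> 1" shows "weight n (raise_comp n \<nu>) = Suc (weight n \<nu>)"
  using sum_raise_comp[OF assms, of "\<lambda>_ x. x" \<nu>] sum.atLeast_Suc_atMost[OF assms, of \<nu>]
  by (simp add: weight_def numeral_2_eq_2)

lemma affine_count_raise_comp: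
  assumes "n \<ge> 1" "p < n"
  shows "affine_count n (raise_comp n \<nu>) p m = affine_count n \<nu> (Suc p) m"
proof -
  have "affine_count n (raise_comp n \<nu>) p m = (\<Sum>k=2..n. \<nu> k + (if k - 1 \<le> p then 1 else 0) - m) + (Suc (\<nu> 1) - m)"
    unfolding affine_count_def
    using sum_raise_comp[OF assms(1), of "\<lambda>k x. x + (if k \<le> p then 1 else 0) - m" \<nu>] assms by simp
  also have "(\<Sum>k=2..n. \<nu> k + (if k - 1 \<le> p then 1 else 0) - m) = (\<Sum>k=2..n. \<nu> k + (if k \<le> Suc p then 1 else 0) - m)"
    by (intro sum.cong) auto
  finally show ?thesis
    unfolding affine_count_def
    by (subst sum.atLeast_Suc_atMost[OF assms(1)]) (simp add: numeral_2_eq_2)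
qed

lemma affine_count_top:
  "affine_count n \<nu> n (Suc m) = affine_count n \<nu> 0 m"
  unfolding affine_count_def by (intro sum.cong) auto

lemma affine_count_zero: 
  "affine_count n \<nu> p 0 = weight n \<nu> + min p n"
proof -
  have "affine_count n \<nu> p 0 = weight n \<nu> + (\<Sum>k=1..n. if k \<le> p then 1 else 0)"
    by (simp add: affine_count_def sum.distrib weight_def)
  also have "(\<Sum>k=1..n. if k \<le> p then 1 else 0) = card ({1..n} \<inter> {k. k \<le> p})"
    by (simp add: sum.If_cases)
  also have "{1..n} \<inter> {k. k \<le> p} = {1..min p n}" by auto
  finally show ?thesis by simp
qed

text \<open>Counts are constant beyond p = n, a count at p = n and level m + 1 is the one at p = 0
  and level m, and a count at level 0 depends only on the weight. So one period of p decides the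
  order, which makes up for the bound p < n in \<open>affine_count_raise_comp\<close>.\<close>

lemma affine_leI:
  assumes "\<nu> \<in> compositions n" "\<eta> \<in> compositions n" "weight n \<nu> = weight n \<eta>"
    and "\<And>p m. p < n \<Longrightarrow> affine_count n \<nu> p m \<le> affine_count n \<eta> p m" and "n \<ge> 1"
  shows "affine_le n \<nu> \<eta>"
proof -
  have "affine_count n \<nu> p m \<le> affine_count n \<eta> p m" for p m
  proof (cases "p < n")
    case False
    then show ?thesis
      using assms affine_count_beyond[of n p] affine_count_top affine_count_zero by (cases m) auto
  qed (use assms in auto)
  then show ?thesis using assms by (simp add: affine_le_def)
qed

lemma affine_le_raise_comp:
  assumes "affine_le n \<nu> \<eta>" "n \<ge> 1"
  shows "affine_le n (raise_comp n \<nu>) (raise_comp n \<eta>)"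
  using assms
  by (intro affine_leI) (auto simp: raise_comp_compositions weight_raise_comp affine_count_raise_comp affine_le_def)

lemma raise_comp_inj:
  assumes "raise_comp n \<nu> = raise_comp n \<eta>" "n \<ge> 1" "\<nu> \<in> compositions n" "\<eta> \<in> compositions n"
  shows "\<nu> = \<eta>"
proof
  fix k
  show "\<nu> k = \<eta> k"
  proof (cases "k \<in> {1..n}")
    case True
    then obtain j where k: "k = Suc j" "j < n" by (cases k) auto
    show ?thesis
    proof (cases j)
      case 0
      then show ?thesis using fun_cong[OF assms(1), of n] k by (simp add: raise_comp_def)
    next
      case (Suc i)
      then show ?thesis using fun_cong[OF assms(1), of j] k by (simp add: raise_comp_def)
    qed
  qed (use assms in \<open>auto simp: compositions_def\<close>)
qed

lemma leg'_permute:
  assumes bij: "bij_betw \<sigma> {1..n} {1..n}"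
    and pb: "\<And>j. j \<in> {1..n} \<Longrightarrow> part_before \<mu> j k \<longleftrightarrow> part_before \<eta> (\<sigma> j) (\<sigma> k)"
  shows "leg' n \<mu> k = leg' n \<eta> (\<sigma> k)"
proof -
  have "leg' n \<mu> k = card {j \<in> {1..n}. part_before \<eta> (\<sigma> j) (\<sigma> k)}"
    unfolding leg'_eq_card using pb by (intro arg_cong[of _ _ card]) auto
  also have "\<dots> = card (\<sigma> ` {j \<in> {1..n}. part_before \<eta> (\<sigma> j) (\<sigma> k)})"
    by (rule card_image[symmetric], rule inj_on_subset[OF bij_betw_imp_inj_on[OF bij]]) blast
  also have "\<sigma> ` {j \<in> {1..n}. part_before \<eta> (\<sigma> j) (\<sigma> k)} = {j \<in> \<sigma> ` {1..n}. part_before \<eta> j (\<sigma> k)}"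
    by blast
  finally show ?thesis unfolding bij_betw_imp_surj_on[OF bij] leg'_eq_card .
qed

text \<open>Raising respects the order of positions. If the first part ties with another one, it
  precedes it before the move and is strictly larger afterwards; if it is smaller by one, it follows
  before the move and loses the new tie by standing last.\<close>

lemma leg'_raise_comp:
  assumes "k \<in> {1..n}"
  shows "leg' n (raise_comp n \<eta>) k = (if k = n then leg' n \<eta> 1 else leg' n \<eta> (Suc k))"
proof -
  define \<sigma> where "\<sigma> = (\<lambda>j. if j = n then 1 else Suc j)"
  have bij: "bij_betw \<sigma> {1..n} {1..n}"
    using assms by (intro bij_betwI[where g = "\<lambda>j. if j = 1 then n else j - 1"]) (auto simp: \<sigma>_def)
  have pb: "part_before (raise_comp n \<eta>) j k \<longleftrightarrow> part_before \<eta> (\<sigma> j) (\<sigma> k)" if "j \<in> {1..n}" for j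
    using that assms by (auto simp: part_before_def \<sigma>_def raise_comp_def)
  show ?thesis using leg'_permute[OF bij pb] by (simp add: \<sigma>_def)
qed

lemma leg'_swap_comp:
  assumes "i \<in> {1..<n}" "\<eta> i \<noteq> \<eta> (Suc i)" "k \<in> {1..n}"
  shows "leg' n (swap_comp i \<eta>) k = leg' n \<eta> (Transposition.transpose i (Suc i) k)"
proof -
  define \<sigma> where "\<sigma> = Transposition.transpose i (Suc i)"
  have bij: "bij_betw \<sigma> {1..n} {1..n}"
    unfolding \<sigma>_def by (rule bij_betw_transpose_iff) (use assms in auto)
  have pb: "part_before (swap_comp i \<eta>) j k \<longleftrightarrow> part_before \<eta> (\<sigma> j) (\<sigma> k)" for j
    using assms by (auto simp: part_before_def \<sigma>_def swap_comp_def Transposition.transpose_def)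
  show ?thesis using leg'_permute[OF bij pb] by (simp add: \<sigma>_def)
qed

lemma affine_count_pair:
  assumes "i \<in> {1..<n}"
  shows "affine_count n \<mu> p m =
    (\<Sum>k\<in>{1..n} - {i, Suc i}. \<mu> k + (if k \<le> p then 1 else 0) - m) +
    ((\<mu> i + (if i \<le> p then 1 else 0) - m) + (\<mu> (Suc i) + (if Suc i \<le> p then 1 else 0) - m))"
proof -
  have "{1..n} = ({1..n} - {i, Suc i}) \<union> {i, Suc i}" using assms by auto
  then have "affine_count n \<mu> p m = (\<Sum>k\<in>({1..n} - {i, Suc i}) \<union> {i, Suc i}. \<mu> k + (if k \<le> p then 1 else 0) - m)"
    unfolding affine_count_def by simp
  also have "\<dots> = (\<Sum>k\<in>{1..n} - {i, Suc i}. \<mu> k + (if k \<le> p then 1 else 0) - m) +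
      (\<Sum>k\<in>{i, Suc i}. \<mu> k + (if k \<le> p then 1 else 0) - m)"
    by (rule sum.union_disjoint) auto
  finally show ?thesis by simp
qed

lemma weight_pair:
  assumes "i \<in> {1..<n}"
  shows "weight n \<mu> = (\<Sum>k\<in>{1..n} - {i, Suc i}. \<mu> k) + (\<mu> i + \<mu> (Suc i))"
  using affine_count_pair[OF assms, of \<mu> 0 0] affine_count_zero[of n \<mu> 0] assms by simp

text \<open>The lattice points between \<nu> and its transposition at i, both ends included. T_i
  x^\<nu> is a combination of the monomials with these exponents.\<close>

definition pair_segment :: "nat \<Rightarrow> (nat \<Rightarrow> nat) \<Rightarrow> (nat \<Rightarrow> nat) set" where
  "pair_segment i \<nu> = {\<nu>(i := c, Suc i := d) |c d. c + d = \<nu> i + \<nu> (Suc i) \<and>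
     min (\<nu> i) (\<nu> (Suc i)) \<le> c \<and> min (\<nu> i) (\<nu> (Suc i)) \<le> d}"

lemma swap_comp_compositions:
  "i \<in> {1..<n} \<Longrightarrow> \<eta> \<in> compositions n \<Longrightarrow> swap_comp i \<eta> \<in> compositions n"
  by (simp add: compositions_def swap_comp_def)

text \<open>Together with the support of T_i this makes the order compatible with the intertwiners.
  For p \<noteq> i the extra unit goes to both positions i, i + 1 or to neither, and the pair
  contributes a symmetric convex function, which does not grow when the pair moves inwards. Only p =
  i is delicate: there the hypothesis is used at p = i - 1, i and i + 1, where the remaining
  positions contribute equal amounts.\<close>

lemma affine_le_swap_comp:
  assumes le: "affine_le n \<nu> \<eta>" and i: "i \<in> {1..<n}" and up: "\<eta> i < \<eta> (Suc i)"
    and \<mu>: "\<mu> \<in> pair_segment i \<nu>"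
  shows "affine_le n \<mu> (swap_comp i \<eta>)" and "\<mu> = swap_comp i \<eta> \<Longrightarrow> \<nu> = \<eta>"
proof -
  obtain c d where cd: "\<mu> = \<nu>(i := c, Suc i := d)" "c + d = \<nu> i + \<nu> (Suc i)"
    "min (\<nu> i) (\<nu> (Suc i)) \<le> c" "min (\<nu> i) (\<nu> (Suc i)) \<le> d"
    using \<mu> unfolding pair_segment_def by blast
  have comp: "\<nu> \<in> compositions n" "\<eta> \<in> compositions n" and wt: "weight n \<nu> = weight n \<eta>"
    using le unfolding affine_le_def by blast+
  have G: "affine_count n \<nu> p m \<le> affine_count n \<eta> p m" for p m
    using le unfolding affine_le_def by blast
  define R where "R = (\<lambda>(\<mu> :: nat \<Rightarrow> nat) p m. \<Sum>k\<in>{1..n} - {i, Suc i}. \<mu> k + (if k \<le> p then 1 else 0) - (m::nat))"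
  define g where "g = (\<lambda>x (j::nat) p m. x + (if j \<le> p then 1 else 0) - (m::nat))"
  have cnt: "affine_count n \<mu> p m = R \<mu> p m + (g (\<mu> i) i p m + g (\<mu> (Suc i)) (Suc i) p m)" for \<mu> p m
    unfolding R_def g_def by (rule affine_count_pair[OF i])
  have R\<mu>: "R \<mu> p m = R \<nu> p m" for p m unfolding R_def cd(1) by (rule sum.cong) auto
  have R\<eta>: "R (swap_comp i \<eta>) p m = R \<eta> p m" for p m unfolding R_def swap_comp_def by (rule sum.cong) auto
  have Ri: "R \<mu> p m = R \<mu> i m" if "p = i - 1 \<or> p = Suc i" for \<mu> p m
  proof -
    have "k \<le> p \<longleftrightarrow> k \<le> i" if "k \<in> {1..n} - {i, Suc i}" for k using that \<open>p = i - 1 \<or> p = Suc i\<close> by auto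
    then show ?thesis unfolding R_def by (intro sum.cong) simp_all
  qed
  note Ri = Ri[OF disjI1[OF refl]] Ri[OF disjI2[OF refl]]
  have vals: "\<mu> i = c" "\<mu> (Suc i) = d" "swap_comp i \<eta> i = \<eta> (Suc i)" "swap_comp i \<eta> (Suc i) = \<eta> i"
    by (simp_all add: cd(1) swap_comp_def)
  show "affine_le n \<mu> (swap_comp i \<eta>)"
    unfolding affine_le_def
  proof (intro conjI allI)
    show "\<mu> \<in> compositions n" using comp i by (auto simp: cd(1) compositions_def)
    show "swap_comp i \<eta> \<in> compositions n" using comp i by (simp add: swap_comp_compositions)
    have "weight n \<mu> = weight n \<nu>"
      unfolding weight_pair[OF i, of \<mu>] weight_pair[OF i, of \<nu>] vals cd(2)
      by (simp add: cd(1))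
    moreover have "weight n (swap_comp i \<eta>) = weight n \<eta>"
      unfolding weight_pair[OF i, of "swap_comp i \<eta>"] weight_pair[OF i, of \<eta>] vals
      by (simp add: swap_comp_def)
    ultimately show "weight n \<mu> = weight n (swap_comp i \<eta>)" using wt by simp
    fix p m
    show "affine_count n \<mu> p m \<le> affine_count n (swap_comp i \<eta>) p m"
    proof (cases "p = i")
      case False
      then have eq: "i \<le> p \<longleftrightarrow> Suc i \<le> p" by auto
      have "g c i p m + g d (Suc i) p m \<le> g (\<nu> i) i p m + g (\<nu> (Suc i)) (Suc i) p m"
        unfolding g_def eq using cd(2-4) by (simp split: if_splits)
      moreover have "g (\<eta> (Suc i)) i p m + g (\<eta> i) (Suc i) p m = g (\<eta> i) i p m + g (\<eta> (Suc i)) (Suc i) p m"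
        unfolding g_def eq by simp
      ultimately show ?thesis using G[of p m] unfolding cnt R\<mu> R\<eta> vals by linarith
    next
      case True
      have 1: "R \<nu> i m + ((\<nu> i - m) + (\<nu> (Suc i) - m)) \<le> R \<eta> i m + ((\<eta> i - m) + (\<eta> (Suc i) - m))"
      proof -
        have "\<not> i \<le> i - 1" "\<not> Suc i \<le> i - 1" using i by auto
        then show ?thesis using G[of "i - 1" m] unfolding cnt Ri g_def by simp
      qed
      have 2: "R \<nu> i m + ((\<nu> i + 1 - m) + (\<nu> (Suc i) - m)) \<le> R \<eta> i m + ((\<eta> i + 1 - m) + (\<eta> (Suc i) - m))"
        using G[of i m] unfolding cnt Ri g_def by simp
      have 3: "R \<nu> i m + ((\<nu> i + 1 - m) + (\<nu> (Suc i) + 1 - m)) \<le> R \<eta> i m + ((\<eta> i + 1 - m) + (\<eta> (Suc i) + 1 - m))"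
        using G[of "Suc i" m] unfolding cnt Ri g_def by simp
      have "R \<nu> i m + ((c + 1 - m) + (d - m)) \<le> R \<eta> i m + ((\<eta> (Suc i) + 1 - m) + (\<eta> i - m))"
      proof (cases "\<nu> (Suc i) \<le> \<nu> i")
        case True
        have "(c + 1 - m) + (d - m) \<le> (\<nu> i + 1 - m) + (\<nu> (Suc i) - m)"
          using cd(2-4) True by simp
        moreover have "(\<eta> i + 1 - m) + (\<eta> (Suc i) - m) \<le> (\<eta> (Suc i) + 1 - m) + (\<eta> i - m)"
          using up by simp
        ultimately show ?thesis using 2 by linarith
      next
        case False
        then have h: "(c + 1 - m) + (d - m) \<le> (\<nu> (Suc i) + 1 - m) + (\<nu> i - m)"
          using cd(2-4) by simp
        show ?thesis
        \<comment> \<open>Up to this level the extra unit counts fully in the swapped \<eta> and at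
          most once in \<nu>, so inequality 1 suffices. Above it the pair of \<eta> contributes
          nothing even with both units, so inequality 3 suffices.\<close>
        proof (cases "m \<le> \<eta> (Suc i)")
          case True
          then have "\<eta> (Suc i) + 1 - m = (\<eta> (Suc i) - m) + 1" by simp
          moreover have "\<nu> (Suc i) + 1 - m \<le> (\<nu> (Suc i) - m) + 1" by simp
          ultimately show ?thesis using 1 h by linarith
        next
          case False
          then have "\<eta> i + 1 - m = 0" "\<eta> (Suc i) + 1 - m = 0" using up by auto
          moreover have "\<nu> i - m \<le> \<nu> i + 1 - m" by simp
          ultimately show ?thesis using 3 h by linarith
        qed
      qed
      then show ?thesis unfolding cnt R\<mu> R\<eta> vals True g_def by simp
    qed
  qed
  assume eq: "\<mu> = swap_comp i \<eta>"
  then have c: "c = \<eta> (Suc i)" "d = \<eta> i" using vals by auto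
  have off: "\<nu> k = \<eta> k" if "k \<noteq> i" "k \<noteq> Suc i" for k
    using fun_cong[OF eq, of k] that by (simp add: cd(1) swap_comp_def)
  then have "R \<nu> i (\<eta> (Suc i)) = R \<eta> i (\<eta> (Suc i))" unfolding R_def by (intro sum.cong) auto
  \<comment> \<open>At p = i and level \<eta> (Suc i) the pair of \<eta> contributes nothing, since
    \<eta> i + 1 \<le> \<eta> (Suc i). This bounds both parts of \<nu> from above, and the known sum
    and minimum leave only \<nu> = \<eta> on the pair.\<close>
  then have "(\<nu> i + 1 - \<eta> (Suc i)) + (\<nu> (Suc i) - \<eta> (Suc i)) = 0"
    using G[of i "\<eta> (Suc i)"] up unfolding cnt g_def by simp
  then have "\<nu> i = \<eta> i" "\<nu> (Suc i) = \<eta> (Suc i)"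
    using cd(2-4) up unfolding c by arith+
  then show "\<nu> = \<eta>" using off by (metis ext)
qed

subsection \<open>Hecke operators on all functions\<close>

type_synonym point_fn = "(nat \<Rightarrow> complex) \<Rightarrow> complex"

definition swap_pt :: "nat \<Rightarrow> (nat \<Rightarrow> 'a) \<Rightarrow> nat \<Rightarrow> 'a" where
  "swap_pt i x = x(i := x (Suc i), Suc i := x i)"

lemma swap_pt_simps [simp]:
  "swap_pt i x i = x (Suc i)" "swap_pt i x (Suc i) = x i"
  "k \<noteq> i \<Longrightarrow> k \<noteq> Suc i \<Longrightarrow> swap_pt i x k = x k"
  "swap_pt i (swap_pt i x) = x"
  by (auto simp: swap_pt_def)

locale macdonald_params =
  fixes n :: nat and q lam t :: real
  assumes n_pos: "n \<ge> 1" and q_pos: "0 < q" and q_less_1: "q < 1" and lam_pos: "lam > 0"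
    and t_eq: "t = q powr lam"
begin

lemma t_pos: "0 < t" and t_less_1: "t < 1"
proof -
  show "0 < t" using q_pos by (simp add: t_eq)
  have "q powr lam < 1 powr lam" by (rule powr_less_mono2) (use q_pos q_less_1 lam_pos in auto)
  then show "t < 1" by (simp add: t_eq)
qed

abbreviation gen :: "(nat \<Rightarrow> complex) \<Rightarrow> bool" where "gen \<equiv> generic_point n q"

text \<open>The substitution behind \<omega>: \<open>omega_op n q f x\<close> equals
  \<open>f (rot x)\<close>, as \<open>omega_op_eq\<close> shows.\<close>

definition rot :: "(nat \<Rightarrow> complex) \<Rightarrow> nat \<Rightarrow> complex" where
  "rot x k = (if k = 1 then of_real q * x n else if k \<in> {2..n} then x (k - 1) else x k)"

lemma genD: "gen x \<Longrightarrow> i \<in> {1..n} \<Longrightarrow> j \<in> {1..n} \<Longrightarrow> i \<noteq> j \<Longrightarrow> x i \<noteq> of_real (q powi k) * x j"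
  unfolding generic_point_def by blast

lemma gen_neq: "gen x \<Longrightarrow> i \<in> {1..n} \<Longrightarrow> j \<in> {1..n} \<Longrightarrow> i \<noteq> j \<Longrightarrow> x i \<noteq> x j"
  using genD[of x i j 0] by simp

lemma gen_comp_inj:
  assumes "gen x" "inj_on \<sigma> {1..n}" "\<sigma> ` {1..n} \<subseteq> {1..n}" "\<And>i. i \<in> {1..n} \<Longrightarrow> y i = of_real (q powi e i) * x (\<sigma> i)"
  shows "gen y"
  unfolding generic_point_def
proof (intro ballI allI impI)
  fix i j k assume ij: "i \<in> {1..n}" "j \<in> {1..n}" "i \<noteq> j"
  have q0: "q \<noteq> 0" using q_pos by simp
  show "y i \<noteq> of_real (q powi k) * y j"
  proof
    assume eq: "y i = of_real (q powi k) * y j"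
    have "x (\<sigma> i) = of_real (q powi (- e i)) * y i"
      using assms(4)[OF ij(1)] q0 by (simp add: power_int_minus)
    also have "\<dots> = of_real (q powi (- e i + k + e j)) * x (\<sigma> j)"
    proof -
      have "q powi (- e i) * (q powi k * q powi e j) = q powi (- e i + k + e j)"
        by (simp only: power_int_add[OF disjI1[OF q0]] mult.assoc)
      then show ?thesis
        unfolding eq assms(4)[OF ij(2)] by (metis (no_types, lifting) mult.assoc of_real_mult)
    qed
    finally have "x (\<sigma> i) = of_real (q powi (- e i + k + e j)) * x (\<sigma> j)" .
    moreover have "\<sigma> i \<in> {1..n}" "\<sigma> j \<in> {1..n}" "\<sigma> i \<noteq> \<sigma> j"
      using assms(3) ij inj_onD[OF assms(2) _ ij(1,2)] by blast+
    ultimately show False using genD[OF assms(1)] by blast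
  qed
qed

lemma gen_swap_pt: "i \<in> {1..<n} \<Longrightarrow> gen (swap_pt i x) \<longleftrightarrow> gen x"
proof -
  assume i: "i \<in> {1..<n}"
  have *: "gen (swap_pt i x)" if "gen x" for x
    by (rule gen_comp_inj[OF that, of "Transposition.transpose i (Suc i)" _ "\<lambda>_. 0"])
      (use i in \<open>auto simp: Transposition.transpose_def swap_pt_def inj_on_def split: if_splits\<close>)
  show ?thesis using *[of x] *[of "swap_pt i x"] by auto
qed

lemma gen_rot: "gen x \<Longrightarrow> gen (rot x)"
  by (rule gen_comp_inj[of x "\<lambda>k. if k = 1 then n else k - 1" _ "\<lambda>k. if k = 1 then 1 else 0"])
    (use n_pos in \<open>auto simp: rot_def inj_on_def split: if_splits\<close>)

text \<open>
  \<open>TT i\<close>, \<open>TI i\<close>, \<open>XX i\<close> and \<open>OM\<close> are \<open>T\<^sub>i\<close>, its inverse, the multiplication by \<open>x\<^sub>i\<close> and \<open>\<omega>\<close> at the generic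
  points. Off the generic points they act through the one-dimensional representation
  \<open>T\<^sub>i = t\<close>, \<open>x\<^sub>i = 0\<close>, \<open>\<omega> = 1\<close>, so that the Hecke relations are equalities of operators on
  all functions.
\<close>

definition TT :: "nat \<Rightarrow> point_fn \<Rightarrow> point_fn" where
  "TT i f x = (if gen x then T_op t i f x else of_real t * f x)"

definition TI :: "nat \<Rightarrow> point_fn \<Rightarrow> point_fn" where
  "TI i f x = (if gen x then (T_op t i f x - (of_real t - 1) * f x) / of_real t else f x / of_real t)"

definition XX :: "nat \<Rightarrow> point_fn \<Rightarrow> point_fn" where
  "XX i f x = (if gen x then x i * f x else 0)"

definition OM :: "point_fn \<Rightarrow> point_fn" where
  "OM f x = (if gen x then f (rot x) else f x)"

text \<open>The coefficient of s_i in T_i, for a = x_i and b = x_(i+1). The identities that follow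
  are scalar forms of the Hecke relations: symmetry serves the quadratic relation, the cocycle
  identity the braid relation.\<close>

definition hecke_coeff :: "complex \<Rightarrow> complex \<Rightarrow> complex" where
  "hecke_coeff a b = (of_real t * a - b) / (a - b)"

lemma T_op_hecke_coeff: "T_op t i f x = of_real t * f x + hecke_coeff (x i) (x (Suc i)) * (f (swap_pt i x) - f x)"
  by (simp add: T_op_def s_op_def hecke_coeff_def swap_pt_def)

lemma hecke_coeff_sym: "a \<noteq> b \<Longrightarrow> hecke_coeff a b + hecke_coeff b a = 1 + of_real t"
  unfolding hecke_coeff_def by (simp add: divide_simps) (simp add: algebra_simps)

lemma hecke_coeff_mult: "a \<noteq> b \<Longrightarrow> hecke_coeff a b * (a - b) = of_real t * a - b"
  by (simp add: hecke_coeff_def)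

text \<open>Each factor is (t - 1) times a single variable over a difference, and both sides collect
  the same numerator a b c.\<close>

lemma hecke_coeff_cocycle:
  assumes "a \<noteq> b" "b \<noteq> c" "a \<noteq> c"
  shows "(hecke_coeff a c - 1) * (hecke_coeff a b - of_real t) * (hecke_coeff b c - of_real t) =
    (hecke_coeff a c - of_real t) * (hecke_coeff a b - 1) * (hecke_coeff b c - 1)"
proof -
  have 1: "hecke_coeff a b - 1 = (of_real t - 1) * a / (a - b)" "hecke_coeff a b - of_real t = (of_real t - 1) * b / (a - b)" if "a \<noteq> b" for a b
    unfolding hecke_coeff_def using that by (simp_all add: field_simps)
  show ?thesis unfolding 1[OF assms(1)] 1[OF assms(2)] 1[OF assms(3)] by simp
qed

lemma hecke_coeff_scale: "c \<noteq> 0 \<Longrightarrow> hecke_coeff (c * a) (c * b) = hecke_coeff a b"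
  unfolding hecke_coeff_def by (metis (no_types, opaque_lifting) mult.left_commute mult_divide_mult_cancel_left right_diff_distrib)

lemma TT_linear: "TT i (\<lambda>x. c * f x + d * g x) = (\<lambda>x. c * TT i f x + d * TT i g x)"
  by (simp add: TT_def T_op_hecke_coeff fun_eq_iff algebra_simps)

lemma TI_linear: "TI i (\<lambda>x. c * f x + d * g x) = (\<lambda>x. c * TI i f x + d * TI i g x)"
  using t_pos by (simp add: TI_def T_op_hecke_coeff fun_eq_iff algebra_simps add_divide_distrib diff_divide_distrib)

lemma OM_linear: "OM (\<lambda>x. c * f x + d * g x) = (\<lambda>x. c * OM f x + d * OM g x)"
  by (simp add: OM_def fun_eq_iff)

lemma XX_linear: "XX i (\<lambda>x. c * f x + d * g x) = (\<lambda>x. c * XX i f x + d * XX i g x)"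
  by (simp add: XX_def fun_eq_iff algebra_simps)

lemma TT_scale: "TT i (\<lambda>x. c * f x) = (\<lambda>x. c * TT i f x)"
  and TI_scale: "TI i (\<lambda>x. c * f x) = (\<lambda>x. c * TI i f x)"
  and OM_scale: "OM (\<lambda>x. c * f x) = (\<lambda>x. c * OM f x)"
  and XX_scale: "XX j (\<lambda>x. c * f x) = (\<lambda>x. c * XX j f x)"
  using TT_linear[of i c f 0 f] TI_linear[of i c f 0 f] OM_linear[of c f 0 f] XX_linear[of j c f 0 f] by simp_all

lemma swap_pt_neq:
  assumes "i \<in> {1..<n}" "gen x" shows "x i \<noteq> x (Suc i)"
  by (rule gen_neq) (use assms in auto)

lemma TT_TT:
  assumes "i \<in> {1..<n}"
  shows "TT i (TT i f) = (\<lambda>x. (of_real t - 1) * TT i f x + of_real t * f x)"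
proof
  fix x
  show "TT i (TT i f) x = (of_real t - 1) * TT i f x + of_real t * f x"
  proof (cases "gen x")
    case True
    then have g: "gen (swap_pt i x)" using gen_swap_pt[OF assms] by blast
    have "TT i (TT i f) x = T_op t i (T_op t i f) x"
      using True g by (simp add: TT_def T_op_hecke_coeff)
    then show ?thesis using T_op_T_op[of x i t f] swap_pt_neq[OF assms True] True by (simp add: TT_def)
  qed (simp add: TT_def algebra_simps)
qed

lemma TI_eq:
  "TI i f = (\<lambda>x. (1 / of_real t) * TT i f x + ((1 - of_real t) / of_real t) * f x)"
  using t_pos by (auto simp: TI_def TT_def fun_eq_iff field_simps)

lemma TT_TI [simp]: "i \<in> {1..<n} \<Longrightarrow> TT i (TI i f) = f"
  unfolding TI_eq TT_linear using t_pos by (simp add: TT_TT fun_eq_iff field_simps)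

lemma TI_TT [simp]: "i \<in> {1..<n} \<Longrightarrow> TI i (TT i f) = f"
  unfolding TI_eq using t_pos by (simp add: TT_TT fun_eq_iff field_simps)

lemma swap_pt_commute:
  assumes "Suc i < j \<or> Suc j < i"
  shows "swap_pt i (swap_pt j x) = swap_pt j (swap_pt i x)"
  using assms by (auto simp: swap_pt_def fun_eq_iff)

lemma TT_commute:
  assumes "i \<in> {1..<n}" "j \<in> {1..<n}" "Suc i < j \<or> Suc j < i"
  shows "TT i (TT j f) = TT j (TT i f)"
proof
  fix x
  have ne: "i \<noteq> j" "i \<noteq> Suc j" "Suc i \<noteq> j" "Suc i \<noteq> Suc j" using assms by auto
  show "TT i (TT j f) x = TT j (TT i f) x"
    using ne by (simp add: TT_def T_op_hecke_coeff gen_swap_pt[OF assms(1)] gen_swap_pt[OF assms(2)] swap_pt_commute[OF assms(3)]) (simp add: algebra_simps)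
qed

text \<open>Both sides at x involve f only at the six permutations of three coordinates. Comparing
  coefficients, with the three reversed Hecke coefficients eliminated by symmetry, leaves one
  nontrivial relation between p, r and s.\<close>

lemma TT_braid:
  assumes "i \<in> {1..<n}" "Suc i < n"
  shows "TT i (TT (Suc i) (TT i f)) = TT (Suc i) (TT i (TT (Suc i) f))"
proof
  fix x
  show "TT i (TT (Suc i) (TT i f)) x = TT (Suc i) (TT i (TT (Suc i) f)) x"
  proof (cases "gen x")
    case False
    then show ?thesis by (simp add: TT_def)
  next
    case True
    define P where "P = (\<lambda>a b c. x(i := a, Suc i := b, Suc (Suc i) := c))"
    define F where "F = (\<lambda>a b c. f (P a b c))"
    have i': "Suc i \<in> {1..<n}" using assms by auto
    have s: "swap_pt i (P a b c) = P b a c" "swap_pt (Suc i) (P a b c) = P a c b" for a b c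
      by (auto simp: P_def swap_pt_def fun_eq_iff)
    have T1: "TT i g (P a b c) = of_real t * g (P a b c) + hecke_coeff a b * (g (P b a c) - g (P a b c))" if "gen (P a b c)" for g a b c
    proof -
      have "P a b c i = a" "P a b c (Suc i) = b" by (auto simp: P_def)
      then show ?thesis using that s by (simp add: TT_def T_op_hecke_coeff)
    qed
    have T2: "TT (Suc i) g (P a b c) = of_real t * g (P a b c) + hecke_coeff b c * (g (P a c b) - g (P a b c))" if "gen (P a b c)" for g a b c
    proof -
      have "P a b c (Suc i) = b" "P a b c (Suc (Suc i)) = c" by (auto simp: P_def)
      then show ?thesis using that s by (simp add: TT_def T_op_hecke_coeff)
    qed
    have g: "gen (P b a c) \<longleftrightarrow> gen (P a b c)" "gen (P a c b) \<longleftrightarrow> gen (P a b c)" for a b c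
      using gen_swap_pt[OF assms(1), of "P a b c"] gen_swap_pt[OF i', of "P a b c"] s by auto
    define a where "a = x i"
    define b where "b = x (Suc i)"
    define c where "c = x (Suc (Suc i))"
    have x: "x = P a b c" by (auto simp: P_def a_def b_def c_def)
    have G: "gen (P a b c)" using True x by simp
    have G6: "gen (P a c b)" "gen (P b a c)" "gen (P b c a)" "gen (P c a b)" "gen (P c b a)"
      using G g by metis+
    have ne: "a \<noteq> b" "b \<noteq> c" "a \<noteq> c"
      using gen_neq[OF True] assms by (auto simp: a_def b_def c_def)
    define p r s w where "p = hecke_coeff a b" and "r = hecke_coeff a c" and "s = hecke_coeff b c" and "w = complex_of_real t"
    have K: "hecke_coeff a b = p" "hecke_coeff a c = r" "hecke_coeff b c = s" "hecke_coeff b a = 1 + w - p" "hecke_coeff c a = 1 + w - r" "hecke_coeff c b = 1 + w - s"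
      using hecke_coeff_sym ne by (simp_all add: p_def r_def s_def w_def algebra_simps eq_diff_eq)
    have "(r - 1) * (p - w) * (s - w) = (r - w) * (p - 1) * (s - 1)"
      using hecke_coeff_cocycle[OF ne] by (simp add: p_def r_def s_def w_def)
    \<comment> \<open>The cocycle identity is 1 - w times the relation needed; t < 1 permits the
      cancellation.\<close>
    then have "(1 - w) * (r * (p + s - 1 - w)) = (1 - w) * (p * s - w)" by algebra
    moreover have "1 - w \<noteq> 0" using t_less_1 by (simp add: w_def)
    ultimately have rel: "r * (p + s - 1 - w) = p * s - w" by simp
    define f1 f2 f3 f4 f5 f6 where "f1 = f (P a b c)" and "f2 = f (P a c b)" and "f3 = f (P b a c)"
      and "f4 = f (P b c a)" and "f5 = f (P c a b)" and "f6 = f (P c b a)"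
    note fs = f1_def[symmetric] f2_def[symmetric] f3_def[symmetric] f4_def[symmetric] f5_def[symmetric] f6_def[symmetric]
    show ?thesis
      unfolding x by (simp only: T1[OF G] T1[OF G6(1)] T1[OF G6(2)] T1[OF G6(3)] T1[OF G6(4)] T1[OF G6(5)] 
         T2[OF G] T2[OF G6(1)] T2[OF G6(2)] T2[OF G6(3)] T2[OF G6(4)] T2[OF G6(5)] K w_def[symmetric] fs)
       (use rel in algebra)
  qed
qed

lemma TT_XX_TT:
  assumes "i \<in> {1..<n}"
  shows "TT i (XX i (TT i f)) = (\<lambda>x. of_real t * XX (Suc i) f x)"
proof
  fix x
  show "TT i (XX i (TT i f)) x = of_real t * XX (Suc i) f x"
  proof (cases "gen x")
    case True
    have ne: "x i \<noteq> x (Suc i)" by (rule swap_pt_neq[OF assms True])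
    define a b p w where "a = x i" and "b = x (Suc i)" and "p = hecke_coeff (x i) (x (Suc i))" and "w = complex_of_real t"
    have K: "hecke_coeff (x (Suc i)) (x i) = 1 + w - p" using hecke_coeff_sym[OF ne] by (simp add: p_def w_def algebra_simps eq_diff_eq)
    have m: "p * (a - b) = w * a - b" using hecke_coeff_mult[OF ne] by (simp add: p_def w_def a_def b_def)
    define u v where "u = f x" and "v = f (swap_pt i x)"
    have "TT i (XX i (TT i f)) x = w * (a * (w * u + p * (v - u))) + p * (b * (w * v + (1 + w - p) * (u - v)) - a * (w * u + p * (v - u)))"
      using True by (simp add: TT_def XX_def T_op_hecke_coeff gen_swap_pt[OF assms] K) (simp add: a_def b_def p_def w_def u_def v_def)
    also have "\<dots> = w * (b * u)" using m by algebra
    finally show ?thesis using True by (simp add: XX_def w_def b_def u_def)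
  qed (simp add: TT_def XX_def)
qed

lemma TT_XX:
  assumes "i \<in> {1..<n}" "j \<noteq> i" "j \<noteq> Suc i"
  shows "TT i (XX j f) = XX j (TT i f)"
  using assms(2,3) by (auto simp: fun_eq_iff TT_def XX_def T_op_hecke_coeff gen_swap_pt[OF assms(1)] algebra_simps)

lemma TT_XX_eq:
  assumes "i \<in> {1..<n}"
  shows "TT i (XX i f) = (\<lambda>x. of_real t * XX (Suc i) (TI i f) x)"
  using TT_XX_TT[OF assms, of "TI i f"] assms by simp

lemma TI_XX_Suc:
  assumes "i \<in> {1..<n}"
  shows "TI i (XX (Suc i) f) = (\<lambda>x. (1 / of_real t) * XX i (TT i f) x)"
proof -
  have "XX (Suc i) f = (\<lambda>x. (1 / of_real t) * TT i (XX i (TT i f)) x)"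
    unfolding TT_XX_TT[OF assms] using t_pos by simp
  then show ?thesis using TI_scale TI_TT[OF assms] by metis
qed

lemma TI_conj:
  assumes i: "i \<in> {1..<n}" and j: "j \<in> {1..<n}" and eq: "\<And>f. TT i (F f) = F (TT j f)"
  shows "TI i (F f) = F (TI j f)"
  using eq[of "TI j f"] TI_TT[OF i, of "F (TI j f)"] TT_TI[OF j, of f] by simp

lemma rot_simps:
  "rot x 1 = of_real q * x n"
  "k \<in> {1..<n} \<Longrightarrow> rot x (Suc k) = x k"
  by (auto simp: rot_def)

lemma rot_swap_pt:
  assumes "i \<ge> 1" "Suc i < n"
  shows "rot (swap_pt i x) = swap_pt (Suc i) (rot x)"
proof
  fix k
  consider "k = Suc i" | "k = Suc (Suc i)" | "k = 1" | "k \<noteq> Suc i" "k \<noteq> Suc (Suc i)" "k \<noteq> 1" by blast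
  then show "rot (swap_pt i x) k = swap_pt (Suc i) (rot x) k"
  proof cases
    case 4
    then show ?thesis using assms by (auto simp: rot_def swap_pt_def)
  qed (use assms in \<open>simp_all add: rot_def swap_pt_def\<close>)
qed

lemma TT_OM:
  assumes "i \<ge> 1" "Suc i < n"
  shows "TT i (OM f) = OM (TT (Suc i) f)"
proof
  fix x
  have i: "i \<in> {1..<n}" "Suc i \<in> {1..<n}" using assms by auto
  show "TT i (OM f) x = OM (TT (Suc i) f) x"
    by (simp add: TT_def OM_def T_op_hecke_coeff gen_swap_pt[OF i(1)] gen_swap_pt[OF i(2)] gen_rot rot_swap_pt[OF assms] rot_simps(2)[OF i(1)] rot_simps(2)[OF i(2)])
qed

lemma rot_rot_swap_pt:
  assumes "n \<ge> 2"
  shows "rot (rot (swap_pt (n - 1) x)) = swap_pt 1 (rot (rot x))"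
proof
  fix k
  consider "k = 1" | "k = 2" | "k \<in> {3..n}" | "k = 0 \<or> k > n" by force
  then show "rot (rot (swap_pt (n - 1) x)) k = swap_pt 1 (rot (rot x)) k"
  proof cases
    case 1
    then show ?thesis using assms by (simp add: rot_def swap_pt_def)
  next
    case 2
    then show ?thesis using assms by (simp add: rot_def swap_pt_def)
  next
    case 3
    then have "k - 1 \<in> {2..n}" "k \<in> {2..n}" "k - 1 - 1 \<noteq> n - 1" "k - 1 - 1 \<noteq> Suc (n - 1)" "k \<noteq> 1" "k - 1 \<noteq> 1" "k \<noteq> Suc 1"
      using assms by auto
    then show ?thesis unfolding rot_def swap_pt_def by (simp only: if_True if_False fun_upd_apply)
  next
    case 4
    then have "k \<notin> {2..n}" "k \<noteq> n - 1" "k \<noteq> Suc (n - 1)" "k \<noteq> 1" "k \<noteq> Suc 1"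
      using assms by auto
    then show ?thesis unfolding rot_def swap_pt_def by (simp only: if_True if_False fun_upd_apply)
  qed
qed

text \<open>Two rotations bring x_(n-1) and x_n to positions 1 and 2, both multiplied by q, and the
  Hecke coefficient is homogeneous of degree 0.\<close>

lemma OM_OM_TT:
  assumes "n \<ge> 2"
  shows "TT (n - 1) (OM (OM f)) = OM (OM (TT 1 f))"
proof
  fix x
  have i: "n - 1 \<in> {1..<n}" "1 \<in> {1..<n}" and n: "Suc (n - 1) = n" using assms by auto
  have r: "rot (rot x) 1 = of_real q * x (n - 1)" "rot (rot x) (Suc 1) = of_real q * x n"
    using rot_simps(2)[of "n - 1" x] rot_simps(2)[of 1 "rot x"] i assms by (simp_all add: rot_simps(1)[unfolded One_nat_def])
  have K: "hecke_coeff (rot (rot x) 1) (rot (rot x) (Suc 1)) = hecke_coeff (x (n - 1)) (x n)"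
    unfolding r by (rule hecke_coeff_scale) (use q_pos in simp)
  show "TT (n - 1) (OM (OM f)) x = OM (OM (TT 1 f)) x"
  proof (cases "gen x")
    case True
    then have g: "gen (rot x)" "gen (rot (rot x))" "gen (swap_pt (n - 1) x)" "gen (rot (swap_pt (n - 1) x))"
      using gen_rot gen_swap_pt[OF i(1)] by blast+
    have OO: "OM (OM h) y = h (rot (rot y))" if "gen y" "gen (rot y)" for h y
      using that by (simp add: OM_def)
    show ?thesis
      unfolding OO[OF True g(1)] TT_def T_op_hecke_coeff OO[OF g(3,4)] K n rot_rot_swap_pt[OF assms]
      using True g by (simp only: if_True)
  qed (simp add: TT_def OM_def)
qed

lemma OM_XX: "i \<in> {1..<n} \<Longrightarrow> OM (XX (Suc i) f) = XX i (OM f)"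
  by (auto simp: fun_eq_iff OM_def XX_def gen_rot rot_simps)

lemma OM_XX_1: "OM (XX 1 f) = (\<lambda>x. of_real q * XX n (OM f) x)"
  by (auto simp: fun_eq_iff OM_def XX_def gen_rot rot_simps(1)[unfolded One_nat_def])

end

section \<open>The operators Y_i and their relations with T_i and the raising operator\<close>

context macdonald_params
begin

definition TTs :: "nat list \<Rightarrow> point_fn \<Rightarrow> point_fn" where
  "TTs js = foldr (\<circ>) (map TT js) id"

definition TIs :: "nat list \<Rightarrow> point_fn \<Rightarrow> point_fn" where
  "TIs js = foldr (\<circ>) (map TI js) id"

lemma TTs_simps [simp]: "TTs [] f = f" "TTs (j # js) f = TT j (TTs js f)"
  by (simp_all add: TTs_def)

lemma TIs_simps [simp]: "TIs [] f = f" "TIs (j # js) f = TI j (TIs js f)"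
  by (simp_all add: TIs_def)

lemma TTs_append: "TTs (xs @ ys) f = TTs xs (TTs ys f)"
  by (induction xs) simp_all

lemma TIs_append: "TIs (xs @ ys) f = TIs xs (TIs ys f)"
  by (induction xs) simp_all

lemma TTs_linear: "TTs js (\<lambda>x. c * f x + d * g x) = (\<lambda>x. c * TTs js f x + d * TTs js g x)"
  by (induction js) (simp_all add: TT_linear)

lemma TIs_linear: "TIs js (\<lambda>x. c * f x + d * g x) = (\<lambda>x. c * TIs js f x + d * TIs js g x)"
  by (induction js) (simp_all add: TI_linear)

lemma TTs_scale: "TTs js (\<lambda>x. c * f x) = (\<lambda>x. c * TTs js f x)"
  and TIs_scale: "TIs js (\<lambda>x. c * f x) = (\<lambda>x. c * TIs js f x)"
  using TTs_linear[of js c f 0 f] TIs_linear[of js c f 0 f] by simp_all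

lemma TTs_comm:
  assumes "\<And>j g. j \<in> set js \<Longrightarrow> TT j (F g) = F (TT j g)"
  shows "TTs js (F f) = F (TTs js f)"
  using assms by (induction js) simp_all

lemma TIs_comm:
  assumes "\<And>j g. j \<in> set js \<Longrightarrow> TI j (F g) = F (TI j g)"
  shows "TIs js (F f) = F (TIs js f)"
  using assms by (induction js) simp_all

lemma TI_XX:
  assumes "i \<in> {1..<n}" "j \<noteq> i" "j \<noteq> Suc i"
  shows "TI i (XX j f) = XX j (TI i f)"
  by (rule TI_conj[OF assms(1) assms(1)]) (rule TT_XX[OF assms])

lemma TI_TT_commute:
  assumes "i \<in> {1..<n}" "j \<in> {1..<n}" "Suc i < j \<or> Suc j < i"
  shows "TI i (TT j f) = TT j (TI i f)"
  by (rule TI_conj[OF assms(1) assms(1)]) (rule TT_commute[OF assms])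

lemma TI_OM:
  assumes "i \<ge> 1" "Suc i < n"
  shows "TI i (OM f) = OM (TI (Suc i) f)"
  by (rule TI_conj) (use assms TT_OM in auto)

lemma OM_OM_TI:
  assumes "n \<ge> 2"
  shows "TI (n - 1) (OM (OM f)) = OM (OM (TI 1 f))"
  by (rule TI_conj[where F = "\<lambda>f. OM (OM f)"]) (use assms OM_OM_TT in auto)

lemma TI_TI_TT:
  assumes "i \<in> {1..<n}" "Suc i < n"
  shows "TI i (TI (Suc i) (TT i f)) = TT (Suc i) (TI i (TI (Suc i) f))"
proof -
  have i': "Suc i \<in> {1..<n}" using assms by auto
  define g where "g = TI i (TI (Suc i) f)"
  have "f = TT (Suc i) (TT i g)" unfolding g_def using assms(1) i' by simp
  then have "TT i f = TT (Suc i) (TT i (TT (Suc i) g))" using TT_braid[OF assms, of g] by simp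
  then show ?thesis using assms(1) i' by (simp add: g_def)
qed

definition YY :: "nat \<Rightarrow> point_fn \<Rightarrow> point_fn" where
  "YY i f = (\<lambda>x. of_real (t powi (int i - int n)) * TTs [i..<n] (OM (TIs [1..<i] f)) x)"

definition PH :: "point_fn \<Rightarrow> point_fn" where
  "PH f = XX n (OM f)"

lemma YY_linear: "YY i (\<lambda>x. c * f x + d * g x) = (\<lambda>x. c * YY i f x + d * YY i g x)"
  by (simp add: YY_def TTs_linear TIs_linear OM_linear fun_eq_iff algebra_simps)

lemma YY_scale: "YY i (\<lambda>x. c * f x) = (\<lambda>x. c * YY i f x)"
  using YY_linear[of i c f 0 f] by simp

lemma PH_scale: "PH (\<lambda>x. c * f x) = (\<lambda>x. c * PH f x)"
  by (simp add: PH_def OM_scale XX_scale)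

lemma TTs_OM:
  assumes "i \<ge> 1" "m < n"
  shows "OM (TTs [Suc i..<Suc m] f) = TTs [i..<m] (OM f)"
  using assms
proof (induction "m - i" arbitrary: i)
  case 0
  then show ?case by simp
next
  case (Suc k)
  then have "[Suc i..<Suc m] = Suc i # [Suc (Suc i)..<Suc m]" "[i..<m] = i # [Suc i..<m]"
    "k = m - Suc i" "Suc i < n"
    by (simp_all add: upt_conv_Cons del: upt_Suc)
  moreover have "OM (TTs [Suc (Suc i)..<Suc m] f) = TTs [Suc i..<m] (OM f)"
    by (rule Suc.hyps(1)) (use calculation Suc.prems in auto)
  ultimately show ?case
    using TT_OM[of i "TTs [Suc (Suc i)..<Suc m] f"] Suc.prems by (simp del: upt_Suc)
qed

lemma TIs_OM:
  assumes "i \<ge> 1" "m < n"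
  shows "OM (TIs [Suc i..<Suc m] f) = TIs [i..<m] (OM f)"
  using assms
proof (induction "m - i" arbitrary: i)
  case 0
  then show ?case by simp
next
  case (Suc k)
  then have "[Suc i..<Suc m] = Suc i # [Suc (Suc i)..<Suc m]" "[i..<m] = i # [Suc i..<m]"
    "k = m - Suc i" "Suc i < n"
    by (simp_all add: upt_conv_Cons del: upt_Suc)
  moreover have "OM (TIs [Suc (Suc i)..<Suc m] f) = TIs [Suc i..<m] (OM f)"
    by (rule Suc.hyps(1)) (use calculation Suc.prems in auto)
  ultimately show ?case
    using TI_OM[of i "TIs [Suc (Suc i)..<Suc m] f"] Suc.prems by (simp del: upt_Suc)
qed

text \<open>The factor x_n passes the inverses, becomes x_(n-1) under \<omega>, and T_(n-1) x_(n-1)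
  = t x_n T_(n-1)^(-1) turns the last T into an inverse, the t accounting for the change of
  normalisation. That inverse crosses \<omega>^2 as T_1^(-1) and completes the product of inverses
  in Y_(i+1).\<close>

lemma YY_PH:
  assumes "i \<in> {1..<n}"
  shows "YY i (PH f) = PH (YY (Suc i) f)"
proof -
  define m where "m = n - 1"
  have m: "n = Suc m" "m \<ge> 1" "i \<le> m" "m \<in> {1..<n}" using assms by (auto simp: m_def)
  have split: "[i..<n] = [i..<m] @ [m]" using m by simp
  have split2: "[1..<Suc i] = 1 # [2..<Suc i]" using assms by (simp add: upt_conv_Cons numeral_2_eq_2)
  have a: "TIs [1..<i] (XX n g) = XX n (TIs [1..<i] g)" for g
    by (rule TIs_comm) (use assms in \<open>auto intro!: TI_XX\<close>)
  have b: "TTs [i..<m] (XX n g) = XX n (TTs [i..<m] g)" for g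
    by (rule TTs_comm, rule TT_XX) (use assms m in auto)
  have "YY i (PH f) = (\<lambda>x. of_real (t powi (int i - int n)) * TTs [i..<m] (TT m (XX m (OM (TIs [1..<i] (OM f))))) x)"
  proof -
    have "OM (XX n g) = XX m (OM g)" for g using OM_XX[OF m(4)] m(1) by simp
    then show ?thesis by (simp add: YY_def PH_def a[unfolded One_nat_def] split TTs_append)
  qed
  also have "\<dots> = (\<lambda>x. of_real (t powi (int i - int n)) * (of_real t * XX n (TTs [i..<m] (TI m (OM (TIs [1..<i] (OM f))))) x))"
    unfolding TT_XX_eq[OF m(4)] TTs_scale m(1)[symmetric] b ..
  also have "\<dots> = (\<lambda>x. of_real (t powi (int (Suc i) - int n)) * XX n (TTs [i..<m] (TI m (OM (TIs [1..<i] (OM f))))) x)"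
  proof -
    have "t powi (int (Suc i) - int n) = t powi (int i - int n) * t"
      using t_pos power_int_add_1[of t "int i - int n"] by (simp add: algebra_simps)
    then show ?thesis by (simp add: mult.assoc)
  qed
  also have "TI m (OM (TIs [1..<i] (OM f))) = OM (OM (TIs [1..<Suc i] f))"
  proof -
    have "TIs [1..<i] (OM f) = OM (TIs [2..<Suc i] f)"
      using TIs_OM[of 1 i f] assms by (simp add: numeral_2_eq_2)
    moreover have "n \<ge> 2" and mn: "n - 1 = m" using m by auto
    ultimately show ?thesis
      using OM_OM_TI[of "TIs [2..<Suc i] f"] unfolding split2 mn by (simp only: TIs_simps)
  qed
  also have "TTs [i..<m] (OM (OM (TIs [1..<Suc i] f))) = OM (TTs [Suc i..<n] (OM (TIs [1..<Suc i] f)))"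
    using TTs_OM[of i m] assms m by (simp del: upt_Suc)
  finally show ?thesis by (simp add: YY_def PH_def OM_scale XX_scale del: upt_Suc)
qed

lemma TIs_XX:
  assumes "m < n"
  shows "TIs [1..<Suc m] (XX (Suc m) f) = (\<lambda>x. (1 / of_real t) ^ m * XX 1 (TTs [1..<Suc m] f) x)"
  using assms
proof (induction m arbitrary: f)
  case (Suc m)
  then have m: "Suc m \<in> {1..<n}" by auto
  have "TIs [1..<Suc (Suc m)] (XX (Suc (Suc m)) f) = TIs [1..<Suc m] (TI (Suc m) (XX (Suc (Suc m)) f))"
    by (simp add: TIs_append)
  also have "\<dots> = (\<lambda>x. (1 / of_real t) * ((1 / of_real t) ^ m * XX 1 (TTs [1..<Suc m] (TT (Suc m) f)) x))"
    unfolding TI_XX_Suc[OF m] TIs_scale using Suc by simp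
  finally show ?case by (simp add: TTs_append)
qed simp

text \<open>T_j^(-1) x_(j+1) = t^(-1) x_j T_j, applied n - 1 times, lowers x_n to x_1 and converts
  all inverses into T_j; the powers of t form the normalisation of Y_1. The q comes from \<omega>
  x_1 = q x_n \<omega>.\<close>

lemma YY_n_PH: "YY n (PH f) = (\<lambda>x. of_real q * PH (YY 1 f) x)"
proof -
  obtain m where m: "n = Suc m" using n_pos by (cases n) auto
  have "YY n (PH f) = OM (TIs [1..<n] (XX n (OM f)))"
    by (simp add: YY_def PH_def)
  also have "\<dots> = (\<lambda>x. (1 / of_real t) ^ m * (of_real q * XX n (OM (TTs [1..<n] (OM f))) x))"
  proof -
    have "m < n" using m by simp
    then have "TIs [1..<n] (XX n (OM f)) = (\<lambda>x. (1 / of_real t) ^ m * XX 1 (TTs [1..<n] (OM f)) x)"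
      by (rule TIs_XX[of m, folded m])
    then show ?thesis by (simp only: OM_scale OM_XX_1)
  qed
  also have "(1 / of_real t) ^ m = complex_of_real (t powi (int 1 - int n))"
    using t_pos by (simp add: m power_int_minus power_one_over inverse_eq_divide)
  finally show ?thesis by (simp add: YY_def PH_def OM_scale XX_scale mult.left_commute)
qed

lemma TIs_TT_high:
  assumes "i \<in> {1..<n}" "Suc i < k" "k \<le> n"
  shows "TIs [1..<k] (TT i f) = TT (Suc i) (TIs [1..<k] f)"
proof -
  have "[1..<k] = [1..<i] @ [i..<k]" using assms upt_add_eq_append[of 1 i "k - i"] by simp
  also have "[i..<k] = [i, Suc i] @ [Suc (Suc i)..<k]" using assms by (simp add: upt_conv_Cons)
  finally have split: "[1..<k] = [1..<i] @ [i, Suc i] @ [Suc (Suc i)..<k]" .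
  have a: "TIs [Suc (Suc i)..<k] (TT i g) = TT i (TIs [Suc (Suc i)..<k] g)" for g
    by (rule TIs_comm) (use assms in \<open>auto intro!: TI_TT_commute\<close>)
  have b: "TIs [1..<i] (TT (Suc i) g) = TT (Suc i) (TIs [1..<i] g)" for g
    by (rule TIs_comm) (use assms in \<open>auto intro!: TI_TT_commute\<close>)
  show ?thesis unfolding split TIs_append a using TI_TI_TT[of i] assms b by simp
qed

lemma TTs_TT_high:
  assumes "k \<ge> 1" "k \<le> i" "Suc i < n"
  shows "TTs [k..<n] (TT i f) = TT (Suc i) (TTs [k..<n] f)"
proof -
  have "[k..<n] = [k..<i] @ [i..<n]" using assms upt_add_eq_append[of k i "n - i"] by simp
  also have "[i..<n] = [i, Suc i] @ [Suc (Suc i)..<n]" using assms by (simp add: upt_conv_Cons)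
  finally have split: "[k..<n] = [k..<i] @ [i, Suc i] @ [Suc (Suc i)..<n]" .
  have a: "TTs [Suc (Suc i)..<n] (TT i g) = TT i (TTs [Suc (Suc i)..<n] g)" for g
    by (rule TTs_comm) (use assms in \<open>auto intro!: TT_commute\<close>)
  have b: "TTs [k..<i] (TT (Suc i) g) = TT (Suc i) (TTs [k..<i] g)" for g
    by (rule TTs_comm) (use assms in \<open>auto intro!: TT_commute\<close>)
  show ?thesis unfolding split TTs_append a using TT_braid[of i] assms b by simp
qed

text \<open>The index of T_i is raised once and lowered once. For k < i, \<omega> lowers it and the
  product T_k ... T_(n-1) raises it by the braid relation; for k > i + 1 the product of inverses
  raises it and \<omega> lowers it.\<close>

lemma YY_TT_commute:
  assumes "i \<in> {1..<n}" "k \<in> {1..n}" "k \<noteq> i" "k \<noteq> Suc i"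
  shows "YY k (TT i f) = TT i (YY k f)"
proof -
  consider "k < i" | "Suc i < k" using assms by force
  then have "TTs [k..<n] (OM (TIs [1..<k] (TT i f))) = TT i (TTs [k..<n] (OM (TIs [1..<k] f)))"
  proof cases
    case 1
    then obtain j where j: "i = Suc j" "1 \<le> j" "k \<le> j" using assms by (cases i) auto
    have a: "TIs [1..<k] (TT i g) = TT i (TIs [1..<k] g)" for g
      by (rule TIs_comm) (use assms 1 in \<open>auto intro!: TI_TT_commute\<close>)
    have b: "OM (TT i g) = TT j (OM g)" for g using TT_OM[of j g] j assms by simp
    have c: "TTs [k..<n] (TT j g) = TT i (TTs [k..<n] g)" for g
      using TTs_TT_high[of k j g] j assms by simp
    show ?thesis unfolding a b c ..
  next
    case 2
    have a: "TTs [k..<n] (TT i g) = TT i (TTs [k..<n] g)" for g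
      by (rule TTs_comm) (use assms 2 in \<open>auto intro!: TT_commute\<close>)
    have b: "TIs [1..<k] (TT i f) = TT (Suc i) (TIs [1..<k] f)"
      by (rule TIs_TT_high) (use assms 2 in auto)
    have c: "OM (TT (Suc i) g) = TT i (OM g)" for g
      by (rule TT_OM[symmetric]) (use assms 2 in auto)
    show ?thesis unfolding b c a ..
  qed
  then show ?thesis by (simp add: YY_def TT_scale)
qed

lemma TT_YY_Suc_TT:
  assumes "i \<in> {1..<n}"
  shows "TT i (YY (Suc i) (TT i f)) = (\<lambda>x. of_real t * YY i f x)"
proof -
  have "TIs [1..<Suc i] (TT i f) = TIs [1..<i] f"
    using assms by (simp add: TIs_append)
  moreover have "TTs [i..<n] g = TT i (TTs [Suc i..<n] g)" for g
    using assms by (simp add: upt_conv_Cons)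
  moreover have "t powi (int (Suc i) - int n) = t * t powi (int i - int n)"
    using t_pos power_int_add_1[of t "int i - int n"] by (simp add: algebra_simps)
  ultimately show ?thesis by (simp add: YY_def TT_scale mult.assoc del: upt_Suc)
qed

lemma YY_Suc_TT:
  assumes "i \<in> {1..<n}"
  shows "YY (Suc i) (TT i f) = (\<lambda>x. TT i (YY i f) x - (of_real t - 1) * YY i f x)"
proof -
  have "YY (Suc i) (TT i f) = TI i (\<lambda>x. of_real t * YY i f x)"
    using TT_YY_Suc_TT[OF assms, of f] TI_TT[OF assms] by metis
  also have "\<dots> = (\<lambda>x. of_real t * TI i (YY i f) x)" by (rule TI_scale)
  also have "\<dots> = (\<lambda>x. TT i (YY i f) x - (of_real t - 1) * YY i f x)"
  proof
    fix x
    show "of_real t * TI i (YY i f) x = TT i (YY i f) x - (of_real t - 1) * YY i f x"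
      using t_pos by (simp add: TI_eq field_simps)
  qed
  finally show ?thesis .
qed

lemma YY_TT:
  assumes "i \<in> {1..<n}"
  shows "YY i (TT i f) = (\<lambda>x. TT i (YY (Suc i) f) x + (of_real t - 1) * YY i f x)"
proof
  fix x
  have "YY (Suc i) (TT i (TT i f)) = (\<lambda>x. (of_real t - 1) * YY (Suc i) (TT i f) x + of_real t * YY (Suc i) f x)"
    unfolding TT_TT[OF assms] YY_linear ..
  then have "TT i (YY (Suc i) (TT i (TT i f))) x = (of_real t - 1) * TT i (YY (Suc i) (TT i f)) x + of_real t * TT i (YY (Suc i) f) x"
    by (simp only: TT_linear)
  then have "of_real t * YY i (TT i f) x = of_real t * (TT i (YY (Suc i) f) x + (of_real t - 1) * YY i f x)"
    unfolding TT_YY_Suc_TT[OF assms] by (simp add: algebra_simps)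
  then show "YY i (TT i f) x = TT i (YY (Suc i) f) x + (of_real t - 1) * YY i f x"
    using t_pos by simp
qed

text \<open>The relations give Y_i T_i f = \<beta> T_i f + (t - 1) \<alpha> f, and the condition on
  c says exactly that adding c f makes this an eigenvector with eigenvalue \<beta>.\<close>

lemma YY_intertwiner:
  assumes i: "i \<in> {1..<n}" and \<alpha>: "YY i f = (\<lambda>x. \<alpha> * f x)" and \<beta>: "YY (Suc i) f = (\<lambda>x. \<beta> * f x)"
    and c: "c * (\<beta> - \<alpha>) = (of_real t - 1) * \<alpha>"
  defines "g \<equiv> (\<lambda>x. TT i f x + c * f x)"
  shows "YY i g = (\<lambda>x. \<beta> * g x)" and "YY (Suc i) g = (\<lambda>x. \<alpha> * g x)"
proof -
  have g: "g = (\<lambda>x. 1 * TT i f x + c * f x)" by (simp add: g_def)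
  show "YY i g = (\<lambda>x. \<beta> * g x)"
    unfolding g YY_linear YY_TT[OF i] \<alpha> \<beta> TT_scale using c
    by (auto simp: fun_eq_iff algebra_simps) algebra
  show "YY (Suc i) g = (\<lambda>x. \<alpha> * g x)"
    unfolding g YY_linear YY_Suc_TT[OF i] \<alpha> \<beta> TT_scale using c
    by (auto simp: fun_eq_iff algebra_simps) algebra
qed

text \<open>Cutting off outside the generic points turns an identity that holds at generic points
  into an equality of functions, to which the operators \<open>TT\<close>, \<open>TI\<close>,
  \<open>XX\<close>, \<open>OM\<close> and their relations apply.\<close>

definition mask :: "point_fn \<Rightarrow> point_fn" where
  "mask f x = (if gen x then f x else 0)"

definition gen_eq :: "point_fn \<Rightarrow> point_fn \<Rightarrow> bool" where
  "gen_eq f g \<longleftrightarrow> (\<forall>x. gen x \<longrightarrow> f x = g x)"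

lemma gen_eq_TT:
  assumes "gen_eq f g" "i \<in> {1..<n}" shows "gen_eq (TT i f) (T_op t i g)"
  using assms gen_swap_pt[OF assms(2)] by (simp add: gen_eq_def TT_def T_op_hecke_coeff)

lemma gen_eq_TI:
  assumes "gen_eq f g" "i \<in> {1..<n}" shows "gen_eq (TI i f) (inv (T_op t i) g)"
  unfolding gen_eq_def
proof (intro allI impI)
  fix x assume x: "gen x"
  define h where "h = inv (T_op t i) g"
  have h: "T_op t i h = g"
    unfolding h_def using bij_T_op[of t i] t_pos by (simp add: bij_is_surj surj_f_inv_f)
  have "T_op t i g x = (of_real t - 1) * g x + of_real t * h x"
    using T_op_T_op[of x i t h] swap_pt_neq[OF assms(2) x] h by simp
  moreover have "T_op t i f x = T_op t i g x"
    using assms x gen_swap_pt[OF assms(2)] by (simp add: gen_eq_def T_op_hecke_coeff)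
  ultimately show "TI i f x = inv (T_op t i) g x"
    using x t_pos assms(1) by (simp add: TI_def h_def[symmetric] gen_eq_def field_simps)
qed

lemma gen_eq_TTs:
  assumes "gen_eq f g" "set js \<subseteq> {1..<n}" shows "gen_eq (TTs js f) (foldr (\<circ>) (map (T_op t) js) id g)"
  using assms by (induction js) (simp_all add: gen_eq_TT)

lemma gen_eq_TIs:
  assumes "gen_eq f g" "set js \<subseteq> {1..<n}"
  shows "gen_eq (TIs js f) (foldr (\<circ>) (map (\<lambda>j. inv (T_op t j)) js) id g)"
  using assms by (induction js) (simp_all add: gen_eq_TI)

lemma s_ops_eq:
  "m \<ge> 1 \<Longrightarrow> foldr (\<circ>) (map s_op (rev [1..<m])) id g x =
     g (\<lambda>k. if k = 1 then x m else if k \<in> {2..m} then x (k - 1) else x k)"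
proof (induction m arbitrary: x rule: nat_induct_at_least)
  case base
  have "(\<lambda>k. if k = 1 then x 1 else if k \<in> {2..1} then x (k - 1) else x k) = x" by auto
  then show ?case by simp
next
  case (Suc m)
  let ?y = "x(m := x (Suc m), Suc m := x m)"
  have "(\<lambda>k. if k = 1 then ?y m else if k \<in> {2..m} then ?y (k - 1) else ?y k) =
    (\<lambda>k. if k = 1 then x (Suc m) else if k \<in> {2..Suc m} then x (k - 1) else x k)"
    using Suc.hyps by (auto simp: fun_eq_iff le_Suc_eq)
  moreover have "foldr (\<circ>) (map s_op (rev [1..<Suc m])) id g x = s_op m (foldr (\<circ>) (map s_op (rev [1..<m])) id g) x"
    using Suc.hyps by simp
  moreover have "\<dots> = foldr (\<circ>) (map s_op (rev [1..<m])) id g ?y"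
    by (simp only: s_op_def)
  ultimately show ?case using Suc.IH[of ?y] by (simp only:)
qed

lemma omega_op_eq: "omega_op n q g x = g (rot x)"
proof -
  let ?y = "\<lambda>k. if k = 1 then x n else if k \<in> {2..n} then x (k - 1) else x k"
  have "?y(1 := of_real q * ?y 1) = rot x" by (auto simp: rot_def fun_eq_iff)
  then show ?thesis using s_ops_eq[OF n_pos, of "tau_op q 1 g" x] by (simp add: omega_op_def tau_op_def)
qed

lemma gen_eq_OM: "gen_eq f g \<Longrightarrow> gen_eq (OM f) (omega_op n q g)"
  by (simp add: gen_eq_def OM_def omega_op_eq gen_rot)

lemma gen_eq_YY:
  assumes "gen_eq f g" "i \<in> {1..n}" shows "gen_eq (YY i f) (Y_op n q t i g)"
proof -
  have "gen_eq (TTs [i..<n] (OM (TIs [1..<i] f)))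
    (foldr (\<circ>) (map (T_op t) [i..<n]) id (omega_op n q (foldr (\<circ>) (map (\<lambda>j. inv (T_op t j)) [1..<i]) id g)))"
    by (intro gen_eq_TTs gen_eq_OM gen_eq_TIs assms(1)) (use assms in auto)
  then show ?thesis by (simp add: gen_eq_def YY_def Y_op_def)
qed

lemma YY_not_gen: "\<not> gen x \<Longrightarrow> f x = 0 \<Longrightarrow> YY i f x = 0"
proof -
  assume x: "\<not> gen x" "f x = 0"
  have "TIs js f x = 0" for js using x by (induction js) (simp_all add: TI_def)
  then have "OM (TIs [1..<i] f) x = 0" using x by (simp add: OM_def)
  then have "TTs js (OM (TIs [1..<i] f)) x = 0" for js using x by (induction js) (simp_all add: TT_def)
  then show ?thesis by (simp add: YY_def)
qed

text \<open>Translates the pointwise eigenvalue condition of the definition into the operator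
  calculus. Outside the generic points both sides of the operator equation vanish.\<close>

lemma YY_mask_eigen_iff:
  assumes "i \<in> {1..n}"
  shows "YY i (mask f) = (\<lambda>x. c * mask f x) \<longleftrightarrow> (\<forall>x. gen x \<longrightarrow> Y_op n q t i f x = c * f x)"
proof -
  have "gen_eq (YY i (mask f)) (Y_op n q t i f)"
    by (rule gen_eq_YY[OF _ assms]) (simp add: gen_eq_def mask_def)
  then have "YY i (mask f) x = (if gen x then Y_op n q t i f x else 0)" for x
    using YY_not_gen[of x "mask f" i] by (simp add: gen_eq_def mask_def)
  then show ?thesis by (auto simp: fun_eq_iff mask_def)
qed

end

subsection \<open>Polynomial functions\<close>

lemma finite_subsingleton:
  assumes "\<And>x y. x \<in> S \<Longrightarrow> y \<in> S \<Longrightarrow> x = y" shows "finite S"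
proof (cases "S = {}")
  case False
  then obtain x where "S \<subseteq> {x}" using assms by blast
  then show ?thesis by (rule finite_subset) simp
qed simp

definition fspan :: "('a \<Rightarrow> point_fn) \<Rightarrow> 'a set \<Rightarrow> point_fn \<Rightarrow> bool" where
  "fspan F S f \<longleftrightarrow> (\<exists>b. f = (\<lambda>x. \<Sum>\<nu>\<in>S. b \<nu> * F \<nu> x))"

lemma fspan_linear:
  assumes "fspan F S f" "fspan F S g"
  shows "fspan F S (\<lambda>x. c * f x + d * g x)"
proof -
  obtain a b where "f = (\<lambda>x. \<Sum>\<nu>\<in>S. a \<nu> * F \<nu> x)" "g = (\<lambda>x. \<Sum>\<nu>\<in>S. b \<nu> * F \<nu> x)"
    using assms unfolding fspan_def by blast
  then have "c * f x + d * g x = (\<Sum>\<nu>\<in>S. (c * a \<nu> + d * b \<nu>) * F \<nu> x)" for x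
    by (simp only: sum_distrib_left sum.distrib[symmetric] distrib_right mult.assoc)
  then show ?thesis unfolding fspan_def by (intro exI[of _ "\<lambda>\<nu>. c * a \<nu> + d * b \<nu>"]) simp
qed

lemma fspan_0: "fspan F S (\<lambda>x. 0)"
  unfolding fspan_def by (rule exI[of _ "\<lambda>_. 0"]) simp

lemma fspan_add: "fspan F S f \<Longrightarrow> fspan F S g \<Longrightarrow> fspan F S (\<lambda>x. f x + g x)"
  using fspan_linear[of F S f g 1 1] by simp

lemma fspan_diff: "fspan F S f \<Longrightarrow> fspan F S g \<Longrightarrow> fspan F S (\<lambda>x. f x - g x)"
  using fspan_linear[of F S f g 1 "-1"] by simp

lemma fspan_scale: "fspan F S f \<Longrightarrow> fspan F S (\<lambda>x. c * f x)"
  using fspan_linear[of F S f f c 0] by simp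

lemma fspan_sum:
  assumes "\<And>j. j \<in> J \<Longrightarrow> fspan F S (f j)"
  shows "fspan F S (\<lambda>x. \<Sum>j\<in>J. f j x)"
proof (cases "finite J")
  case True
  then show ?thesis using assms by (induction J) (simp_all add: fspan_0 fspan_add)
qed (simp add: fspan_0)

lemma fspan_mono:
  assumes "fspan F S f" "S \<subseteq> S'" "finite S'"
  shows "fspan F S' f"
proof -
  obtain b where f: "f = (\<lambda>x. \<Sum>\<nu>\<in>S. b \<nu> * F \<nu> x)" using assms unfolding fspan_def by blast
  have "(\<Sum>\<nu>\<in>S. b \<nu> * F \<nu> x) = (\<Sum>\<nu>\<in>S'. (if \<nu> \<in> S then b \<nu> else 0) * F \<nu> x)" for x
    using assms(2,3) by (intro sum.mono_neutral_cong_left) auto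
  then show ?thesis unfolding f fspan_def by (intro exI[of _ "\<lambda>\<nu>. if \<nu> \<in> S then b \<nu> else 0"]) simp
qed

lemma fspan_base:
  assumes "\<nu> \<in> S" "finite S" shows "fspan F S (F \<nu>)"
  by (rule fspan_mono[of F "{\<nu>}"]) (use assms in \<open>auto simp: fspan_def intro!: exI[of _ "\<lambda>_. 1"]\<close>)

lemma fspan_trans:
  assumes "fspan F S f" "\<And>\<nu>. \<nu> \<in> S \<Longrightarrow> fspan G S' (F \<nu>)"
  shows "fspan G S' f"
proof -
  obtain b where f: "f = (\<lambda>x. \<Sum>\<nu>\<in>S. b \<nu> * F \<nu> x)" using assms unfolding fspan_def by blast
  show ?thesis unfolding f by (intro fspan_sum fspan_scale assms(2))
qed

lemma pair_power_sum:
  fixes u v :: "'a::comm_ring_1"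
  assumes "k \<ge> 1"
  shows "(u - v) * (\<Sum>j=1..<k. u ^ j * v ^ (k - j)) = u ^ k * v - u * v ^ k"
  using assms
proof (induction k rule: nat_induct_at_least)
  case (Suc k)
  have "(\<Sum>j=1..<k. u ^ j * v ^ (Suc k - j)) = v * (\<Sum>j=1..<k. u ^ j * v ^ (k - j))"
    unfolding sum_distrib_left by (rule sum.cong) (simp_all add: Suc_diff_le mult.left_commute)
  then have "(u - v) * (\<Sum>j=1..<Suc k. u ^ j * v ^ (Suc k - j)) =
      v * ((u - v) * (\<Sum>j=1..<k. u ^ j * v ^ (k - j))) + (u - v) * (u ^ k * v)"
    using Suc.hyps by (simp add: algebra_simps)
  then show ?case unfolding Suc.IH by (simp add: algebra_simps)
qed simp

text \<open>Writing w u - v = w (u - v) + (w - 1) v reduces the quotient to a geometric sum. The end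
  terms are kept apart because they belong to the ends of the segment, where the leading coefficient
  is read off.\<close>

lemma pair_divided_difference:
  fixes u v w :: "'a::field"
  assumes "k \<ge> 1" "u \<noteq> v"
  shows "(w * u - v) / (u - v) * (u ^ k - v ^ k) =
    w * u ^ k - v ^ k + (w - 1) * (\<Sum>j=1..<k. u ^ j * v ^ (k - j))"
proof -
  define h where "h = (\<Sum>j=1..<k. u ^ j * v ^ (k - j))"
  have "(u - v) * h = u ^ k * v - u * v ^ k" unfolding h_def by (rule pair_power_sum[OF assms(1)])
  moreover define U V where "U = u ^ k" and "V = v ^ k"
  ultimately have "(u - v) * h = U * v - u * V" by simp
  then have "(w * u - v) * (U - V) = (w * U - V + (w - 1) * h) * (u - v)" by algebra
  then show ?thesis using assms(2) unfolding h_def[symmetric] U_def[symmetric] V_def[symmetric]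
    by (simp add: nonzero_divide_eq_eq)
qed

lemma monomial_fn_pair:
  assumes "i \<in> {1..<n}"
  shows "monomial_fn n (\<nu>(i := c, Suc i := d)) x =
    (\<Prod>k\<in>{1..n} - {i, Suc i}. x k ^ \<nu> k) * (x i ^ c * x (Suc i) ^ d)"
proof -
  let ?\<mu> = "\<nu>(i := c, Suc i := d)"
  have "{1..n} = ({1..n} - {i, Suc i}) \<union> {i, Suc i}" using assms by auto
  then have "monomial_fn n ?\<mu> x = (\<Prod>k\<in>({1..n} - {i, Suc i}) \<union> {i, Suc i}. x k ^ ?\<mu> k)"
    unfolding monomial_fn_def by simp
  also have "\<dots> = (\<Prod>k\<in>{1..n} - {i, Suc i}. x k ^ ?\<mu> k) * (\<Prod>k\<in>{i, Suc i}. x k ^ ?\<mu> k)"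
    by (rule prod.union_disjoint) auto
  also have "(\<Prod>k\<in>{1..n} - {i, Suc i}. x k ^ ?\<mu> k) = (\<Prod>k\<in>{1..n} - {i, Suc i}. x k ^ \<nu> k)"
    by (rule prod.cong) auto
  also have "(\<Prod>k\<in>{i, Suc i}. x k ^ ?\<mu> k) = x i ^ c * x (Suc i) ^ d" by simp
  finally show ?thesis .
qed

lemma finite_pair_segment: "finite (pair_segment i \<nu>)"
proof -
  have "pair_segment i \<nu> \<subseteq> (\<lambda>(c, d). \<nu>(i := c, Suc i := d)) ` ({..\<nu> i + \<nu> (Suc i)} \<times> {..\<nu> i + \<nu> (Suc i)})"
  proof
    fix \<mu> assume "\<mu> \<in> pair_segment i \<nu>"
    then obtain c d where "\<mu> = \<nu>(i := c, Suc i := d)" "c + d = \<nu> i + \<nu> (Suc i)"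
      unfolding pair_segment_def by blast
    then show "\<mu> \<in> (\<lambda>(c, d). \<nu>(i := c, Suc i := d)) ` ({..\<nu> i + \<nu> (Suc i)} \<times> {..\<nu> i + \<nu> (Suc i)})"
      by (intro image_eqI[of _ _ "(c, d)"]) auto
  qed
  then show ?thesis by (rule finite_subset) simp
qed

section \<open>The action of T_i and of the raising operator on monomials, and density of generic
  points\<close>

context macdonald_params
begin

lemma T_op_monomial:
  fixes \<nu> :: "nat \<Rightarrow> nat" and x :: "nat \<Rightarrow> complex"
  assumes i: "i \<in> {1..<n}"
  defines "m \<equiv> (\<lambda>c d. monomial_fn n (\<nu>(i := c, Suc i := d)))"
  assumes x: "x i \<noteq> x (Suc i)"
  shows "\<nu> i < \<nu> (Suc i) \<Longrightarrow> T_op t i (monomial_fn n \<nu>) x =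
      of_real t * m (\<nu> (Suc i)) (\<nu> i) x + ((of_real t - 1) * m (\<nu> i) (\<nu> (Suc i)) x +
        (\<Sum>j=1..<\<nu> (Suc i) - \<nu> i. (of_real t - 1) * m (\<nu> i + j) (\<nu> (Suc i) - j) x))"
    and "\<nu> i = \<nu> (Suc i) \<Longrightarrow> T_op t i (monomial_fn n \<nu>) x = of_real t * m (\<nu> i) (\<nu> (Suc i)) x"
    and "\<nu> (Suc i) < \<nu> i \<Longrightarrow> T_op t i (monomial_fn n \<nu>) x =
      m (\<nu> (Suc i)) (\<nu> i) x + (\<Sum>j=1..<\<nu> i - \<nu> (Suc i). (1 - of_real t) * m (\<nu> (Suc i) + j) (\<nu> i - j) x)"
proof -
  define R where "R = (\<Prod>k\<in>{1..n} - {i, Suc i}. x k ^ \<nu> k)"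
  define u v w where "u = x i" and "v = x (Suc i)" and "w = complex_of_real t"
  have uv: "u \<noteq> v" using x by (simp add: u_def v_def)
  have m: "m c d x = R * (u ^ c * v ^ d)" for c d
    unfolding m_def R_def u_def v_def by (rule monomial_fn_pair[OF i])
  have \<nu>: "monomial_fn n \<nu> = m (\<nu> i) (\<nu> (Suc i))" by (simp add: m_def)
  have ms: "m c d (swap_pt i x) = R * (v ^ c * u ^ d)" for c d
    unfolding m_def monomial_fn_pair[OF i] R_def u_def v_def
    by (intro arg_cong2[of _ _ _ _ "(*)"] prod.cong) auto
  define D where "D = (w * u - v) / (u - v)"
  have T: "T_op t i (monomial_fn n \<nu>) x = R * (w * (u ^ \<nu> i * v ^ \<nu> (Suc i)) +
      D * (v ^ \<nu> i * u ^ \<nu> (Suc i) - u ^ \<nu> i * v ^ \<nu> (Suc i)))"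
    unfolding T_op_hecke_coeff \<nu> m ms hecke_coeff_def u_def[symmetric] v_def[symmetric] w_def[symmetric] D_def[symmetric]
    by (simp add: algebra_simps)
  {
    assume "\<nu> i = \<nu> (Suc i)"
    then show "T_op t i (monomial_fn n \<nu>) x = of_real t * m (\<nu> i) (\<nu> (Suc i)) x"
      unfolding T m w_def by (simp add: mult.commute)
  next
    assume less: "\<nu> i < \<nu> (Suc i)"
    define a k where "a = \<nu> i" and "k = \<nu> (Suc i) - \<nu> i"
    have k: "k \<ge> 1" "\<nu> (Suc i) = a + k" using less by (auto simp: a_def k_def)
    have h: "(\<Sum>j=1..<k. (w - 1) * (R * (u ^ (a + j) * v ^ (a + k - j)))) =
        R * (u ^ a * v ^ a) * ((w - 1) * (\<Sum>j=1..<k. u ^ j * v ^ (k - j)))"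
      unfolding sum_distrib_left
    proof (rule sum.cong[OF refl])
      fix j assume "j \<in> {1..<k}"
      then have "a + k - j = a + (k - j)" by simp
      then show "(w - 1) * (R * (u ^ (a + j) * v ^ (a + k - j))) = R * (u ^ a * v ^ a) * ((w - 1) * (u ^ j * v ^ (k - j)))"
        by (simp add: power_add)
    qed
    have "v ^ a * u ^ (a + k) - u ^ a * v ^ (a + k) = u ^ a * v ^ a * (u ^ k - v ^ k)"
      by (simp add: power_add algebra_simps)
    then have "T_op t i (monomial_fn n \<nu>) x =
        R * (u ^ a * v ^ a) * (w * v ^ k + D * (u ^ k - v ^ k))"
      unfolding T k(2) a_def[symmetric] by (simp add: power_add algebra_simps)
    also have "\<dots> = w * (R * (u ^ (a + k) * v ^ a)) + ((w - 1) * (R * (u ^ a * v ^ (a + k))) +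
        R * (u ^ a * v ^ a) * ((w - 1) * (\<Sum>j=1..<k. u ^ j * v ^ (k - j))))"
      unfolding D_def pair_divided_difference[OF k(1) uv] by (simp add: power_add algebra_simps)
    finally show "T_op t i (monomial_fn n \<nu>) x =
      of_real t * m (\<nu> (Suc i)) (\<nu> i) x + ((of_real t - 1) * m (\<nu> i) (\<nu> (Suc i)) x +
        (\<Sum>j=1..<\<nu> (Suc i) - \<nu> i. (of_real t - 1) * m (\<nu> i + j) (\<nu> (Suc i) - j) x))"
      unfolding k_def[symmetric] unfolding m w_def[symmetric] k(2) a_def[symmetric] h .
  next
    assume less: "\<nu> (Suc i) < \<nu> i"
    define a k where "a = \<nu> (Suc i)" and "k = \<nu> i - \<nu> (Suc i)"
    have k: "k \<ge> 1" "\<nu> i = a + k" using less by (auto simp: a_def k_def)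
    have h: "(\<Sum>j=1..<k. (1 - w) * (R * (u ^ (a + j) * v ^ (a + k - j)))) =
        R * (u ^ a * v ^ a) * ((1 - w) * (\<Sum>j=1..<k. u ^ j * v ^ (k - j)))"
      unfolding sum_distrib_left
    proof (rule sum.cong[OF refl])
      fix j assume "j \<in> {1..<k}"
      then have "a + k - j = a + (k - j)" by simp
      then show "(1 - w) * (R * (u ^ (a + j) * v ^ (a + k - j))) = R * (u ^ a * v ^ a) * ((1 - w) * (u ^ j * v ^ (k - j)))"
        by (simp add: power_add)
    qed
    have "v ^ (a + k) * u ^ a - u ^ (a + k) * v ^ a = - (u ^ a * v ^ a * (u ^ k - v ^ k))"
      by (simp add: power_add algebra_simps)
    then have "T_op t i (monomial_fn n \<nu>) x =
        R * (u ^ a * v ^ a) * (w * u ^ k - D * (u ^ k - v ^ k))"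
      unfolding T k(2) a_def[symmetric] by (simp add: power_add algebra_simps)
    also have "\<dots> = R * (u ^ a * v ^ (a + k)) +
        R * (u ^ a * v ^ a) * ((1 - w) * (\<Sum>j=1..<k. u ^ j * v ^ (k - j)))"
      unfolding D_def pair_divided_difference[OF k(1) uv] by (simp add: power_add algebra_simps)
    finally show "T_op t i (monomial_fn n \<nu>) x =
      m (\<nu> (Suc i)) (\<nu> i) x + (\<Sum>j=1..<\<nu> i - \<nu> (Suc i). (1 - of_real t) * m (\<nu> (Suc i) + j) (\<nu> i - j) x)"
      unfolding k_def[symmetric] unfolding m w_def[symmetric] k(2) a_def[symmetric] h .
  }
qed

text \<open>At an ascent the swapped monomial has coefficient exactly t. This is the source of the
  factor t in front of the swapped polynomial in \<open>E_swap\<close>.\<close>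

lemma T_monomial_leading:
  assumes i: "i \<in> {1..<n}" and less: "\<nu> i < \<nu> (Suc i)"
  obtains g where "fspan (monomial_fn n) (pair_segment i \<nu> - {swap_comp i \<nu>}) g"
    "\<And>x. x i \<noteq> x (Suc i) \<Longrightarrow>
       T_op t i (monomial_fn n \<nu>) x = of_real t * monomial_fn n (swap_comp i \<nu>) x + g x"
proof
  let ?S = "pair_segment i \<nu> - {swap_comp i \<nu>}"
  have fin: "finite ?S" using finite_pair_segment by simp
  let ?g = "\<lambda>x. (of_real t - 1) * monomial_fn n (\<nu>(i := \<nu> i, Suc i := \<nu> (Suc i))) x +
        (\<Sum>j=1..<\<nu> (Suc i) - \<nu> i. (of_real t - 1) * monomial_fn n (\<nu>(i := \<nu> i + j, Suc i := \<nu> (Suc i) - j)) x)"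
  have in_S: "\<nu>(i := c, Suc i := d) \<in> ?S" if "c + d = \<nu> i + \<nu> (Suc i)" "\<nu> i \<le> c" "\<nu> i < d" for c d
  proof -
    have "\<nu>(i := c, Suc i := d) \<in> pair_segment i \<nu>" unfolding pair_segment_def using that less by force
    moreover have "\<nu>(i := c, Suc i := d) \<noteq> swap_comp i \<nu>"
      using that less by (auto simp: swap_comp_def dest: fun_cong[of _ _ "Suc i"])
    ultimately show ?thesis by simp
  qed
  show "fspan (monomial_fn n) ?S ?g"
    by (intro fspan_add fspan_scale fspan_sum fspan_base[OF _ fin] in_S) (use less in auto)
  show "T_op t i (monomial_fn n \<nu>) x = of_real t * monomial_fn n (swap_comp i \<nu>) x + ?g x"
    if "x i \<noteq> x (Suc i)" for x
    unfolding T_op_monomial(1)[of i x \<nu>, OF i that less] by (simp add: swap_comp_def)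
qed

lemma T_monomial:
  assumes i: "i \<in> {1..<n}"
  obtains g where "fspan (monomial_fn n) (pair_segment i \<nu>) g"
    "\<And>x. x i \<noteq> x (Suc i) \<Longrightarrow> T_op t i (monomial_fn n \<nu>) x = g x"
proof -
  have fin: "finite (pair_segment i \<nu>)" by (rule finite_pair_segment)
  have in_S: "\<nu>(i := c, Suc i := d) \<in> pair_segment i \<nu>"
    if "c + d = \<nu> i + \<nu> (Suc i)" "min (\<nu> i) (\<nu> (Suc i)) \<le> c" "min (\<nu> i) (\<nu> (Suc i)) \<le> d" for c d
    unfolding pair_segment_def using that by blast
  consider "\<nu> i < \<nu> (Suc i)" | "\<nu> i = \<nu> (Suc i)" | "\<nu> (Suc i) < \<nu> i" by linarith
  then show ?thesis
  proof cases
    case 1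
    then obtain g where g: "fspan (monomial_fn n) (pair_segment i \<nu> - {swap_comp i \<nu>}) g"
      "\<And>x. x i \<noteq> x (Suc i) \<Longrightarrow>
         T_op t i (monomial_fn n \<nu>) x = of_real t * monomial_fn n (swap_comp i \<nu>) x + g x"
      using T_monomial_leading[OF i] by blast
    have "swap_comp i \<nu> \<in> pair_segment i \<nu>" unfolding swap_comp_def by (rule in_S) auto
    then have "fspan (monomial_fn n) (pair_segment i \<nu>) (\<lambda>x. of_real t * monomial_fn n (swap_comp i \<nu>) x + g x)"
      by (intro fspan_add fspan_scale fspan_base fspan_mono[OF g(1)] fin) auto
    then show ?thesis using that g(2) by blast
  next
    case 2
    have "fspan (monomial_fn n) (pair_segment i \<nu>) (\<lambda>x. of_real t * monomial_fn n (\<nu>(i := \<nu> i, Suc i := \<nu> (Suc i))) x)"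
      by (intro fspan_scale fspan_base[OF _ fin] in_S) auto
    then show ?thesis using that T_op_monomial(2)[of i _ \<nu>, OF i _ 2] by blast
  next
    case 3
    have "fspan (monomial_fn n) (pair_segment i \<nu>) (\<lambda>x. monomial_fn n (\<nu>(i := \<nu> (Suc i), Suc i := \<nu> i)) x +
      (\<Sum>j=1..<\<nu> i - \<nu> (Suc i). (1 - of_real t) * monomial_fn n (\<nu>(i := \<nu> (Suc i) + j, Suc i := \<nu> i - j)) x))"
      by (intro fspan_add fspan_scale fspan_sum fspan_base[OF _ fin] in_S) (use 3 in auto)
    then show ?thesis using that T_op_monomial(3)[of i _ \<nu>, OF i _ 3] by blast
  qed
qed

lemma T_op_sum:
  assumes "\<And>x. x i \<noteq> x (Suc i) \<Longrightarrow> (\<forall>\<nu>\<in>S. T_op t i (F \<nu>) x = G \<nu> x)" "x i \<noteq> x (Suc i)"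
  shows "T_op t i (\<lambda>x. \<Sum>\<nu>\<in>S. b \<nu> * F \<nu> x) x = (\<Sum>\<nu>\<in>S. b \<nu> * G \<nu> x)"
proof -
  have "T_op t i (\<lambda>x. \<Sum>\<nu>\<in>S. b \<nu> * F \<nu> x) x = (\<Sum>\<nu>\<in>S. b \<nu> * T_op t i (F \<nu>) x)"
    by (simp add: T_op_hecke_coeff sum_distrib_left sum_subtractf sum.distrib algebra_simps)
  also have "\<dots> = (\<Sum>\<nu>\<in>S. b \<nu> * G \<nu> x)" using assms by simp
  finally show ?thesis .
qed

lemma T_span:
  assumes f: "fspan (monomial_fn n) S f" and i: "i \<in> {1..<n}"
    and S': "\<And>\<nu>. \<nu> \<in> S \<Longrightarrow> pair_segment i \<nu> \<subseteq> S'" "finite S'"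
  obtains g where "fspan (monomial_fn n) S' g" "\<And>x. x i \<noteq> x (Suc i) \<Longrightarrow> T_op t i f x = g x"
proof -
  obtain b where b: "f = (\<lambda>x. \<Sum>\<nu>\<in>S. b \<nu> * monomial_fn n \<nu> x)" using f unfolding fspan_def by blast
  have "\<exists>g. fspan (monomial_fn n) (pair_segment i \<nu>) g \<and> (\<forall>x. x i \<noteq> x (Suc i) \<longrightarrow> T_op t i (monomial_fn n \<nu>) x = g x)" for \<nu>
    using T_monomial[OF i] by metis
  then obtain G where G: "\<And>\<nu>. fspan (monomial_fn n) (pair_segment i \<nu>) (G \<nu>)"
    "\<And>\<nu> x. x i \<noteq> x (Suc i) \<Longrightarrow> T_op t i (monomial_fn n \<nu>) x = G \<nu> x" by metis
  show ?thesis
  proof (rule that)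
    show "fspan (monomial_fn n) S' (\<lambda>x. \<Sum>\<nu>\<in>S. b \<nu> * G \<nu> x)"
      by (intro fspan_sum fspan_scale fspan_mono[OF G(1)] S')
    show "T_op t i f x = (\<Sum>\<nu>\<in>S. b \<nu> * G \<nu> x)" if "x i \<noteq> x (Suc i)" for x
      unfolding b by (rule T_op_sum) (use G(2) that in auto)
  qed
qed

lemma monomial_rot:
  shows "x n * monomial_fn n \<nu> (rot x) = of_real (q ^ \<nu> 1) * monomial_fn n (raise_comp n \<nu>) x"
proof -
  obtain m where m: "n = Suc m" using n_pos by (cases n) auto
  have "monomial_fn n \<nu> (rot x) = rot x 1 ^ \<nu> 1 * (\<Prod>k=Suc 1..Suc m. rot x k ^ \<nu> k)"
    unfolding monomial_fn_def m by (rule prod.atLeast_Suc_atMost) simp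
  also have "(\<Prod>k=Suc 1..Suc m. rot x k ^ \<nu> k) = (\<Prod>k=1..m. rot x (Suc k) ^ \<nu> (Suc k))"
    by (rule prod.shift_bounds_cl_Suc_ivl)
  also have "\<dots> = (\<Prod>k=1..m. x k ^ raise_comp n \<nu> k)"
  proof (rule prod.cong[OF refl])
    fix k assume "k \<in> {1..m}"
    then have "k \<in> {1..<n}" using m by simp
    then show "rot x (Suc k) ^ \<nu> (Suc k) = x k ^ raise_comp n \<nu> k"
      by (simp only: rot_simps(2) raise_comp_def if_True)
  qed
  finally have "monomial_fn n \<nu> (rot x) = (of_real q * x n) ^ \<nu> 1 * (\<Prod>k=1..m. x k ^ raise_comp n \<nu> k)"
    unfolding rot_simps(1) .
  moreover have "monomial_fn n (raise_comp n \<nu>) x = (\<Prod>k=1..m. x k ^ raise_comp n \<nu> k) * x n ^ Suc (\<nu> 1)"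
    unfolding monomial_fn_def m by (simp add: raise_comp_def)
  ultimately show ?thesis by (simp add: power_mult_distrib)
qed

definition poly_fn :: "point_fn \<Rightarrow> bool" where
  "poly_fn f \<longleftrightarrow> (\<exists>S. finite S \<and> S \<subseteq> compositions n \<and> fspan (monomial_fn n) S f)"

lemma poly_fnI: "fspan (monomial_fn n) S f \<Longrightarrow> finite S \<Longrightarrow> S \<subseteq> compositions n \<Longrightarrow> poly_fn f"
  unfolding poly_fn_def by blast

lemma poly_fn_linear:
  assumes "poly_fn f" "poly_fn g" shows "poly_fn (\<lambda>x. c * f x + d * g x)"
proof -
  obtain S S' where S: "finite S" "S \<subseteq> compositions n" "fspan (monomial_fn n) S f"
    "finite S'" "S' \<subseteq> compositions n" "fspan (monomial_fn n) S' g"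
    using assms unfolding poly_fn_def by blast
  then have "fspan (monomial_fn n) (S \<union> S') (\<lambda>x. c * f x + d * g x)"
    by (intro fspan_linear fspan_mono[OF S(3)] fspan_mono[OF S(6)]) auto
  then show ?thesis by (rule poly_fnI) (use S in auto)
qed

lemma poly_fn_scale: "poly_fn f \<Longrightarrow> poly_fn (\<lambda>x. c * f x)"
  using poly_fn_linear[of f f c 0] by simp

lemma poly_fn_diff: "poly_fn f \<Longrightarrow> poly_fn g \<Longrightarrow> poly_fn (\<lambda>x. f x - g x)"
  using poly_fn_linear[of f g 1 "-1"] by simp

lemma poly_fn_T:
  assumes "poly_fn f" and i: "i \<in> {1..<n}"
  obtains g where "poly_fn g" "\<And>x. x i \<noteq> x (Suc i) \<Longrightarrow> T_op t i f x = g x"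
proof -
  obtain S where S: "finite S" "S \<subseteq> compositions n" "fspan (monomial_fn n) S f"
    using assms unfolding poly_fn_def by blast
  let ?S = "\<Union>\<nu>\<in>S. pair_segment i \<nu>"
  have "finite ?S" using S finite_pair_segment by blast
  moreover have "?S \<subseteq> compositions n"
    using S(2) i by (fastforce simp: pair_segment_def compositions_def)
  ultimately show ?thesis using T_span[OF S(3) i, of ?S] that poly_fnI[of ?S] by blast
qed

lemma poly_fn_mult_rot:
  assumes "poly_fn f" shows "poly_fn (\<lambda>x. x n * f (rot x))"
proof -
  obtain S b where S: "finite S" "S \<subseteq> compositions n" "f = (\<lambda>x. \<Sum>\<nu>\<in>S. b \<nu> * monomial_fn n \<nu> x)"
    using assms unfolding poly_fn_def fspan_def by blast
  have fin: "finite (raise_comp n ` S)" using S by simp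
  have "x n * f (rot x) = (\<Sum>\<nu>\<in>S. b \<nu> * (of_real (q ^ \<nu> 1) * monomial_fn n (raise_comp n \<nu>) x))" for x
    unfolding S(3) sum_distrib_left mult.left_commute[of "x n"] monomial_rot ..
  then have "fspan (monomial_fn n) (raise_comp n ` S) (\<lambda>x. x n * f (rot x))"
    using fin by (auto intro!: fspan_sum fspan_scale fspan_base)
  then show ?thesis by (rule poly_fnI[OF _ fin]) (use raise_comp_compositions n_pos in auto)
qed

lemma poly_fn_monomial: "\<nu> \<in> compositions n \<Longrightarrow> poly_fn (monomial_fn n \<nu>)"
  by (rule poly_fnI[of "{\<nu>}"]) (auto intro: fspan_base)

lemma poly_fn_mult_var:
  assumes "poly_fn f" "j \<in> {1..n}" shows "poly_fn (\<lambda>x. x j * f x)"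
proof -
  obtain S b where S: "finite S" "S \<subseteq> compositions n" "f = (\<lambda>x. \<Sum>\<nu>\<in>S. b \<nu> * monomial_fn n \<nu> x)"
    using assms unfolding poly_fn_def fspan_def by blast
  define up where "up = (\<lambda>\<nu>::nat \<Rightarrow> nat. \<nu>(j := Suc (\<nu> j)))"
  have fin: "finite (up ` S)" using S by simp
  have "x j * monomial_fn n \<nu> x = monomial_fn n (up \<nu>) x" for x \<nu>
  proof -
    have "(\<Prod>k\<in>{1..n} - {j}. x k ^ up \<nu> k) = (\<Prod>k\<in>{1..n} - {j}. x k ^ \<nu> k)"
      by (rule prod.cong) (auto simp: up_def)
    moreover have "(\<Prod>k\<in>{1..n}. x k ^ \<mu> k) = x j ^ \<mu> j * (\<Prod>k\<in>{1..n} - {j}. x k ^ \<mu> k)" for \<mu>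
      by (rule prod.remove) (use assms(2) in auto)
    ultimately show ?thesis unfolding monomial_fn_def by (simp add: up_def)
  qed
  then have "x j * f x = (\<Sum>\<nu>\<in>S. b \<nu> * monomial_fn n (up \<nu>) x)" for x
    unfolding S(3) sum_distrib_left mult.left_commute[of "x j"] by simp
  then have "fspan (monomial_fn n) (up ` S) (\<lambda>x. x j * f x)"
    using fin by (auto intro!: fspan_sum fspan_scale fspan_base)
  moreover have "up ` S \<subseteq> compositions n" using S(2) assms(2) by (auto simp: up_def compositions_def)
  ultimately show ?thesis using fin by (intro poly_fnI)
qed

lemma poly_fn_rot:
  assumes "poly_fn f" shows "poly_fn (\<lambda>x. f (rot x))"
proof -
  obtain S b where S: "finite S" "S \<subseteq> compositions n" "f = (\<lambda>x. \<Sum>\<nu>\<in>S. b \<nu> * monomial_fn n \<nu> x)"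
    using assms unfolding poly_fn_def fspan_def by blast
  define low where "low = (\<lambda>\<nu>::nat \<Rightarrow> nat. (raise_comp n \<nu>)(n := \<nu> 1))"
  have fin: "finite (low ` S)" using S by simp
  have "monomial_fn n \<nu> (rot x) = of_real (q ^ \<nu> 1) * monomial_fn n (low \<nu>) x" for x \<nu>
  proof -
    obtain m where m: "n = Suc m" using n_pos by (cases n) auto
    have "monomial_fn n \<nu> (rot x) = rot x 1 ^ \<nu> 1 * (\<Prod>k=Suc 1..Suc m. rot x k ^ \<nu> k)"
      unfolding monomial_fn_def m by (rule prod.atLeast_Suc_atMost) simp
    also have "(\<Prod>k=Suc 1..Suc m. rot x k ^ \<nu> k) = (\<Prod>k=1..m. rot x (Suc k) ^ \<nu> (Suc k))"
      by (rule prod.shift_bounds_cl_Suc_ivl)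
    also have "\<dots> = (\<Prod>k=1..m. x k ^ low \<nu> k)"
    proof (rule prod.cong[OF refl])
      fix k assume "k \<in> {1..m}"
      then have k: "k \<in> {1..<n}" "k \<noteq> n" using m by auto
      then have "low \<nu> k = \<nu> (Suc k)" by (simp add: low_def raise_comp_def)
      then show "rot x (Suc k) ^ \<nu> (Suc k) = x k ^ low \<nu> k"
        by (simp only: rot_simps(2)[OF k(1)])
    qed
    finally have "monomial_fn n \<nu> (rot x) = (of_real q * x n) ^ \<nu> 1 * (\<Prod>k=1..m. x k ^ low \<nu> k)"
      unfolding rot_simps(1) .
    moreover have "monomial_fn n (low \<nu>) x = (\<Prod>k=1..m. x k ^ low \<nu> k) * x n ^ \<nu> 1"
      unfolding monomial_fn_def m by (simp add: low_def m)
    ultimately show ?thesis by (simp add: power_mult_distrib)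
  qed
  then have "f (rot x) = (\<Sum>\<nu>\<in>S. b \<nu> * (of_real (q ^ \<nu> 1) * monomial_fn n (low \<nu>) x))" for x
    unfolding S(3) by simp
  then have "fspan (monomial_fn n) (low ` S) (\<lambda>x. f (rot x))"
    using fin by (auto intro!: fspan_sum fspan_scale fspan_base)
  moreover have "low ` S \<subseteq> compositions n"
    using n_pos raise_comp_compositions by (fastforce simp: low_def compositions_def)
  ultimately show ?thesis using fin by (intro poly_fnI)
qed

lemma poly_fn_continuous:
  assumes "poly_fn f" "\<And>k. k \<in> {1..n} \<Longrightarrow> continuous_on A (\<lambda>s. z s k)"
  shows "continuous_on A (\<lambda>s. f (z s))"
proof -
  obtain S b where S: "f = (\<lambda>x. \<Sum>\<nu>\<in>S. b \<nu> * monomial_fn n \<nu> x)"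
    using assms unfolding poly_fn_def fspan_def by blast
  show ?thesis unfolding S monomial_fn_def by (intro continuous_intros assms(2))
qed

text \<open>
  Non-generic points on a line through a generic point form a countable set, hence the generic
  points are dense on that line.
\<close>

lemma poly_fn_eq_0:
  assumes f: "poly_fn f" and z: "\<And>x. gen x \<Longrightarrow> f x = 0"
  shows "f x = 0"
proof (rule ccontr)
  assume nz: "f x \<noteq> 0"
  \<comment> \<open>The coordinates have real part 1 and distinct imaginary parts, so none is a real
    multiple of another; hence y is generic, and no excluded hyperplane contains the whole line from
    x to y.\<close>
  define y where "y = (\<lambda>k. Complex 1 (real k))"
  define l where "l = (\<lambda>(s::real) k. x k + of_real s * (y k - x k))"
  define bad where "bad = (\<lambda>(i, j, k::int). {s. l s i = of_real (q powi k) * l s j})"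
  have gy': "y i \<noteq> of_real r * y j" if "i \<noteq> j" for i j r
    using that by (auto simp: y_def complex_eq_iff)
  have gy: "y i \<noteq> of_real (q powi k) * y j" if "i \<noteq> j" for i j k
    by (rule gy'[OF that])
  have "finite (bad (i, j, k))" if "i \<noteq> j" for i j k
  proof -
    define A where "A = x i - of_real (q powi k) * x j"
    define B where "B = y i - of_real (q powi k) * y j"
    have B: "B \<noteq> 0" using gy[OF that] by (simp add: B_def)
    have s: "s \<in> bad (i, j, k) \<longleftrightarrow> A + of_real s * (B - A) = 0" for s
      by (auto simp: bad_def l_def A_def B_def algebra_simps)
    have "s = s'" if "s \<in> bad (i, j, k)" "s' \<in> bad (i, j, k)" for s s'
    proof -
      have "A + of_real s * (B - A) = 0" "A + of_real s' * (B - A) = 0" using that s by auto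
      then have "(of_real s - of_real s') * (B - A) = 0" by algebra
      moreover have "B - A \<noteq> 0"
      proof
        assume "B - A = 0"
        then show False using \<open>A + of_real s * (B - A) = 0\<close> B by simp
      qed
      ultimately show ?thesis by simp
    qed
    then show ?thesis by (rule finite_subsingleton)
  qed
  then have cnt: "countable (\<Union>p\<in>{(i, j, k). i \<in> {1..n} \<and> j \<in> {1..n} \<and> i \<noteq> j}. bad p)"
    by (intro countable_UN) (auto intro: countable_finite)
  have "{s. f (l s) \<noteq> 0} \<subseteq> (\<Union>p\<in>{(i, j, k). i \<in> {1..n} \<and> j \<in> {1..n} \<and> i \<noteq> j}. bad p)"
  proof
    fix s assume "s \<in> {s. f (l s) \<noteq> 0}"
    then have "\<not> gen (l s)" using z by auto
    then obtain i j k where ijk: "i \<in> {1..n}" "j \<in> {1..n}" "i \<noteq> j" "l s i = of_real (q powi k) * l s j"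
      unfolding generic_point_def by blast
    then have "s \<in> bad (i, j, k)" unfolding bad_def by blast
    then show "s \<in> (\<Union>p\<in>{(i, j, k). i \<in> {1..n} \<and> j \<in> {1..n} \<and> i \<noteq> j}. bad p)"
      using ijk by (intro UN_I[of "(i, j, k)"]) simp_all
  qed
  then have "countable {s. f (l s) \<noteq> 0}" using cnt countable_subset by blast
  moreover have "open {s. f (l s) \<noteq> 0}"
  proof -
    have "continuous_on UNIV (\<lambda>s. f (l s))"
      by (rule poly_fn_continuous[OF f]) (auto simp: l_def intro!: continuous_intros)
    then have "open ((\<lambda>s. f (l s)) -` (- {0}))" by (rule open_vimage[rotated]) auto
    then show ?thesis by (simp add: vimage_def)
  qed
  moreover have "0 \<in> {s. f (l s) \<noteq> 0}" using nz by (simp add: l_def)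
  ultimately obtain e where "e > 0" "ball 0 e \<subseteq> {s. f (l s) \<noteq> 0}" "countable {s. f (l s) \<noteq> 0}"
    by (meson open_contains_ball)
  then show False using uncountable_ball[of e "0::real"] countable_subset by blast
qed

end

text \<open>A composition with nonzero last part is the raise of one of smaller weight. Any other
  nonzero composition is reached from one of this kind by swaps that move its last nonzero part to
  the left across zeros, which are ascents.\<close>

lemma composition_induct [consumes 2, case_names zero raise swap]:
  assumes \<eta>: "\<eta> \<in> compositions n" and n: "n \<ge> 1"
    and zero: "P (\<lambda>_. 0)"
    and raise: "\<And>\<nu>. \<nu> \<in> compositions n \<Longrightarrow> P \<nu> \<Longrightarrow> P (raise_comp n \<nu>)"
    and swap: "\<And>\<nu> i. \<nu> \<in> compositions n \<Longrightarrow> i \<in> {1..<n} \<Longrightarrow> \<nu> i < \<nu> (Suc i) \<Longrightarrow> P \<nu> \<Longrightarrow> P (swap_comp i \<nu>)"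
  shows "P \<eta>"
  using \<eta>
proof (induction "weight n \<eta>" arbitrary: \<eta> rule: less_induct)
  case (less \<eta>)
  \<comment> \<open>Here k is the position of the last nonzero part and d its distance from n; each
    swap backwards moves it one step closer to n.\<close>
  have last: "P \<mu>" if "d + k = n" "k \<in> {1..n}" "\<mu> \<in> compositions n" "weight n \<mu> = weight n \<eta>"
    "\<mu> k \<noteq> 0" "\<And>j. j > k \<Longrightarrow> \<mu> j = 0" for d k \<mu>
    using that
  proof (induction d arbitrary: k \<mu>)
    case 0
    define \<nu> where "\<nu> = (\<lambda>j. if j = 1 then \<mu> n - 1 else if j \<in> {2..n} then \<mu> (j - 1) else 0)"
    have \<nu>: "\<nu> \<in> compositions n" using n by (auto simp: \<nu>_def compositions_def)
    have eq: "raise_comp n \<nu> = \<mu>"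
    proof
      fix j
      consider "j \<in> {1..<n}" | "j = n" | "j \<notin> {1..n}" by fastforce
      then show "raise_comp n \<nu> j = \<mu> j"
      proof cases
        case 1
        then show ?thesis by (simp add: raise_comp_def \<nu>_def)
      next
        case 2
        then show ?thesis using 0 by (simp add: raise_comp_def \<nu>_def)
      next
        case 3
        then show ?thesis using raise_comp_compositions[OF n, of \<nu>] "0.prems"(3) by (simp add: compositions_def)
      qed
    qed
    have "weight n \<nu> < weight n \<eta>" using weight_raise_comp[OF n, of \<nu>] eq 0 by simp
    then show ?case using raise[OF \<nu> less.hyps[OF _ \<nu>]] eq by simp
  next
    case (Suc d)
    have k: "k \<in> {1..<n}" using Suc.prems by auto
    let ?\<nu> = "swap_comp k \<mu>"
    have z: "\<mu> (Suc k) = 0" using Suc.prems by simp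
    have \<nu>: "?\<nu> \<in> compositions n" using k Suc.prems(3) by (rule swap_comp_compositions)
    have "P ?\<nu>"
    proof (rule Suc.IH)
      show "weight n ?\<nu> = weight n \<eta>"
        using weight_pair[OF k, of ?\<nu>] weight_pair[OF k, of \<mu>] Suc.prems(4) by (simp add: swap_comp_def)
      show "?\<nu> j = 0" if "j > Suc k" for j using Suc.prems(6)[of j] that by (simp add: swap_comp_def)
      show "?\<nu> \<in> compositions n" by (rule \<nu>)
      show "?\<nu> (Suc k) \<noteq> 0" using Suc.prems(5) by (simp add: swap_comp_def)
    qed (use Suc.prems(1) k in auto)
    moreover have "?\<nu> k < ?\<nu> (Suc k)" using z Suc.prems(5) by (simp add: swap_comp_def)
    ultimately have "P (swap_comp k ?\<nu>)" using swap[OF \<nu> k] by blast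
    moreover have "swap_comp k ?\<nu> = \<mu>" by (auto simp: swap_comp_def fun_eq_iff)
    ultimately show ?case by simp
  qed
  show ?case
  proof (cases "\<eta> = (\<lambda>_. 0)")
    case False
    then have ne: "{k. \<eta> k \<noteq> 0} \<noteq> {}" by auto
    have sub: "{k. \<eta> k \<noteq> 0} \<subseteq> {1..n}" 
    proof (rule subsetI, rule ccontr)
      fix k assume "k \<in> {k. \<eta> k \<noteq> 0}" "k \<notin> {1..n}"
      then show False using less.prems by (simp add: compositions_def)
    qed
    then have fin: "finite {k. \<eta> k \<noteq> 0}" by (rule finite_subset) simp
    define k where "k = Max {k. \<eta> k \<noteq> 0}"
    have k: "\<eta> k \<noteq> 0" "k \<in> {1..n}" using Max_in[OF fin ne] sub by (auto simp: k_def)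
    have "\<eta> j = 0" if "j > k" for j
    proof (rule ccontr)
      assume "\<eta> j \<noteq> 0"
      then have "j \<le> k" unfolding k_def using fin by (intro Max_ge) auto
      then show False using that by simp
    qed
    then show ?thesis using last[of "n - k" k \<eta>] k less.prems by simp
  qed (use zero in simp)
qed

section \<open>The joint eigenvalues and their separation\<close>

context macdonald_params
begin

definition eigval :: "(nat \<Rightarrow> nat) \<Rightarrow> nat \<Rightarrow> complex" where
  "eigval \<eta> i = of_real (q ^ \<eta> i * t powi (- int (leg' n \<eta> i)))"

lemma eigval_powr: "eigval \<eta> i = of_real (q powr (real (\<eta> i) - lam * real (leg' n \<eta> i)))"
proof -
  have "q ^ \<eta> i = q powr real (\<eta> i)" using q_pos by (simp add: powr_realpow)
  moreover have "t powi (- int (leg' n \<eta> i)) = q powr (- lam * real (leg' n \<eta> i))"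
  proof -
    have "t powi (- int k) = q powr (- lam * real k)" for k
      using q_pos by (simp add: t_eq power_int_minus powr_minus powr_powr powr_realpow[symmetric])
    then show ?thesis .
  qed
  ultimately show ?thesis by (simp add: eigval_def powr_add[symmetric])
qed

lemma eigval_eq_iff:
  "eigval \<eta> i = eigval \<nu> j \<longleftrightarrow> real (\<eta> i) - lam * real (leg' n \<eta> i) = real (\<nu> j) - lam * real (leg' n \<nu> j)"
  unfolding eigval_powr using q_pos q_less_1 by (simp add: powr_inj)

lemma part_before_iff_eigval:
  assumes "j \<in> {1..n}" "k \<in> {1..n}"
  shows "part_before \<eta> j k \<longleftrightarrow> real (\<eta> j) - lam * real (leg' n \<eta> j) > real (\<eta> k) - lam * real (leg' n \<eta> k)"
proof -
  have *: "real (\<eta> j) - lam * real (leg' n \<eta> j) > real (\<eta> k) - lam * real (leg' n \<eta> k)"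
    if "part_before \<eta> j k" "j \<in> {1..n}" for j k
  proof -
    have "leg' n \<eta> j < leg' n \<eta> k" by (rule leg'_less[OF that])
    then have "lam * real (leg' n \<eta> j) < lam * real (leg' n \<eta> k)" using lam_pos by simp
    moreover have "\<eta> j \<ge> \<eta> k" using that by (auto simp: part_before_def)
    ultimately show ?thesis by linarith
  qed
  show ?thesis
    using *[of j k] *[of k j] part_before_total[of j k \<eta>] assms
    by (cases "j = k") (auto simp: part_before_def)
qed

text \<open>Because lam > 0, the exponents of q decrease strictly along the ranks. So all
  eigenvalues together recover the order of positions, hence \<open>leg'\<close>, and then the
  parts. This covers rational lam too, where single eigenvalues of different compositions can
  coincide.\<close>

lemma eigval_distinct:
  assumes "\<eta> \<in> compositions n" "\<nu> \<in> compositions n" "\<And>i. i \<in> {1..n} \<Longrightarrow> eigval \<eta> i = eigval \<nu> i"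
  shows "\<eta> = \<nu>"
proof
  fix i
  have e: "real (\<eta> i) - lam * real (leg' n \<eta> i) = real (\<nu> i) - lam * real (leg' n \<nu> i)" if "i \<in> {1..n}" for i
    using assms(3)[OF that] unfolding eigval_eq_iff .
  have l: "leg' n \<eta> i = leg' n \<nu> i" if i: "i \<in> {1..n}" for i
  proof -
    have "part_before \<eta> j i \<longleftrightarrow> part_before \<nu> j i" if "j \<in> {1..n}" for j
      unfolding part_before_iff_eigval[OF that i] e[OF that] e[OF i] ..
    then have "{j \<in> {1..n}. part_before \<eta> j i} = {j \<in> {1..n}. part_before \<nu> j i}" by blast
    then show ?thesis unfolding leg'_eq_card by simp
  qed
  show "\<eta> i = \<nu> i"
  proof (cases "i \<in> {1..n}")
    case True
    then show ?thesis using e[OF True] l[OF True] by simp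
  next
    case False
    then show ?thesis using assms by (simp add: compositions_def)
  qed
qed

subsection \<open>Existence and uniqueness of the nonsymmetric Macdonald polynomials\<close>

definition eigenfn :: "(nat \<Rightarrow> nat) \<Rightarrow> point_fn \<Rightarrow> bool" where
  "eigenfn \<eta> f \<longleftrightarrow> (\<forall>i\<in>{1..n}. YY i (mask f) = (\<lambda>x. eigval \<eta> i * mask f x))"

definition lower :: "(nat \<Rightarrow> nat) \<Rightarrow> (nat \<Rightarrow> nat) set" where
  "lower \<eta> = {\<nu>. affine_le n \<nu> \<eta> \<and> \<nu> \<noteq> \<eta>}"

text \<open>Stronger than the triangularity in \<open>is_nonsym_macdonald\<close>, since
  \<open>lower \<eta>\<close> refers to the affine order. In this form it survives both raising and
  swapping.\<close>

definition triangular :: "(nat \<Rightarrow> nat) \<Rightarrow> point_fn \<Rightarrow> bool" where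
  "triangular \<eta> f \<longleftrightarrow> (\<exists>g. fspan (monomial_fn n) (lower \<eta>) g \<and> f = (\<lambda>x. monomial_fn n \<eta> x + g x))"

lemma lower_subset: "lower \<eta> \<subseteq> {\<nu>. comp_less n \<nu> \<eta>}"
  unfolding lower_def using affine_le_imp_comp_less by blast

lemma finite_lower: "finite (lower \<eta>)"
  by (rule finite_subset[OF lower_subset finite_comp_less])

lemma mask_linear: "mask (\<lambda>x. c * f x + d * g x) = (\<lambda>x. c * mask f x + d * mask g x)"
  by (auto simp: mask_def)

lemma mask_scale: "mask (\<lambda>x. c * f x) = (\<lambda>x. c * mask f x)"
  by (auto simp: mask_def)

lemma eigenfn_scale: "eigenfn \<eta> f \<Longrightarrow> eigenfn \<eta> (\<lambda>x. c * f x)"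
  by (simp add: eigenfn_def mask_scale YY_scale mult.left_commute)

lemma eigenfn_cong: "mask f = mask g \<Longrightarrow> eigenfn \<eta> f \<Longrightarrow> eigenfn \<eta> g"
  by (simp add: eigenfn_def)

lemma eigenfn_raise:
  assumes f: "eigenfn \<eta> f"
  shows "eigenfn (raise_comp n \<eta>) (\<lambda>x. x n * f (rot x))"
  unfolding eigenfn_def
proof
  fix i assume i: "i \<in> {1..n}"
  have m: "mask (\<lambda>x. x n * f (rot x)) = PH (mask f)"
    by (auto simp: mask_def PH_def XX_def OM_def gen_rot)
  have l: "leg' n (raise_comp n \<eta>) i = (if i = n then leg' n \<eta> 1 else leg' n \<eta> (Suc i))"
    by (rule leg'_raise_comp[OF i])
  show "YY i (mask (\<lambda>x. x n * f (rot x))) = (\<lambda>x. eigval (raise_comp n \<eta>) i * mask (\<lambda>x. x n * f (rot x)) x)"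
  proof (cases "i = n")
    case True
    have "YY 1 (mask f) = (\<lambda>x. eigval \<eta> 1 * mask f x)" using f n_pos by (simp add: eigenfn_def)
    then show ?thesis unfolding m True YY_n_PH using l True
      by (simp add: PH_scale eigval_def raise_comp_def mult.assoc)
  next
    case False
    then have i': "i \<in> {1..<n}" "Suc i \<in> {1..n}" using i by auto
    have "YY (Suc i) (mask f) = (\<lambda>x. eigval \<eta> (Suc i) * mask f x)" using f i' by (simp add: eigenfn_def)
    then show ?thesis unfolding m YY_PH[OF i'(1)] using l False i'(1)
      by (simp add: PH_scale eigval_def raise_comp_def)
  qed
qed

text \<open>The constant \<open>c\<close> of \<open>YY_intertwiner\<close> for the eigenvalues of
  Y_i and Y_(i+1). The denominator is nonzero at an ascent, where position i + 1 strictly precedes i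
  in rank.\<close>

definition swap_coeff :: "(nat \<Rightarrow> nat) \<Rightarrow> nat \<Rightarrow> complex" where
  "swap_coeff \<eta> i = (of_real t - 1) * eigval \<eta> i / (eigval \<eta> (Suc i) - eigval \<eta> i)"

lemma eigenfn_swap:
  assumes f: "eigenfn \<eta> f" and i: "i \<in> {1..<n}" and less: "\<eta> i < \<eta> (Suc i)"
    and g: "\<And>x. x i \<noteq> x (Suc i) \<Longrightarrow> g x = T_op t i f x + swap_coeff \<eta> i * f x"
  shows "eigenfn (swap_comp i \<eta>) g"
  unfolding eigenfn_def
proof
  fix k assume k: "k \<in> {1..n}"
  have i2: "i \<in> {1..n}" "Suc i \<in> {1..n}" using i by auto
  let ?c = "swap_coeff \<eta> i"
  have m: "mask g = (\<lambda>x. TT i (mask f) x + ?c * mask f x)"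
  proof
    fix x show "mask g x = TT i (mask f) x + ?c * mask f x"
    proof (cases "gen x")
      case True
      then show ?thesis
        using g[OF swap_pt_neq[OF i True]] gen_swap_pt[OF i, of x] by (simp add: mask_def TT_def T_op_hecke_coeff)
    qed (simp add: mask_def TT_def)
  qed
  have Y: "YY k (mask f) = (\<lambda>x. eigval \<eta> k * mask f x)" if "k \<in> {1..n}" for k
    using f that unfolding eigenfn_def by blast
  have "part_before \<eta> (Suc i) i" using less by (simp add: part_before_def)
  then have ne: "eigval \<eta> (Suc i) - eigval \<eta> i \<noteq> 0"
    using part_before_iff_eigval[OF i2(2,1), of \<eta>] unfolding right_minus_eq eigval_eq_iff by simp
  have c: "?c * (eigval \<eta> (Suc i) - eigval \<eta> i) = (of_real t - 1) * eigval \<eta> i"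
    using ne by (simp add: swap_coeff_def)
  have ev: "eigval (swap_comp i \<eta>) k = eigval \<eta> (Transposition.transpose i (Suc i) k)"
    unfolding eigval_def using leg'_swap_comp[OF i _ k, of \<eta>] less
    by (auto simp: swap_comp_def Transposition.transpose_def)
  consider "k = i" | "k = Suc i" | "k \<noteq> i" "k \<noteq> Suc i" by blast
  then show "YY k (mask g) = (\<lambda>x. eigval (swap_comp i \<eta>) k * mask g x)"
  proof cases
    case 1
    then show ?thesis unfolding ev m using YY_intertwiner(1)[OF i Y[OF i2(1)] Y[OF i2(2)] c] by simp
  next
    case 2
    then show ?thesis unfolding ev m using YY_intertwiner(2)[OF i Y[OF i2(1)] Y[OF i2(2)] c] by simp
  next
    case 3
    have "mask g = (\<lambda>x. 1 * TT i (mask f) x + ?c * mask f x)" by (simp add: m)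
    then have "YY k (mask g) = (\<lambda>x. 1 * YY k (TT i (mask f)) x + ?c * YY k (mask f) x)"
      by (simp only: YY_linear)
    then show ?thesis unfolding ev m YY_TT_commute[OF i k 3] Y[OF k] TT_scale using 3
      by (simp add: Transposition.transpose_def algebra_simps)
  qed
qed

lemma triangular_raise:
  assumes "triangular \<eta> f" "\<eta> \<in> compositions n"
  shows "triangular (raise_comp n \<eta>) (\<lambda>x. of_real (1 / q ^ \<eta> 1) * (x n * f (rot x)))"
proof -
  obtain b where f: "f = (\<lambda>x. monomial_fn n \<eta> x + (\<Sum>\<nu>\<in>lower \<eta>. b \<nu> * monomial_fn n \<nu> x))"
    using assms unfolding triangular_def fspan_def by blast
  let ?g = "\<lambda>x. of_real (1 / q ^ \<eta> 1) * (\<Sum>\<nu>\<in>lower \<eta>. b \<nu> * (of_real (q ^ \<nu> 1) * monomial_fn n (raise_comp n \<nu>) x))"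
  have "raise_comp n \<nu> \<in> lower (raise_comp n \<eta>)" if "\<nu> \<in> lower \<eta>" for \<nu>
    using that affine_le_raise_comp[of n \<nu> \<eta>] raise_comp_inj[of n \<nu> \<eta>] n_pos assms(2)
    by (auto simp: lower_def affine_le_def)
  then have "fspan (monomial_fn n) (lower (raise_comp n \<eta>)) ?g"
    by (intro fspan_scale fspan_sum fspan_base finite_lower)
  moreover have "of_real (1 / q ^ \<eta> 1) * (x n * f (rot x)) = monomial_fn n (raise_comp n \<eta>) x + ?g x" for x
  proof -
    have "x n * f (rot x) = of_real (q ^ \<eta> 1) * monomial_fn n (raise_comp n \<eta>) x +
      (\<Sum>\<nu>\<in>lower \<eta>. b \<nu> * (of_real (q ^ \<nu> 1) * monomial_fn n (raise_comp n \<nu>) x))"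
      unfolding f distrib_left sum_distrib_left mult.left_commute[of "x n"] monomial_rot ..
    moreover have "complex_of_real (1 / q ^ \<eta> 1) * of_real (q ^ \<eta> 1) = 1"
      unfolding of_real_mult[symmetric] using q_pos by simp
    ultimately show ?thesis by (simp only: distrib_left mult.assoc[symmetric] mult_1_left)
  qed
  ultimately show ?thesis unfolding triangular_def by blast
qed

lemma triangular_swap:
  assumes "triangular \<eta> f" and \<eta>: "\<eta> \<in> compositions n" and i: "i \<in> {1..<n}" and less: "\<eta> i < \<eta> (Suc i)"
  obtains g where "triangular (swap_comp i \<eta>) g"
    "\<And>x. x i \<noteq> x (Suc i) \<Longrightarrow> of_real t * g x = T_op t i f x + c * f x"
proof -
  obtain f0 where f0: "fspan (monomial_fn n) (lower \<eta>) f0" "f = (\<lambda>x. monomial_fn n \<eta> x + f0 x)"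
    using assms unfolding triangular_def by blast
  let ?L = "lower (swap_comp i \<eta>)"
  \<comment> \<open>The equality clause of \<open>affine_le_swap_comp\<close> keeps the new leading
    exponent out of everything produced from lower terms, so the leading coefficient is not
    disturbed.\<close>
  have in_L: "\<mu> \<in> ?L" if "affine_le n \<nu> \<eta>" "\<mu> \<in> pair_segment i \<nu>" "\<nu> \<noteq> \<eta> \<or> \<mu> \<noteq> swap_comp i \<eta>" for \<mu> \<nu>
    using affine_le_swap_comp[OF that(1) i less that(2)] that(3) by (auto simp: lower_def)
  have self: "\<nu> \<in> pair_segment i \<nu>" for \<nu>
    unfolding pair_segment_def by (rule CollectI, rule exI[of _ "\<nu> i"], rule exI[of _ "\<nu> (Suc i)"]) auto
  have ne: "\<eta> \<noteq> swap_comp i \<eta>" using less by (auto simp: swap_comp_def dest: fun_cong[of _ _ i])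
  obtain g1 where g1: "fspan (monomial_fn n) (pair_segment i \<eta> - {swap_comp i \<eta>}) g1"
    "\<And>x. x i \<noteq> x (Suc i) \<Longrightarrow>
       T_op t i (monomial_fn n \<eta>) x = of_real t * monomial_fn n (swap_comp i \<eta>) x + g1 x"
    using T_monomial_leading[OF i less] by blast
  have "fspan (monomial_fn n) ?L g1"
    by (rule fspan_mono[OF g1(1) _ finite_lower]) (use in_L[OF affine_le_refl[OF \<eta>]] in blast)
  moreover have sub: "pair_segment i \<nu> \<subseteq> ?L" if "\<nu> \<in> lower \<eta>" for \<nu>
    using that in_L[of \<nu>] unfolding lower_def by blast
  moreover obtain g2 where g2: "fspan (monomial_fn n) ?L g2" "\<And>x. x i \<noteq> x (Suc i) \<Longrightarrow> T_op t i f0 x = g2 x"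
    using T_span[OF f0(1) i sub finite_lower] by blast
  moreover have "fspan (monomial_fn n) ?L (monomial_fn n \<eta>)"
    by (rule fspan_base[OF in_L[OF affine_le_refl[OF \<eta>] self] finite_lower]) (use ne in simp)
  moreover have "fspan (monomial_fn n) ?L f0"
  proof (rule fspan_mono[OF f0(1) _ finite_lower], rule subsetI)
    fix \<nu> assume "\<nu> \<in> lower \<eta>"
    then show "\<nu> \<in> ?L" using in_L[OF _ self] by (auto simp: lower_def)
  qed
  ultimately have span: "fspan (monomial_fn n) ?L
      (\<lambda>x. (1 / of_real t) * (g1 x + g2 x + c * (monomial_fn n \<eta> x + f0 x)))"
    by (intro fspan_scale fspan_add)
  show ?thesis
  proof
    show "triangular (swap_comp i \<eta>) (\<lambda>x. monomial_fn n (swap_comp i \<eta>) x +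
        (1 / of_real t) * (g1 x + g2 x + c * (monomial_fn n \<eta> x + f0 x)))"
      unfolding triangular_def using span by blast
    fix x :: "nat \<Rightarrow> complex" assume x: "x i \<noteq> x (Suc i)"
    have "T_op t i f x = T_op t i (monomial_fn n \<eta>) x + T_op t i f0 x"
      unfolding f0(2) T_op_hecke_coeff by (simp add: algebra_simps)
    then show "of_real t * (monomial_fn n (swap_comp i \<eta>) x +
        (1 / of_real t) * (g1 x + g2 x + c * (monomial_fn n \<eta> x + f0 x))) = T_op t i f x + c * f x"
      using g1(2)[OF x] g2(2)[OF x] t_pos unfolding f0(2) by (simp add: field_simps)
  qed
qed

lemma lower_zero: "lower (\<lambda>_. 0) = {}"
proof -
  have "\<nu> = (\<lambda>_. 0)" if "affine_le n \<nu> (\<lambda>_. 0)" for \<nu>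
  proof
    fix k
    have "weight n \<nu> = 0" "\<nu> \<in> compositions n" using that by (auto simp: affine_le_def weight_def)
    then show "\<nu> k = 0" by (cases "k \<in> {1..n}") (auto simp: weight_def compositions_def)
  qed
  then show ?thesis unfolding lower_def by blast
qed

lemma triangular_zero: "triangular (\<lambda>_. 0) (\<lambda>_. 1)"
  unfolding triangular_def lower_zero by (auto simp: fspan_def monomial_fn_def)

lemma eigenfn_zero: "eigenfn (\<lambda>_. 0) (\<lambda>_. 1)"
  unfolding eigenfn_def
proof
  fix i assume i: "i \<in> {1..n}"
  have TT1: "TT j (mask (\<lambda>_. 1)) = (\<lambda>x. of_real t * mask (\<lambda>_. 1) x)" if "j \<in> {1..<n}" for j
    using gen_swap_pt[OF that] by (auto simp: TT_def mask_def T_op_hecke_coeff)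
  have TI1: "TI j (mask (\<lambda>_. 1)) = (\<lambda>x. (1 / of_real t) * mask (\<lambda>_. 1) x)" if "j \<in> {1..<n}" for j
  proof
    fix x
    show "TI j (mask (\<lambda>_. 1)) x = (1 / of_real t) * mask (\<lambda>_. 1) x"
      unfolding TI_eq TT1[OF that] using t_pos by (simp add: field_simps)
  qed
  have TTs1: "TTs js (mask (\<lambda>_. 1)) = (\<lambda>x. of_real t ^ length js * mask (\<lambda>_. 1) x)" if "set js \<subseteq> {1..<n}" for js
    using that by (induction js) (simp_all add: TT1 TT_scale mult.assoc mult.left_commute)
  have TIs1: "TIs js (mask (\<lambda>_. 1)) = (\<lambda>x. (1 / of_real t) ^ length js * mask (\<lambda>_. 1) x)" if "set js \<subseteq> {1..<n}" for js
    using that by (induction js) (simp_all add: TI1[unfolded One_nat_def] TI_scale mult.assoc mult.left_commute)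
  have OM1: "OM (mask (\<lambda>_. 1)) = mask (\<lambda>_. 1)"
    by (auto simp: OM_def mask_def gen_rot)
  have l: "leg' n (\<lambda>_. 0) i = i - 1"
  proof -
    have "{j \<in> {1..n}. part_before (\<lambda>_. 0) j i} = {1..<i}" using i by (auto simp: part_before_def)
    then show ?thesis unfolding leg'_eq_card by simp
  qed
  have "YY i (mask (\<lambda>_. 1)) = (\<lambda>x. of_real (t powi (int i - int n)) * (of_real t ^ (n - i) * ((1 / of_real t) ^ (i - 1))) * mask (\<lambda>_. 1) x)"
  proof
    fix x
    have "TIs [1..<i] (mask (\<lambda>_. 1)) = (\<lambda>x. (1 / of_real t) ^ (i - 1) * mask (\<lambda>_. 1) x)"
      using TIs1[of "[1..<i]"] i by (simp add: subset_iff)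
    moreover have "TTs [i..<n] (mask (\<lambda>_. 1)) = (\<lambda>x. of_real t ^ (n - i) * mask (\<lambda>_. 1) x)"
      using TTs1[of "[i..<n]"] i by (simp add: subset_iff)
    ultimately show "YY i (mask (\<lambda>_. 1)) x = of_real (t powi (int i - int n)) *
        (of_real t ^ (n - i) * ((1 / of_real t) ^ (i - 1))) * mask (\<lambda>_. 1) x"
      by (simp only: YY_def OM_scale TTs_scale OM1 mult.assoc mult.left_commute)
  qed
  also have "complex_of_real (t powi (int i - int n)) * (of_real t ^ (n - i) * ((1 / of_real t) ^ (i - 1))) =
      eigval (\<lambda>_. 0) i"
  proof -
    have "t powi (int i - int n) = 1 / t ^ (n - i)"
      using i t_pos by (simp add: power_int_def inverse_eq_divide power_one_over nat_diff_distrib)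
    moreover have "t powi (- int (i - 1)) = (1 / t) ^ (i - 1)"
      by (simp add: power_int_minus inverse_eq_divide power_one_over)
    ultimately show ?thesis using t_pos by (simp add: eigval_def l)
  qed
  finally show "YY i (mask (\<lambda>_. 1)) = (\<lambda>x. eigval (\<lambda>_. 0) i * mask (\<lambda>_. 1) x)" .
qed

lemma triangular_eigenfn_exists:
  assumes "\<eta> \<in> compositions n"
  shows "\<exists>f. triangular \<eta> f \<and> eigenfn \<eta> f"
  using assms n_pos
proof (induction \<eta> rule: composition_induct)
  case zero
  then show ?case using triangular_zero eigenfn_zero by blast
next
  case (raise \<nu>)
  then show ?case using triangular_raise eigenfn_raise eigenfn_scale by blast
next
  case (swap \<nu> i)
  then obtain f where f: "triangular \<nu> f" "eigenfn \<nu> f" by blast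
  obtain g where g: "triangular (swap_comp i \<nu>) g"
    "\<And>x. x i \<noteq> x (Suc i) \<Longrightarrow> of_real t * g x = T_op t i f x + swap_coeff \<nu> i * f x"
    using triangular_swap[OF f(1) swap.hyps(1-3)] by blast
  have "eigenfn (swap_comp i \<nu>) (\<lambda>x. of_real t * g x)"
    by (rule eigenfn_swap[OF f(2) swap.hyps(2,3) g(2)])
  then have "eigenfn (swap_comp i \<nu>) (\<lambda>x. (1 / of_real t) * (of_real t * g x))" by (rule eigenfn_scale)
  then have "eigenfn (swap_comp i \<nu>) g" using t_pos by simp
  then show ?case using g(1) by blast
qed

text \<open>Elimination of one eigenfunction at a time. With i separating \<nu> from \<eta>, the
  operator (Y_i - eigval \<nu> i) / (eigval \<eta> i - eigval \<nu> i) fixes the masked f and kills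
  the \<nu>-term of its expansion; the function \<open>g\<close> in the proof is the result.\<close>

lemma eigenfn_independent:
  assumes "finite S" "\<And>\<nu>. \<nu> \<in> S \<Longrightarrow> eigenfn \<nu> (F \<nu>)" "\<And>\<nu>. \<nu> \<in> S \<Longrightarrow> \<exists>i\<in>{1..n}. eigval \<nu> i \<noteq> eigval \<eta> i"
    and "fspan F S f" "eigenfn \<eta> f"
  shows "mask f = (\<lambda>_. 0)"
  using assms
proof (induction S arbitrary: f rule: finite_induct)
  case empty
  then show ?case by (auto simp: fspan_def mask_def)
next
  case (insert \<nu> S)
  obtain b where b: "f = (\<lambda>x. \<Sum>\<mu>\<in>insert \<nu> S. b \<mu> * F \<mu> x)" using insert.prems(3) unfolding fspan_def by blast
  obtain i where i: "i \<in> {1..n}" "eigval \<nu> i \<noteq> eigval \<eta> i" using insert.prems(2)[of \<nu>] by blast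
  have lin: "YY i (\<lambda>x. \<Sum>\<mu>\<in>A. b \<mu> * mask (F \<mu>) x) = (\<lambda>x. \<Sum>\<mu>\<in>A. b \<mu> * YY i (mask (F \<mu>)) x)" if "finite A" for A
    using that
  proof (induction A rule: finite_induct)
    case empty
    show ?case using YY_scale[of i 0 "\<lambda>_. 0"] by simp
  next
    case (insert a A)
    then show ?case
      using YY_linear[of i "b a" "mask (F a)" 1 "\<lambda>x. \<Sum>\<mu>\<in>A. b \<mu> * mask (F \<mu>) x"] by simp
  qed
  have mf: "mask f = (\<lambda>x. \<Sum>\<mu>\<in>insert \<nu> S. b \<mu> * mask (F \<mu>) x)"
    unfolding b by (auto simp: mask_def)
  define g where "g = (\<lambda>x. \<Sum>\<mu>\<in>S. ((eigval \<mu> i - eigval \<nu> i) / (eigval \<eta> i - eigval \<nu> i) * b \<mu>) * F \<mu> x)"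
  have "mask g = mask f"
  proof
    fix x
    have "eigval \<eta> i * mask f x = YY i (mask f) x" using insert.prems(4) i(1) by (simp add: eigenfn_def)
    also have "\<dots> = (\<Sum>\<mu>\<in>insert \<nu> S. b \<mu> * (eigval \<mu> i * mask (F \<mu>) x))"
      unfolding mf lin[OF finite.insertI[OF insert.hyps(1)]]
      using insert.prems(1) i(1) by (intro sum.cong) (simp_all add: eigenfn_def)
    finally have "(eigval \<eta> i - eigval \<nu> i) * mask f x =
      (\<Sum>\<mu>\<in>insert \<nu> S. b \<mu> * (eigval \<mu> i * mask (F \<mu>) x)) - (\<Sum>\<mu>\<in>insert \<nu> S. eigval \<nu> i * (b \<mu> * mask (F \<mu>) x))"
      unfolding left_diff_distrib by (simp add: mf sum_distrib_left del: sum.insert)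
    also have "\<dots> = (\<Sum>\<mu>\<in>S. (eigval \<mu> i - eigval \<nu> i) * b \<mu> * mask (F \<mu>) x)"
      unfolding sum_subtractf[symmetric] using insert.hyps by (simp add: algebra_simps)
    finally have "mask f x = (\<Sum>\<mu>\<in>S. (eigval \<mu> i - eigval \<nu> i) * b \<mu> * mask (F \<mu>) x) / (eigval \<eta> i - eigval \<nu> i)"
      using i(2) by (simp add: nonzero_eq_divide_eq mult.commute)
    also have "\<dots> = mask g x"
      unfolding g_def mask_def by (simp add: sum_divide_distrib)
    finally show "mask g x = mask f x" ..
  qed
  moreover have "mask g = (\<lambda>_. 0)"
  proof (rule insert.IH)
    show "fspan F S g" unfolding g_def fspan_def
      by (rule exI[of _ "\<lambda>\<mu>. (eigval \<mu> i - eigval \<nu> i) / (eigval \<eta> i - eigval \<nu> i) * b \<mu>"]) simp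
    show "eigenfn \<eta> g" using eigenfn_cong[of f g] insert.prems(4) \<open>mask g = mask f\<close> by simp
  qed (use insert.prems in auto)
  ultimately show ?case by simp
qed

text \<open>An eigenfunction is its leading monomial plus smaller ones, so induction on
  \<open>comp_less\<close> writes the monomials below \<eta> through eigenfunctions indexed below
  \<eta>. Their joint eigenvalues differ from that of \<eta>, so f vanishes at generic points, hence
  everywhere.\<close>

lemma comp_less_span_eigenfn_0:
  assumes \<eta>: "\<eta> \<in> compositions n" and f: "fspan (monomial_fn n) {\<nu>. comp_less n \<nu> \<eta>} f" and e: "eigenfn \<eta> f"
  shows "f x = 0"
proof -
  have "\<exists>F. \<forall>\<nu>. \<nu> \<in> compositions n \<longrightarrow> triangular \<nu> (F \<nu>) \<and> eigenfn \<nu> (F \<nu>)"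
    by (rule choice) (use triangular_eigenfn_exists in blast)
  then obtain F where F: "\<And>\<nu>. \<nu> \<in> compositions n \<Longrightarrow> triangular \<nu> (F \<nu>)"
    "\<And>\<nu>. \<nu> \<in> compositions n \<Longrightarrow> eigenfn \<nu> (F \<nu>)" by blast
  have fin: "finite {\<mu>. comp_less n \<mu> \<nu> \<or> \<mu> = \<nu>}" for \<nu>
    using finite_comp_less[of n \<nu>] by (simp add: Collect_disj_eq)
  have mono: "fspan F {\<mu>. comp_less n \<mu> \<nu> \<or> \<mu> = \<nu>} (monomial_fn n \<nu>)" if "\<nu> \<in> compositions n" for \<nu>
    using that
  proof (induction \<nu> rule: comp_less_induct)
    case (less \<nu>)
    obtain g where g: "fspan (monomial_fn n) (lower \<nu>) g" "F \<nu> = (\<lambda>x. monomial_fn n \<nu> x + g x)"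
      using F(1)[OF less.hyps] unfolding triangular_def by blast
    have "fspan F {\<mu>. comp_less n \<mu> \<nu> \<or> \<mu> = \<nu>} g"
    proof (rule fspan_trans[OF g(1)])
      fix \<mu> assume "\<mu> \<in> lower \<nu>"
      then have \<mu>: "comp_less n \<mu> \<nu>" using lower_subset by blast
      show "fspan F {\<mu>. comp_less n \<mu> \<nu> \<or> \<mu> = \<nu>} (monomial_fn n \<mu>)"
        by (rule fspan_mono[OF less.IH[OF \<mu>] _ fin]) (use \<mu> comp_less_trans in blast)
    qed
    then have "fspan F {\<mu>. comp_less n \<mu> \<nu> \<or> \<mu> = \<nu>} (\<lambda>x. F \<nu> x - g x)"
      by (intro fspan_diff fspan_base[OF _ fin]) auto
    then show ?case by (simp add: g(2))
  qed
  have c: "\<nu> \<in> compositions n" if "comp_less n \<nu> \<eta>" for \<nu> using that by (simp add: comp_less_def)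
  have fs: "fspan F {\<nu>. comp_less n \<nu> \<eta>} f"
  proof (rule fspan_trans[OF f])
    fix \<nu> assume "\<nu> \<in> {\<nu>. comp_less n \<nu> \<eta>}"
    then have \<nu>: "comp_less n \<nu> \<eta>" by simp
    show "fspan F {\<nu>. comp_less n \<nu> \<eta>} (monomial_fn n \<nu>)"
      by (rule fspan_mono[OF mono[OF c[OF \<nu>]] _ finite_comp_less]) (use \<nu> comp_less_trans in blast)
  qed
  have "mask f = (\<lambda>_. 0)"
  proof (rule eigenfn_independent[OF finite_comp_less _ _ fs e])
    fix \<nu> assume "\<nu> \<in> {\<nu>. comp_less n \<nu> \<eta>}"
    then have \<nu>: "comp_less n \<nu> \<eta>" by simp
    show "eigenfn \<nu> (F \<nu>)" by (rule F(2)[OF c[OF \<nu>]])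
    show "\<exists>i\<in>{1..n}. eigval \<nu> i \<noteq> eigval \<eta> i"
      using eigval_distinct[OF c[OF \<nu>] \<eta>] \<nu> comp_less_irrefl by blast
  qed
  moreover have "poly_fn f" by (rule poly_fnI[OF f finite_comp_less]) (use c in auto)
  ultimately show ?thesis using poly_fn_eq_0[of f x] by (metis mask_def)
qed

lemma is_nonsym_macdonald_iff:
  "is_nonsym_macdonald n q t \<eta> f \<longleftrightarrow>
    (\<exists>g. fspan (monomial_fn n) {\<nu>. comp_less n \<nu> \<eta>} g \<and> f = (\<lambda>x. monomial_fn n \<eta> x + g x)) \<and> eigenfn \<eta> f"
proof -
  have "(\<exists>b. \<forall>x. f x = monomial_fn n \<eta> x + (\<Sum>\<nu> | comp_less n \<nu> \<eta>. b \<nu> * monomial_fn n \<nu> x)) \<longleftrightarrow>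
    (\<exists>g. fspan (monomial_fn n) {\<nu>. comp_less n \<nu> \<eta>} g \<and> f = (\<lambda>x. monomial_fn n \<eta> x + g x))"
    (is "?l = ?r")
  proof
    assume ?l
    then obtain b where "\<And>x. f x = monomial_fn n \<eta> x + (\<Sum>\<nu> | comp_less n \<nu> \<eta>. b \<nu> * monomial_fn n \<nu> x)" by blast
    then have "f = (\<lambda>x. monomial_fn n \<eta> x + (\<Sum>\<nu> | comp_less n \<nu> \<eta>. b \<nu> * monomial_fn n \<nu> x))" by (rule ext)
    then show ?r unfolding fspan_def by blast
  next
    assume ?r
    then show ?l unfolding fspan_def by auto
  qed
  moreover have "(\<forall>i\<in>{1..n}. \<forall>x. gen x \<longrightarrow> Y_op n q t i f x = eigval \<eta> i * f x) \<longleftrightarrow> eigenfn \<eta> f"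
    unfolding eigenfn_def by (rule ball_cong[OF refl]) (rule YY_mask_eigen_iff[symmetric])
  ultimately show ?thesis
    unfolding is_nonsym_macdonald_def eigval_def by (simp only:)
qed

text \<open>Two candidates share the leading monomial, so their difference is an eigenfunction for
  \<eta> in the span of strictly smaller monomials. This makes the definite description in
  \<open>nonsym_macdonald\<close> well defined.\<close>

lemma nonsym_macdonald_eqI:
  assumes \<eta>: "\<eta> \<in> compositions n" and f: "triangular \<eta> f" "eigenfn \<eta> f"
  shows "nonsym_macdonald n q t \<eta> = f"
  unfolding nonsym_macdonald_def
proof (rule the_equality)
  show f': "is_nonsym_macdonald n q t \<eta> f"
    using f fspan_mono[OF _ lower_subset finite_comp_less]
    unfolding is_nonsym_macdonald_iff triangular_def by blast
  fix h assume h: "is_nonsym_macdonald n q t \<eta> h"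
  obtain g0 where g0: "fspan (monomial_fn n) {\<nu>. comp_less n \<nu> \<eta>} g0" "h = (\<lambda>x. monomial_fn n \<eta> x + g0 x)"
    using h unfolding is_nonsym_macdonald_iff by blast
  obtain g1 where g1: "fspan (monomial_fn n) {\<nu>. comp_less n \<nu> \<eta>} g1" "f = (\<lambda>x. monomial_fn n \<eta> x + g1 x)"
    using f' unfolding is_nonsym_macdonald_iff by blast
  have "fspan (monomial_fn n) {\<nu>. comp_less n \<nu> \<eta>} (\<lambda>x. 1 * h x + (-1) * f x)"
    using fspan_diff[OF g0(1) g1(1)] by (simp add: g0(2) g1(2))
  moreover have "eigenfn \<eta> (\<lambda>x. 1 * h x + (-1) * f x)"
    unfolding eigenfn_def mask_linear YY_linear
    using h f(2) unfolding is_nonsym_macdonald_iff eigenfn_def by (simp add: algebra_simps)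
  ultimately have "1 * h x + (-1) * f x = 0" for x by (rule comp_less_span_eigenfn_0[OF \<eta>])
  then show "h = f" by (simp add: fun_eq_iff)
qed

abbreviation E :: "(nat \<Rightarrow> nat) \<Rightarrow> point_fn" where "E \<eta> \<equiv> nonsym_macdonald n q t \<eta>"

lemma
  assumes "\<eta> \<in> compositions n"
  shows E_triangular: "triangular \<eta> (E \<eta>)" and E_eigenfn: "eigenfn \<eta> (E \<eta>)"
  using triangular_eigenfn_exists[OF assms] nonsym_macdonald_eqI[OF assms] by metis+

lemma E_zero: "E (\<lambda>_. 0) = (\<lambda>_. 1)"
  by (rule nonsym_macdonald_eqI) (simp_all add: compositions_def triangular_zero eigenfn_zero)

lemma E_raise:
  assumes "\<eta> \<in> compositions n"
  shows "E (raise_comp n \<eta>) = (\<lambda>x. of_real (1 / q ^ \<eta> 1) * (x n * E \<eta> (rot x)))"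
  by (intro nonsym_macdonald_eqI triangular_raise eigenfn_scale eigenfn_raise
      E_triangular E_eigenfn raise_comp_compositions n_pos assms)

lemma E_swap:
  assumes "\<eta> \<in> compositions n" "i \<in> {1..<n}" "\<eta> i < \<eta> (Suc i)" "x i \<noteq> x (Suc i)"
  shows "of_real t * E (swap_comp i \<eta>) x = T_op t i (E \<eta>) x + swap_coeff \<eta> i * E \<eta> x"
proof -
  obtain g where g: "triangular (swap_comp i \<eta>) g"
    "\<And>x. x i \<noteq> x (Suc i) \<Longrightarrow> of_real t * g x = T_op t i (E \<eta>) x + swap_coeff \<eta> i * E \<eta> x"
    using triangular_swap[OF E_triangular[OF assms(1)] assms(1-3)] by blast
  have "eigenfn (swap_comp i \<eta>) (\<lambda>x. of_real t * g x)"
    by (rule eigenfn_swap[OF E_eigenfn[OF assms(1)] assms(2,3) g(2)])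
  then have "eigenfn (swap_comp i \<eta>) (\<lambda>x. (1 / of_real t) * (of_real t * g x))" by (rule eigenfn_scale)
  then have "eigenfn (swap_comp i \<eta>) g" using t_pos by simp
  then have "E (swap_comp i \<eta>) = g"
    using nonsym_macdonald_eqI[OF swap_comp_compositions[OF assms(2,1)] g(1)] by simp
  then show ?thesis using g(2)[OF assms(4)] by simp
qed

lemma poly_fn_E:
  assumes "\<eta> \<in> compositions n" shows "poly_fn (E \<eta>)"
proof -
  obtain g where g: "fspan (monomial_fn n) (lower \<eta>) g" "E \<eta> = (\<lambda>x. monomial_fn n \<eta> x + g x)"
    using E_triangular[OF assms] unfolding triangular_def by blast
  have "poly_fn g"
    by (rule poly_fnI[OF g(1) finite_lower]) (auto simp: lower_def affine_le_def)
  then show ?thesis using poly_fn_linear[OF poly_fn_monomial[OF assms], of g 1 1] by (simp add: g(2))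
qed

end

subsection \<open>q-factorials as holomorphic functions\<close>

lemma qpoch_inf_convergent:
  assumes "0 < q" "q < 1"
  shows "convergent_prod (\<lambda>i. 1 - z * complex_of_real q ^ i)"
proof (rule abs_convergent_prod_imp_convergent_prod)
  have "summable (\<lambda>i. norm z * q ^ i)"
    using assms by (intro summable_mult summable_geometric) auto
  then show "abs_convergent_prod (\<lambda>i. 1 - z * complex_of_real q ^ i)"
    unfolding abs_convergent_prod_conv_summable using assms
    by (simp add: norm_mult norm_power)
qed

lemma qpoch_inf_LIMSEQ:
  assumes "0 < q" "q < 1"
  shows "(\<lambda>N. \<Prod>i<N. 1 - z * complex_of_real q ^ i) \<longlonglongrightarrow> qpoch_inf z q"
  using convergent_prod_LIMSEQ[OF qpoch_inf_convergent[OF assms, of z]]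
  unfolding qpoch_inf_def LIMSEQ_lessThan_iff_atMost .

lemma qpoch_inf_shift:
  assumes "0 < q" "q < 1"
  shows "qpoch_inf z q = (1 - z) * qpoch_inf (z * of_real q) q"
proof (rule LIMSEQ_unique)
  show "(\<lambda>N. \<Prod>i<Suc N. 1 - z * complex_of_real q ^ i) \<longlonglongrightarrow> qpoch_inf z q"
    by (rule LIMSEQ_Suc[OF qpoch_inf_LIMSEQ[OF assms]])
  have "(\<Prod>i<Suc N. 1 - z * complex_of_real q ^ i) = (1 - z) * (\<Prod>i<N. 1 - z * of_real q * complex_of_real q ^ i)" for N
    by (subst prod.lessThan_Suc_shift) (simp add: mult.assoc)
  then show "(\<lambda>N. \<Prod>i<Suc N. 1 - z * complex_of_real q ^ i) \<longlonglongrightarrow> (1 - z) * qpoch_inf (z * of_real q) q"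
    by (simp only:) (intro tendsto_mult_left qpoch_inf_LIMSEQ assms)
qed

lemma qpoch_inf_eq_0:
  assumes "0 < q" "q < 1"
  shows "qpoch_inf z q = 0 \<longleftrightarrow> (\<exists>i. z * complex_of_real q ^ i = 1)"
proof -
  have "(\<lambda>i. 1 - z * complex_of_real q ^ i) has_prod qpoch_inf z q"
    unfolding qpoch_inf_def using qpoch_inf_convergent[OF assms] by blast
  then have "qpoch_inf z q = 0 \<longleftrightarrow> 0 \<in> range (\<lambda>i. 1 - z * complex_of_real q ^ i)"
    by (rule has_prod_eq_0_iff)
  then show ?thesis by (auto simp: image_iff)
qed

lemma qpoch_inf_nonzero:
  assumes "0 < q" "q < 1" "norm z < 1"
  shows "qpoch_inf z q \<noteq> 0"
proof
  assume "qpoch_inf z q = 0"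
  then obtain i where "z * complex_of_real q ^ i = 1" using qpoch_inf_eq_0[OF assms(1,2)] by blast
  then have "norm z * q ^ i = 1" using assms by (metis abs_of_pos norm_mult norm_of_real norm_one norm_power)
  moreover have "norm z * q ^ i \<le> norm z * 1"
    using assms by (intro mult_left_mono power_le_one) auto
  ultimately show False using assms by simp
qed

lemma qpoch_inf_holomorphic:
  assumes "0 < q" "q < 1"
  shows "(\<lambda>z. qpoch_inf z q) holomorphic_on S"
proof -
  have "(\<lambda>z. qpoch_inf z q) holomorphic_on UNIV"
  proof (rule holomorphic_uniform_sequence[where f = "\<lambda>N z. \<Prod>i<N. 1 - z * complex_of_real q ^ i"])
    show "(\<lambda>z. \<Prod>i<N. 1 - z * complex_of_real q ^ i) holomorphic_on UNIV" for N
      by (intro holomorphic_intros)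
    fix z :: complex
    have "uniformly_convergent_on (cball z 1) (\<lambda>N z. \<Sum>i<N. norm ((1 - z * complex_of_real q ^ i) - 1))"
    proof (rule Weierstrass_m_test')
      show "summable (\<lambda>i. (norm z + 1) * q ^ i)"
        using assms by (intro summable_mult summable_geometric) auto
      fix i x assume "x \<in> cball z 1"
      then have "norm x \<le> norm z + 1"
        using norm_triangle_ineq2[of x z] by (simp add: dist_norm norm_minus_commute)
      then show "norm (norm ((1 - x * complex_of_real q ^ i) - 1)) \<le> (norm z + 1) * q ^ i"
        using assms by (simp add: norm_mult norm_power mult_right_mono)
    qed
    then have "uniformly_convergent_on (cball z 1) (\<lambda>N z. \<Prod>i<N. 1 - z * complex_of_real q ^ i)"
      by (intro uniformly_convergent_on_prod') (auto intro!: continuous_intros)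
    then obtain l where l: "uniform_limit (cball z 1) (\<lambda>N z. \<Prod>i<N. 1 - z * complex_of_real q ^ i) l sequentially"
      unfolding uniformly_convergent_on_def by blast
    have "l x = qpoch_inf x q" if "x \<in> cball z 1" for x
      using tendsto_uniform_limitI[OF l that] qpoch_inf_LIMSEQ[OF assms, of x] by (rule LIMSEQ_unique)
    then have "uniform_limit (cball z 1) (\<lambda>N z. \<Prod>i<N. 1 - z * complex_of_real q ^ i) (\<lambda>x. qpoch_inf x q) sequentially"
      using l uniform_limit_cong'[of "cball z 1"] by (metis (mono_tags, lifting))
    then show "\<exists>d>0. cball z d \<subseteq> UNIV \<and>
        uniform_limit (cball z d) (\<lambda>N z. \<Prod>i<N. 1 - z * complex_of_real q ^ i) (\<lambda>x. qpoch_inf x q) sequentially"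
      by (intro exI[of _ 1]) auto
  qed auto
  then show ?thesis by (rule holomorphic_on_subset) simp
qed

lemma qpoch_inf_compose_holomorphic [holomorphic_intros]:
  assumes "0 < q" "q < 1" "f holomorphic_on S"
  shows "(\<lambda>z. qpoch_inf (f z) q) holomorphic_on S"
  using holomorphic_on_compose[OF assms(3) qpoch_inf_holomorphic[OF assms(1,2)]] by (simp add: o_def)

lemma qpoch_inf_measurable [measurable]:
  assumes "0 < q" "q < 1"
  shows "(\<lambda>z. qpoch_inf z q) \<in> borel_measurable borel"
  by (rule borel_measurable_continuous_onI)
    (rule holomorphic_on_imp_continuous_on[OF qpoch_inf_holomorphic[OF assms]])

text \<open>The poles of (z;q)_c lie among the points q^(-c-i) with i \<ge> 0, all of modulus at
  least q^(-c).\<close>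

lemma qpoch_holomorphic:
  assumes "0 < q" "q < 1" "f holomorphic_on S" "\<And>z. z \<in> S \<Longrightarrow> norm (f z) < q powr (- c)"
  shows "(\<lambda>z. qpoch (f z) q c) holomorphic_on S"
proof -
  have "qpoch_inf (f z * of_real (q powr c)) q \<noteq> 0" if "z \<in> S" for z
  proof (rule qpoch_inf_nonzero[OF assms(1,2)])
    have "norm (f z) * q powr c < q powr (- c) * q powr c"
      using assms(1) assms(4)[OF that] by (intro mult_strict_right_mono) auto
    then show "norm (f z * complex_of_real (q powr c)) < 1"
      using assms(1) by (simp add: norm_mult powr_add[symmetric])
  qed
  then show ?thesis unfolding qpoch_def
    by (intro holomorphic_intros assms(1,2,3)) auto
qed

text \<open>
  The function \<open>A\<close> removes the removable singularities of the quotient defining \<open>(z;q)\<^sub>c\<close>.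
\<close>

lemma qpoch_regularization:
  assumes q: "0 < q" "q < 1" and \<rho>: "\<rho> > 0" and c: "c \<in> \<nat> \<or> \<rho> < q powr (- c)"
  obtains A R where "\<rho> < R" "A holomorphic_on ball 0 R"
    "\<And>z. norm z < R \<Longrightarrow> A z * (1 - of_real (q powr c) * z) = (1 - z) * A (of_real q * z)"
    "\<And>z. norm z = \<rho> \<Longrightarrow> z \<noteq> of_real \<rho> \<Longrightarrow> A z = qpoch z q c"
    "\<rho> < q powr (- c) \<Longrightarrow> A = (\<lambda>z. qpoch z q c)"
proof (cases "\<rho> < q powr (- c)")
  case True
  show ?thesis
  proof (rule that[of "q powr (- c)" "\<lambda>z. qpoch z q c"])
    show "(\<lambda>z. qpoch z q c) holomorphic_on ball 0 (q powr (- c))"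
      by (rule qpoch_holomorphic[OF q]) (auto intro: holomorphic_intros)
    fix z :: complex assume z: "norm z < q powr (- c)"
    have "norm z * q powr c < q powr (- c) * q powr c"
      using q z by (intro mult_strict_right_mono) auto
    then have n: "norm (z * complex_of_real (q powr c)) < 1"
      using q by (simp add: norm_mult powr_add[symmetric])
    define u where "u = z * complex_of_real (q powr c)"
    have nz: "qpoch_inf u q \<noteq> 0" using qpoch_inf_nonzero[OF q n] by (simp add: u_def)
    then have "1 - u \<noteq> 0" "qpoch_inf (u * of_real q) q \<noteq> 0"
      using qpoch_inf_shift[OF q, of u] by auto
    moreover have zq: "z * of_real q * complex_of_real (q powr c) = u * of_real q" by (simp add: u_def)
    moreover have "of_real (q powr c) * z = u" by (simp add: u_def)
    ultimately show "qpoch z q c * (1 - of_real (q powr c) * z) = (1 - z) * qpoch (of_real q * z) q c"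
      unfolding qpoch_def mult.commute[of "of_real q" z] qpoch_inf_shift[OF q, of z] u_def[symmetric]
        qpoch_inf_shift[OF q, of u] zq by simp
  qed (use True in auto)
next
  case False
  then obtain m where m: "c = of_nat m" using c by (auto elim: Nats_cases)
  have qc: "q powr c = q ^ m" using q by (simp add: m powr_realpow)
  define A where "A = (\<lambda>z. \<Prod>i<m. 1 - z * complex_of_real q ^ i)"
  show ?thesis
  proof (rule that[of "\<rho> + 1" A])
    show "A holomorphic_on ball 0 (\<rho> + 1)" unfolding A_def by (intro holomorphic_intros)
    fix z :: complex
    have "A z * (1 - of_real (q powr c) * z) = (\<Prod>i<Suc m. 1 - z * complex_of_real q ^ i)"
      by (simp add: A_def qc mult.commute)
    also have "\<dots> = (1 - z) * A (of_real q * z)"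
      unfolding A_def by (subst prod.lessThan_Suc_shift) (simp add: mult_ac)
    finally show "A z * (1 - of_real (q powr c) * z) = (1 - z) * A (of_real q * z)" .
  next
    fix z :: complex assume z: "norm z = \<rho>" "z \<noteq> of_real \<rho>"
    have "qpoch_inf z q = (\<Prod>i<k. 1 - z * complex_of_real q ^ i) * qpoch_inf (z * of_real q ^ k) q" for k
    proof (induction k)
      case (Suc k)
      then show ?case using qpoch_inf_shift[OF q, of "z * of_real q ^ k"] by (simp add: mult_ac)
    qed simp
    note split = this[of m]
    \<comment> \<open>Zeros of the denominator are positive reals, and the only positive real on the
      circle is the excluded point \<rho>.\<close>
    have "qpoch_inf (z * of_real q ^ m) q \<noteq> 0"
    proof
      assume "qpoch_inf (z * of_real q ^ m) q = 0"
      then obtain i where "z * of_real q ^ m * of_real q ^ i = 1" using qpoch_inf_eq_0[OF q] by blast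
      then have "z * of_real (q ^ (m + i)) = 1" by (simp add: power_add mult.assoc)
      then have zr: "z = of_real (1 / q ^ (m + i))" using q by (simp add: field_simps)
      then have "norm z = 1 / q ^ (m + i)" using q by (simp add: norm_divide norm_power)
      then show False using z zr by simp
    qed
    then show "A z = qpoch z q c" unfolding qpoch_def qc A_def of_real_power split by simp
  qed (use False in auto)
qed

text \<open>With z = \<rho> exp(2 \<pi> i y) the integral is (2 \<pi> i)^(-1) times the contour
  integral of g(z) / z, and concentric circles are homotopic in the annulus.\<close>

lemma circle_integral_radius:
  fixes g :: "complex \<Rightarrow> complex"
  assumes g: "g holomorphic_on {z. R1 < norm z \<and> norm z < R2}" and R1: "0 \<le> R1"
    and \<rho>: "R1 < \<rho>1" "\<rho>1 < R2" "R1 < \<rho>2" "\<rho>2 < R2"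
  shows "(\<integral>y. indicator {-1/2..1/2} y *\<^sub>R g (of_real \<rho>1 * cis (2 * pi * y)) \<partial>lborel) =
         (\<integral>y. indicator {-1/2..1/2} y *\<^sub>R g (of_real \<rho>2 * cis (2 * pi * y)) \<partial>lborel)"
proof -
  let ?S = "{z::complex. R1 < norm z \<and> norm z < R2}"
  have op: "open ?S"
    by (intro open_Collect_conj open_Collect_less continuous_intros)
  have cont: "continuous_on ?S g" by (rule holomorphic_on_imp_continuous_on[OF g])
  define p where "p = (\<lambda>\<rho>. part_circlepath 0 \<rho> (-pi) pi)"
  have key: "(\<integral>y. indicator {-1/2..1/2} y *\<^sub>R g (of_real \<rho> * cis (2 * pi * y)) \<partial>lborel) =
    contour_integral (p \<rho>) (\<lambda>z. g z / z) / (2 * pi * \<i>)" if "R1 < \<rho>" "\<rho> < R2" for \<rho>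
  proof -
    have pos: "\<rho> > 0" using that R1 by simp
    have c: "continuous_on UNIV (\<lambda>y. g (of_real \<rho> * cis (2 * pi * y)))"
      by (rule continuous_on_compose2[OF cont]) (use that pos in \<open>auto intro!: continuous_intros simp: norm_mult\<close>)
    have c': "continuous_on UNIV (\<lambda>y. g (of_real \<rho> * cis y))"
      by (rule continuous_on_compose2[OF cont]) (use that pos in \<open>auto intro!: continuous_intros simp: norm_mult\<close>)
    define I where "I = integral {-pi..pi} (\<lambda>y. g (of_real \<rho> * cis y))"
    have hI: "((\<lambda>y. g (of_real \<rho> * cis y)) has_integral I) {-pi..pi}"
      unfolding I_def by (intro integrable_integral integrable_continuous_interval continuous_on_subset[OF c']) auto
    have "((\<lambda>y. g (of_real \<rho> * cis (2 * pi * y + 0))) has_integral (1 / \<bar>2 * pi\<bar> ^ DIM(real)) *\<^sub>R I)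
        ((\<lambda>x. (1 / (2 * pi)) *\<^sub>R x + - ((1 / (2 * pi)) *\<^sub>R 0)) ` cbox (-pi) pi)"
      using has_integral_affinity[of "\<lambda>y. g (of_real \<rho> * cis y)" I "-pi" pi "2 * pi" 0] hI by simp
    moreover have "(\<lambda>x. (1 / (2 * pi)) *\<^sub>R x + - ((1 / (2 * pi)) *\<^sub>R 0)) ` cbox (-pi) pi = {-1/2..1/2::real}"
      using image_affinity_cbox[of "1 / (2 * pi)" 0 "-pi" pi] by (simp add: cbox_interval)
    ultimately have h2: "((\<lambda>y. g (of_real \<rho> * cis (2 * pi * y))) has_integral (1 / (2 * pi)) *\<^sub>R I) {-1/2..1/2}"
      by simp
    have "set_integrable lborel {-1/2..1/2} (\<lambda>y. g (of_real \<rho> * cis (2 * pi * y)))"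
      by (rule borel_integrable_atLeastAtMost') (rule continuous_on_subset[OF c], simp)
    then have "(\<integral>y. indicator {-1/2..1/2} y *\<^sub>R g (of_real \<rho> * cis (2 * pi * y)) \<partial>lborel) =
        integral {-1/2..1/2} (\<lambda>y. g (of_real \<rho> * cis (2 * pi * y)))"
      using set_borel_integral_eq_integral(2) unfolding set_lebesgue_integral_def by blast
    also have "\<dots> = (1 / (2 * pi)) *\<^sub>R I" using h2 by (rule integral_unique)
    finally have 1: "(\<integral>y. indicator {-1/2..1/2} y *\<^sub>R g (of_real \<rho> * cis (2 * pi * y)) \<partial>lborel) = (1 / (2 * pi)) *\<^sub>R I" .
    have "((\<lambda>t. g (0 + of_real \<rho> * cis t) / (0 + of_real \<rho> * cis t) * of_real \<rho> * \<i> * cis t) has_integral \<i> * I) {-pi..pi}"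
    proof -
      have "((\<lambda>t. \<i> * g (of_real \<rho> * cis t)) has_integral \<i> * I) {-pi..pi}"
        by (rule has_integral_mult_right[OF hI])
      moreover have "\<i> * g (of_real \<rho> * cis t) = g (0 + of_real \<rho> * cis t) / (0 + of_real \<rho> * cis t) * of_real \<rho> * \<i> * cis t" for t
        using pos by (simp add: field_simps)
      ultimately show ?thesis by (simp only:)
    qed
    then have "((\<lambda>z. g z / z) has_contour_integral \<i> * I) (p \<rho>)"
      unfolding p_def by (subst has_contour_integral_part_circlepath_iff) auto
    then have "contour_integral (p \<rho>) (\<lambda>z. g z / z) = \<i> * I" by (rule contour_integral_unique)
    then show ?thesis unfolding 1 by (simp add: scaleR_conv_of_real)
  qed
  have "contour_integral (p \<rho>1) (\<lambda>z. g z / z) = contour_integral (p \<rho>2) (\<lambda>z. g z / z)"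
  proof (rule Cauchy_theorem_homotopic_loops[OF _ op])
    show "(\<lambda>z. g z / z) holomorphic_on ?S"
      by (intro holomorphic_intros g) (use R1 in auto)
    show "homotopic_loops ?S (p \<rho>1) (p \<rho>2)"
    proof (rule homotopic_loops_linear)
      fix s x :: real assume "s \<in> {0..1}"
      define e where "e = exp (\<i> * complex_of_real (linepath (-pi) pi s))"
      have pe: "p \<rho> s = of_real \<rho> * e" for \<rho> by (simp add: p_def part_circlepath_def e_def)
      have ne: "norm e = 1" unfolding e_def by (rule norm_exp_i_times)
      have "(1 - u) *\<^sub>R (of_real \<rho>1 * e) + u *\<^sub>R (of_real \<rho>2 * e) \<in> ?S" if "0 \<le> u" "u \<le> 1" for u
      proof -
        have "(1 - u) *\<^sub>R (of_real \<rho>1 * e) + u *\<^sub>R (of_real \<rho>2 * e) = of_real ((1 - u) * \<rho>1 + u * \<rho>2) * e"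
          by (simp add: scaleR_conv_of_real algebra_simps)
        moreover have "R1 < (1 - u) * \<rho>1 + u * \<rho>2"
        proof -
          have "(1 - u) * min \<rho>1 \<rho>2 + u * min \<rho>1 \<rho>2 \<le> (1 - u) * \<rho>1 + u * \<rho>2"
            using that by (intro add_mono mult_left_mono) auto
          then show ?thesis using \<rho> by (simp add: algebra_simps)
        qed
        moreover have "(1 - u) * \<rho>1 + u * \<rho>2 < R2"
        proof -
          have "(1 - u) * \<rho>1 + u * \<rho>2 \<le> (1 - u) * max \<rho>1 \<rho>2 + u * max \<rho>1 \<rho>2"
            using that by (intro add_mono mult_left_mono) auto
          then show ?thesis using \<rho> by (simp add: algebra_simps)
        qed
        ultimately show ?thesis using R1 ne by (simp add: norm_mult del: of_real_add of_real_mult)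
      qed
      then show "closed_segment (p \<rho>1 s) (p \<rho>2 s) \<subseteq> ?S"
        unfolding pe closed_segment_def by blast
    qed (simp_all add: p_def exp_minus)
  qed (auto simp: p_def)
  then show ?thesis using key \<rho> by simp
qed

subsection \<open>Integrals over the torus\<close>

definition cube :: "nat \<Rightarrow> (nat \<Rightarrow> real) set" where
  "cube n = PiE {1..n} (\<lambda>_. {-1/2..1/2})"

abbreviation lborel_n :: "nat \<Rightarrow> (nat \<Rightarrow> real) measure" where
  "lborel_n n \<equiv> PiM {1..n} (\<lambda>_. lborel)"

definition cube_integral :: "nat \<Rightarrow> ((nat \<Rightarrow> real) \<Rightarrow> complex) \<Rightarrow> complex" where
  "cube_integral n G = (\<integral>\<theta>. indicator (cube n) \<theta> *\<^sub>R G \<theta> \<partial>lborel_n n)"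

lemma fourier_integral_eq: "fourier_integral n r f = cube_integral n (\<lambda>\<theta>. f (torus_point r \<theta>))"
  unfolding fourier_integral_def cube_integral_def set_lebesgue_integral_def cube_def ..

definition cube_fn :: "nat \<Rightarrow> ((nat \<Rightarrow> real) \<Rightarrow> complex) \<Rightarrow> bool" where
  "cube_fn n G \<longleftrightarrow> G \<in> borel_measurable (lborel_n n) \<and> (\<exists>B. \<forall>\<theta>\<in>cube n. norm (G \<theta>) \<le> B)"

interpretation lborel_product: product_sigma_finite "\<lambda>_::nat. lborel :: real measure"
  by standard

lemma cube_sets: "cube n \<in> sets (lborel_n n)"
  unfolding cube_def by (rule sets_PiM_I_finite) auto

lemma emeasure_cube: "emeasure (lborel_n n) (cube n) = 1"
  unfolding cube_def by (subst lborel_product.emeasure_PiM) auto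

lemma cube_fn_integrable:
  assumes "cube_fn n G" shows "integrable (lborel_n n) (\<lambda>\<theta>. indicator (cube n) \<theta> *\<^sub>R G \<theta>)"
proof -
  obtain B where "\<And>\<theta>. \<theta> \<in> cube n \<Longrightarrow> norm (G \<theta>) \<le> B" using assms unfolding cube_fn_def by blast
  then show ?thesis
    using assms cube_sets emeasure_cube
    by (intro integrableI_bounded_set_indicator[where B = B]) (auto simp: cube_fn_def)
qed

lemma cube_fn_const: "cube_fn n (\<lambda>_. c)"
  by (auto simp: cube_fn_def)

lemma cube_fn_mult:
  assumes "cube_fn n G" "cube_fn n H" shows "cube_fn n (\<lambda>\<theta>. G \<theta> * H \<theta>)"
proof -
  obtain B B' where "\<And>\<theta>. \<theta> \<in> cube n \<Longrightarrow> norm (G \<theta>) \<le> B" "\<And>\<theta>. \<theta> \<in> cube n \<Longrightarrow> norm (H \<theta>) \<le> B'"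
    using assms unfolding cube_fn_def by blast
  then have "norm (G \<theta> * H \<theta>) \<le> B * B'" if "\<theta> \<in> cube n" for \<theta>
    unfolding norm_mult using that by (intro mult_mono) (auto intro: order_trans[OF norm_ge_zero])
  then show ?thesis using assms unfolding cube_fn_def by (auto intro!: borel_measurable_times)
qed

lemma cube_fn_add:
  assumes "cube_fn n G" "cube_fn n H" shows "cube_fn n (\<lambda>\<theta>. G \<theta> + H \<theta>)"
proof -
  obtain B B' where "\<And>\<theta>. \<theta> \<in> cube n \<Longrightarrow> norm (G \<theta>) \<le> B" "\<And>\<theta>. \<theta> \<in> cube n \<Longrightarrow> norm (H \<theta>) \<le> B'"
    using assms unfolding cube_fn_def by blast
  then have "norm (G \<theta> + H \<theta>) \<le> B + B'" if "\<theta> \<in> cube n" for \<theta>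
    using that by (intro norm_triangle_mono)
  then show ?thesis using assms unfolding cube_fn_def by (auto intro!: borel_measurable_add)
qed

lemma cube_fn_diff:
  assumes "cube_fn n G" "cube_fn n H" shows "cube_fn n (\<lambda>\<theta>. G \<theta> - H \<theta>)"
  using cube_fn_add[OF assms(1) cube_fn_mult[OF cube_fn_const[of n "-1"] assms(2)]] by simp

lemma cube_fn_sum: "(\<And>j. j \<in> J \<Longrightarrow> cube_fn n (G j)) \<Longrightarrow> cube_fn n (\<lambda>\<theta>. \<Sum>j\<in>J. G j \<theta>)"
  by (induction J rule: infinite_finite_induct) (simp_all add: cube_fn_const cube_fn_add)

lemma cube_fn_prod: "(\<And>j. j \<in> J \<Longrightarrow> cube_fn n (G j)) \<Longrightarrow> cube_fn n (\<lambda>\<theta>. \<Prod>j\<in>J. G j \<theta>)"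
  by (induction J rule: infinite_finite_induct) (simp_all add: cube_fn_const cube_fn_mult)

lemma cube_fn_power: "cube_fn n G \<Longrightarrow> cube_fn n (\<lambda>\<theta>. G \<theta> ^ k)"
  by (induction k) (simp_all add: cube_fn_const cube_fn_mult)

lemma cube_fn_component:
  assumes "continuous_on UNIV g" "i \<in> {1..n}"
  shows "cube_fn n (\<lambda>\<theta>. g (\<theta> i))"
proof -
  have "g \<in> borel_measurable borel" using assms(1) by (rule borel_measurable_continuous_onI)
  then have "(\<lambda>\<theta>. g (\<theta> i)) \<in> borel_measurable (lborel_n n)"
    by (rule measurable_compose[rotated]) (use assms(2) measurable_component_singleton[of i "{1..n}" "\<lambda>_. lborel"] in simp)
  moreover have "bounded (g ` {-1/2..1/2})"
    by (intro compact_imp_bounded compact_continuous_image continuous_on_subset[OF assms(1)]) auto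
  then obtain B where "\<And>y. y \<in> {-1/2..1/2} \<Longrightarrow> norm (g y) \<le> B" unfolding bounded_iff by blast
  then have "\<forall>\<theta>\<in>cube n. norm (g (\<theta> i)) \<le> B" using assms(2) by (auto simp: cube_def PiE_iff)
  ultimately show ?thesis unfolding cube_fn_def by blast
qed

lemma cube_fn_difference:
  assumes "continuous_on UNIV g" "i \<in> {1..n}" "j \<in> {1..n}"
  shows "cube_fn n (\<lambda>\<theta>. g (\<theta> i - \<theta> j))"
proof -
  have [measurable]: "g \<in> borel_measurable borel" using assms(1) by (rule borel_measurable_continuous_onI)
  have [measurable]: "(\<lambda>\<theta>. \<theta> k) \<in> borel_measurable (lborel_n n)" if "k \<in> {1..n}" for k
    using that measurable_component_singleton[of k "{1..n}" "\<lambda>_. lborel"] by simp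
  have "(\<lambda>\<theta>. g (\<theta> i - \<theta> j)) \<in> borel_measurable (lborel_n n)"
    using assms(2,3) by measurable
  moreover have "bounded (g ` {-1..1})"
    by (intro compact_imp_bounded compact_continuous_image continuous_on_subset[OF assms(1)]) auto
  then obtain B where B: "\<And>y. y \<in> {-1..1} \<Longrightarrow> norm (g y) \<le> B" unfolding bounded_iff by blast
  have "norm (g (\<theta> i - \<theta> j)) \<le> B" if "\<theta> \<in> cube n" for \<theta>
  proof (rule B)
    have "\<theta> i \<in> {-1/2..1/2}" "\<theta> j \<in> {-1/2..1/2}" using that assms(2,3) unfolding cube_def PiE_iff by blast+
    then show "\<theta> i - \<theta> j \<in> {-1..1}" by simp
  qed
  ultimately show ?thesis unfolding cube_fn_def by blast
qed

lemma cube_integral_add: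
  assumes "cube_fn n G" "cube_fn n H"
  shows "cube_integral n (\<lambda>\<theta>. G \<theta> + H \<theta>) = cube_integral n G + cube_integral n H"
  unfolding cube_integral_def scaleR_add_right
  by (rule Bochner_Integration.integral_add) (intro cube_fn_integrable assms)+

lemma cube_integral_diff:
  assumes "cube_fn n G" "cube_fn n H"
  shows "cube_integral n (\<lambda>\<theta>. G \<theta> - H \<theta>) = cube_integral n G - cube_integral n H"
  unfolding cube_integral_def scaleR_diff_right
  by (rule Bochner_Integration.integral_diff) (intro cube_fn_integrable assms)+

lemma cube_integral_scale: "cube_integral n (\<lambda>\<theta>. c * G \<theta>) = c * cube_integral n G"
  unfolding cube_integral_def by (simp flip: mult_scaleR_right)

lemma cube_integral_sum:
  assumes "\<And>j. j \<in> J \<Longrightarrow> cube_fn n (G j)"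
  shows "cube_integral n (\<lambda>\<theta>. \<Sum>j\<in>J. G j \<theta>) = (\<Sum>j\<in>J. cube_integral n (G j))"
  unfolding cube_integral_def scaleR_sum_right
  by (rule Bochner_Integration.integral_sum) (intro cube_fn_integrable assms)

lemma cube_integral_cong:
  assumes "\<And>\<theta>. \<theta> \<in> cube n \<Longrightarrow> G \<theta> = H \<theta>" shows "cube_integral n G = cube_integral n H"
  unfolding cube_integral_def
  by (rule Bochner_Integration.integral_cong) (auto simp: indicator_def assms)

lemma cube_integral_cong_AE:
  assumes "AE \<theta> in lborel_n n. \<theta> \<in> cube n \<longrightarrow> G \<theta> = H \<theta>"
    and G: "G \<in> borel_measurable (lborel_n n)" and H: "H \<in> borel_measurable (lborel_n n)"
  shows "cube_integral n G = cube_integral n H"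
  unfolding cube_integral_def
proof (rule integral_cong_AE)
  have i: "indicat_real (cube n) \<in> borel_measurable (lborel_n n)"
    using cube_sets by simp
  show "(\<lambda>\<theta>. indicat_real (cube n) \<theta> *\<^sub>R G \<theta>) \<in> borel_measurable (lborel_n n)"
    "(\<lambda>\<theta>. indicat_real (cube n) \<theta> *\<^sub>R H \<theta>) \<in> borel_measurable (lborel_n n)"
    using i G H by (auto intro!: borel_measurable_scaleR)
  show "AE \<theta> in lborel_n n. indicator (cube n) \<theta> *\<^sub>R G \<theta> = indicator (cube n) \<theta> *\<^sub>R H \<theta>"
    using assms(1) by eventually_elim (auto simp: indicator_def)
qed

text \<open>In the cube, \<theta>_i = 0 means x_i = r, which is where a q-factorial quotient may
  read 0 / 0.\<close>

lemma cube_AE_nonzero: "AE \<theta> in lborel_n n. \<forall>i\<in>{1..n}. \<theta> i \<noteq> 0"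
proof -
  have "AE \<theta> in lborel_n n. \<theta> i \<noteq> 0" if i: "i \<in> {1..n}" for i
  proof (rule AE_I[where N = "PiE {1..n} (\<lambda>j. if j = i then {0} else UNIV)"])
    show "{\<theta> \<in> space (lborel_n n). \<not> \<theta> i \<noteq> 0} \<subseteq> PiE {1..n} (\<lambda>j. if j = i then {0} else UNIV)"
      by (auto simp: space_PiM PiE_iff extensional_def)
    show "PiE {1..n} (\<lambda>j. if j = i then {0::real} else UNIV) \<in> sets (lborel_n n)"
      by (rule sets_PiM_I_finite) auto
    have "emeasure (lborel_n n) (PiE {1..n} (\<lambda>j. if j = i then {0} else UNIV)) =
        (\<Prod>j\<in>{1..n}. emeasure lborel (if j = i then {0::real} else UNIV))"
      by (rule lborel_product.emeasure_PiM) auto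
    also have "\<dots> = 0" using i by (intro prod_zero) (auto intro!: bexI[of _ i])
    finally show "emeasure (lborel_n n) (PiE {1..n} (\<lambda>j. if j = i then {0} else UNIV)) = 0" .
  qed
  then show ?thesis by (simp add: AE_ball_countable)
qed

lemma cube_integral_permute:
  assumes \<sigma>: "bij_betw \<sigma> {1..n} {1..n}" and G: "G \<in> borel_measurable (lborel_n n)"
  shows "cube_integral n (\<lambda>\<theta>. G (\<lambda>k\<in>{1..n}. \<theta> (\<sigma> k))) = cube_integral n G"
proof -
  define P where "P = (\<lambda>\<theta>::nat \<Rightarrow> real. \<lambda>k\<in>{1..n}. \<theta> (\<sigma> k))"
  have \<sigma>': "\<sigma> k \<in> {1..n}" if "k \<in> {1..n}" for k using bij_betwE[OF \<sigma>] that by blast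
  have P: "P \<in> measurable (lborel_n n) (lborel_n n)"
    unfolding P_def by (rule measurable_restrict) (use \<sigma>' in \<open>auto intro!: measurable_component_singleton\<close>)
  have "distr (lborel_n n) (lborel_n n) P = lborel_n n"
  proof (rule lborel_product.PiM_eqI)
    fix A :: "nat \<Rightarrow> real set" assume A: "\<And>i. i \<in> {1..n} \<Longrightarrow> A i \<in> sets lborel"
    define \<tau> where "\<tau> = inv_into {1..n} \<sigma>"
    have \<tau>: "bij_betw \<tau> {1..n} {1..n}" unfolding \<tau>_def by (rule bij_betw_inv_into[OF \<sigma>])
    have \<tau>': "\<tau> k \<in> {1..n}" "\<sigma> (\<tau> k) = k" if "k \<in> {1..n}" for k
      using bij_betwE[OF \<tau>] bij_betw_inv_into_right[OF \<sigma>] that by (auto simp: \<tau>_def)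
    have \<tau>\<sigma>: "\<tau> (\<sigma> k) = k" if "k \<in> {1..n}" for k
      unfolding \<tau>_def by (rule bij_betw_inv_into_left[OF \<sigma> that])
    have pre: "P -` PiE {1..n} A \<inter> space (lborel_n n) = PiE {1..n} (\<lambda>k. A (\<tau> k))"
    proof (rule set_eqI)
      fix \<theta>
      have "(\<forall>k\<in>{1..n}. \<theta> (\<sigma> k) \<in> A k) \<longleftrightarrow> (\<forall>k\<in>{1..n}. \<theta> k \<in> A (\<tau> k))"
      proof (intro iffI ballI)
        fix k assume "\<forall>k\<in>{1..n}. \<theta> (\<sigma> k) \<in> A k" "k \<in> {1..n}"
        then show "\<theta> k \<in> A (\<tau> k)" using \<tau>'[of k] by metis
      next
        fix k assume "\<forall>k\<in>{1..n}. \<theta> k \<in> A (\<tau> k)" "k \<in> {1..n}"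
        then show "\<theta> (\<sigma> k) \<in> A k" using \<sigma>'[of k] \<tau>\<sigma>[of k] by metis
      qed
      then show "\<theta> \<in> P -` PiE {1..n} A \<inter> space (lborel_n n) \<longleftrightarrow> \<theta> \<in> PiE {1..n} (\<lambda>k. A (\<tau> k))"
        unfolding P_def space_PiM by (simp add: PiE_iff)
    qed
    have "emeasure (distr (lborel_n n) (lborel_n n) P) (PiE {1..n} A) =
        emeasure (lborel_n n) (PiE {1..n} (\<lambda>k. A (\<tau> k)))"
      unfolding pre[symmetric] by (rule emeasure_distr[OF P]) (rule sets_PiM_I_finite, use A in auto)
    also have "\<dots> = (\<Prod>k\<in>{1..n}. emeasure lborel (A (\<tau> k)))"
      by (rule lborel_product.emeasure_PiM) (use A \<tau>' in auto)
    also have "\<dots> = (\<Prod>k\<in>{1..n}. emeasure lborel (A k))"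
      by (rule prod.reindex_bij_betw[OF \<tau>, of "\<lambda>k. emeasure lborel (A k)"])
    finally show "emeasure (distr (lborel_n n) (lborel_n n) P) (PiE {1..n} A) = (\<Prod>k\<in>{1..n}. emeasure lborel (A k))" .
  qed auto
  then have "cube_integral n G = (\<integral>\<theta>. indicator (cube n) \<theta> *\<^sub>R G \<theta> \<partial>distr (lborel_n n) (lborel_n n) P)"
    unfolding cube_integral_def by simp
  also have "\<dots> = (\<integral>\<theta>. indicator (cube n) (P \<theta>) *\<^sub>R G (P \<theta>) \<partial>lborel_n n)"
    by (rule integral_distr[OF P]) (use cube_sets G in \<open>auto intro!: borel_measurable_scaleR\<close>)
  also have "\<dots> = cube_integral n (\<lambda>\<theta>. G (P \<theta>))"
    unfolding cube_integral_def
  proof (rule Bochner_Integration.integral_cong[OF refl])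
    fix \<theta> assume \<theta>: "\<theta> \<in> space (lborel_n n)"
    have "P \<theta> \<in> cube n \<longleftrightarrow> \<theta> \<in> cube n"
    proof -
      have "(\<forall>k\<in>{1..n}. \<theta> (\<sigma> k) \<in> {-1/2..1/2}) \<longleftrightarrow> (\<forall>k\<in>\<sigma> ` {1..n}. \<theta> k \<in> {-1/2..1/2})" by blast
      then show ?thesis unfolding bij_betw_imp_surj_on[OF \<sigma>] cube_def P_def
        using \<theta> by (simp add: PiE_iff space_PiM)
    qed
    then show "indicator (cube n) (P \<theta>) *\<^sub>R G (P \<theta>) = indicator (cube n) \<theta> *\<^sub>R G (P \<theta>)"
      by (simp add: indicator_def)
  qed
  finally show ?thesis by (simp add: P_def)
qed

lemma cube_integral_first_coordinate:
  assumes n: "n \<ge> 1" and G: "cube_fn n G" and H: "cube_fn n H"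
    and eq: "\<And>\<theta>. \<theta> \<in> cube n \<Longrightarrow>
      (\<integral>y. indicator {-1/2..1/2} y *\<^sub>R G (\<theta>(1 := y)) \<partial>lborel) = (\<integral>y. indicator {-1/2..1/2} y *\<^sub>R H (\<theta>(1 := y)) \<partial>lborel)"
  shows "cube_integral n G = cube_integral n H"
proof -
  have I: "{1..n} = insert 1 {2..n}" using n by auto
  let ?M = "PiM {2..n} (\<lambda>_. lborel) :: (nat \<Rightarrow> real) measure"
  have ind: "indicat_real (cube n) (x(1 := y)) = indicator (PiE {2..n} (\<lambda>_. {-1/2..1/2})) x * indicator {-1/2..1/2} y"
    if "x \<in> space ?M" for x y
  proof -
    have "x(1 := y) \<in> cube n \<longleftrightarrow> y \<in> {-1/2..1/2} \<and> x \<in> PiE {2..n} (\<lambda>_. {-1/2..1/2})"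
      using that unfolding cube_def I PiE_iff space_PiM by (auto simp: extensional_def)
    then show ?thesis by (auto simp: indicator_def simp del: One_nat_def)
  qed
  have expand: "cube_integral n G = (\<integral>x. indicator (PiE {2..n} (\<lambda>_. {-1/2..1/2})) x *\<^sub>R
      (\<integral>y. indicator {-1/2..1/2} y *\<^sub>R G (x(1 := y)) \<partial>lborel) \<partial>?M)" if "cube_fn n G" for G
  proof -
    have "cube_integral n G = (\<integral>x. (\<integral>y. indicator (cube n) (x(1 := y)) *\<^sub>R G (x(1 := y)) \<partial>lborel) \<partial>?M)"
      unfolding cube_integral_def using cube_fn_integrable[OF that] unfolding I
      by (intro lborel_product.product_integral_insert) auto
    also have "\<dots> = (\<integral>x. indicator (PiE {2..n} (\<lambda>_. {-1/2..1/2})) x *\<^sub>R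
      (\<integral>y. indicator {-1/2..1/2} y *\<^sub>R G (x(1 := y)) \<partial>lborel) \<partial>?M)"
    proof (rule Bochner_Integration.integral_cong[OF refl])
      fix x assume x: "x \<in> space ?M"
      show "(\<integral>y. indicator (cube n) (x(1 := y)) *\<^sub>R G (x(1 := y)) \<partial>lborel) =
        indicator (PiE {2..n} (\<lambda>_. {-1/2..1/2})) x *\<^sub>R (\<integral>y. indicator {-1/2..1/2} y *\<^sub>R G (x(1 := y)) \<partial>lborel)"
        unfolding ind[OF x] by (simp flip: scaleR_scaleR)
    qed
    finally show ?thesis .
  qed
  show ?thesis unfolding expand[OF G] expand[OF H]
  proof (rule Bochner_Integration.integral_cong[OF refl])
    fix x assume x: "x \<in> space ?M"
    show "indicator (PiE {2..n} (\<lambda>_. {-1/2..1/2})) x *\<^sub>R (\<integral>y. indicator {-1/2..1/2} y *\<^sub>R G (x(1 := y)) \<partial>lborel) =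
      indicator (PiE {2..n} (\<lambda>_. {-1/2..1/2})) x *\<^sub>R (\<integral>y. indicator {-1/2..1/2} y *\<^sub>R H (x(1 := y)) \<partial>lborel)"
    proof (cases "x \<in> PiE {2..n} (\<lambda>_. {-1/2..1/2})")
      case True
      then have "x(1 := 0) \<in> cube n" unfolding cube_def I PiE_iff by (auto simp: extensional_def)
      from eq[OF this] show ?thesis by simp
    qed simp
  qed
qed

lemma torus_monomial_integral:
  assumes r: "r > 0"
  shows "cube_integral n (\<lambda>\<theta>. \<Prod>i=1..n. torus_point r \<theta> i powi \<alpha> i) = (if \<forall>i\<in>{1..n}. \<alpha> i = 0 then 1 else 0)"
proof -
  define g where "g = (\<lambda>k y. (of_real r * cis (2 * pi * y)) powi k :: complex)"
  define c where "c = (\<lambda>k. \<integral>y. indicator {-1/2..1/2} y *\<^sub>R g k y \<partial>lborel)"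
  have int: "integrable lborel (\<lambda>y. indicator {-1/2..1/2} y *\<^sub>R g k y)" for k
  proof -
    have "continuous_on {-1/2..1/2} (g k)" unfolding g_def
      by (intro continuous_intros) (use r in auto)
    then show ?thesis using borel_integrable_atLeastAtMost'[of "-1/2" "1/2" "g k"] by (simp add: set_integrable_def)
  qed
  have c0: "c 0 = 1" by (simp add: c_def g_def)
  have ck: "c k = 0" if "k \<noteq> 0" for k
  proof -
    have "(\<lambda>z. z powi k) holomorphic_on {z::complex. 0 < norm z \<and> norm z < 2 * r + 1}"
      by (intro holomorphic_intros) auto
    \<comment> \<open>Doubling the radius multiplies the integrand by 2^k but leaves the integral
      unchanged, so the integral is 0 for k \<noteq> 0.\<close>
    from circle_integral_radius[OF this, of "2 * r" r]
    have "(\<integral>y. indicator {-1/2..1/2} y *\<^sub>R ((of_real (2 * r) * cis (2 * pi * y)) powi k) \<partial>lborel) = c k"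
      using r by (simp add: c_def g_def)
    also have "(\<integral>y. indicator {-1/2..1/2} y *\<^sub>R ((of_real (2 * r) * cis (2 * pi * y)) powi k) \<partial>lborel) =
        (\<integral>y. (2 powi k) * (indicator {-1/2..1/2} y *\<^sub>R g k y) \<partial>lborel)"
    proof (rule Bochner_Integration.integral_cong[OF refl])
      fix y
      have "(of_real (2 * r) * cis (2 * pi * y)) powi k = (2 powi k) * g k y"
        unfolding g_def power_int_mult_distrib[symmetric] by (simp add: mult.assoc)
      then show "indicator {-1/2..1/2} y *\<^sub>R ((of_real (2 * r) * cis (2 * pi * y)) powi k) =
        (2 powi k) * (indicator {-1/2..1/2} y *\<^sub>R g k y)" by (simp only: mult_scaleR_right)
    qed
    also have "\<dots> = (2 powi k) * c k" unfolding c_def by (rule integral_mult_right_zero)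
    finally have "(2 powi k) * c k = c k" .
    moreover have "(2::complex) powi k \<noteq> 1"
    proof
      assume "(2::complex) powi k = 1"
      then have "norm ((2::complex) powi k) = 1" by simp
      then have "(2::real) powi k = 1" by (simp add: norm_power_int)
      then have "(2::real) powr of_int k = 1" by (simp add: powr_real_of_int')
      then show False using that by simp
    qed
    ultimately show ?thesis by simp
  qed
  have "cube_integral n (\<lambda>\<theta>. \<Prod>i=1..n. torus_point r \<theta> i powi \<alpha> i) =
      (\<integral>\<theta>. (\<Prod>i\<in>{1..n}. indicator {-1/2..1/2} (\<theta> i) *\<^sub>R g (\<alpha> i) (\<theta> i)) \<partial>lborel_n n)"
    unfolding cube_integral_def
  proof (rule Bochner_Integration.integral_cong[OF refl])
    fix \<theta> assume \<theta>: "\<theta> \<in> space (lborel_n n)"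
    show "indicator (cube n) \<theta> *\<^sub>R (\<Prod>i=1..n. torus_point r \<theta> i powi \<alpha> i) =
      (\<Prod>i\<in>{1..n}. indicator {-1/2..1/2} (\<theta> i) *\<^sub>R g (\<alpha> i) (\<theta> i))"
    proof (cases "\<theta> \<in> cube n")
      case True
      then have "indicat_real {-1/2..1/2} (\<theta> i) = 1" if "i \<in> {1..n}" for i
        using that unfolding cube_def PiE_iff by simp
      then show ?thesis using True by (simp add: torus_point_def g_def)
    next
      case False
      then obtain i where i: "i \<in> {1..n}" "\<theta> i \<notin> {-1/2..1/2}"
        using \<theta> unfolding cube_def PiE_iff space_PiM by blast
      then have "(\<Prod>i\<in>{1..n}. indicator {-1/2..1/2} (\<theta> i) *\<^sub>R g (\<alpha> i) (\<theta> i)) = 0"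
        by (intro prod_zero) (auto intro!: bexI[of _ i])
      then show ?thesis using False by simp
    qed
  qed
  also have "\<dots> = (\<Prod>i\<in>{1..n}. c (\<alpha> i))"
    unfolding c_def by (rule lborel_product.product_integral_prod) (use int in auto)
  also have "\<dots> = (if \<forall>i\<in>{1..n}. \<alpha> i = 0 then 1 else 0)"
  proof (cases "\<forall>i\<in>{1..n}. \<alpha> i = 0")
    case False
    then obtain i where "i \<in> {1..n}" "\<alpha> i \<noteq> 0" by blast
    then show ?thesis using False ck by (auto intro!: prod_zero bexI[of _ i])
  qed (simp add: c0)
  finally show ?thesis .
qed

lemma cube_fn_torus_powi:
  assumes "r > 0" "i \<in> {1..n}"
  shows "cube_fn n (\<lambda>\<theta>. torus_point r \<theta> i powi k)"
  unfolding torus_point_def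
  by (rule cube_fn_component[of "\<lambda>y. (of_real r * cis (2 * pi * y)) powi k"])
    (use assms in \<open>auto intro!: continuous_intros\<close>)

text \<open>By orthogonality of monomials, any Laurent polynomial that agrees with f almost
  everywhere on the torus has the integral of f as its constant coefficient. So the definite
  description in \<open>CT\<close> is well defined and both branches coincide.\<close>

lemma CT_eq_fourier_integral:
  assumes r: "r > 0" and f: "(\<lambda>\<theta>. f (torus_point r \<theta>)) \<in> borel_measurable (lborel_n n)"
  shows "CT n r f = fourier_integral n r f"
proof -
  have c0: "c (\<lambda>_. 0) = fourier_integral n r f" if c: "is_laurent_expansion n r f c" for c
  proof -
    let ?S = "{\<alpha>. c \<alpha> \<noteq> 0}"
    let ?m = "\<lambda>\<alpha> \<theta>. c \<alpha> * (\<Prod>i=1..n. torus_point r \<theta> i powi \<alpha> i)"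
    have fin: "finite ?S" and supp: "\<And>\<alpha> i. c \<alpha> \<noteq> 0 \<Longrightarrow> i \<notin> {1..n} \<Longrightarrow> \<alpha> i = 0"
      and AE: "AE \<theta> in lborel_n n. f (torus_point r \<theta>) = (\<Sum>\<alpha>\<in>?S. ?m \<alpha> \<theta>)"
      using c unfolding is_laurent_expansion_def by blast+
    have m: "cube_fn n (?m \<alpha>)" for \<alpha>
      by (intro cube_fn_mult cube_fn_const cube_fn_prod cube_fn_torus_powi r)
    have "fourier_integral n r f = cube_integral n (\<lambda>\<theta>. \<Sum>\<alpha>\<in>?S. ?m \<alpha> \<theta>)"
      unfolding fourier_integral_eq
    proof (rule cube_integral_cong_AE[OF _ f])
      show "(\<lambda>\<theta>. \<Sum>\<alpha>\<in>?S. ?m \<alpha> \<theta>) \<in> borel_measurable (lborel_n n)"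
        using cube_fn_sum[of ?S n ?m] m unfolding cube_fn_def by blast
      show "AE \<theta> in lborel_n n. \<theta> \<in> cube n \<longrightarrow> f (torus_point r \<theta>) = (\<Sum>\<alpha>\<in>?S. ?m \<alpha> \<theta>)"
        using AE by eventually_elim simp
    qed
    also have "\<dots> = (\<Sum>\<alpha>\<in>?S. c \<alpha> * (if \<forall>i\<in>{1..n}. \<alpha> i = 0 then 1 else 0))"
    proof -
      have "cube_integral n (\<lambda>\<theta>. \<Sum>\<alpha>\<in>?S. ?m \<alpha> \<theta>) = (\<Sum>\<alpha>\<in>?S. cube_integral n (?m \<alpha>))"
        by (rule cube_integral_sum) (rule m)
      then show ?thesis unfolding cube_integral_scale torus_monomial_integral[OF r] .
    qed
    also have "\<dots> = (\<Sum>\<alpha>\<in>?S. if \<alpha> = (\<lambda>_. 0) then c \<alpha> else 0)"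
    proof (rule sum.cong[OF refl])
      fix \<alpha> assume "\<alpha> \<in> ?S"
      then have "(\<forall>i\<in>{1..n}. \<alpha> i = 0) \<longleftrightarrow> \<alpha> = (\<lambda>_. 0)" using supp by (auto simp: fun_eq_iff)
      then show "c \<alpha> * (if \<forall>i\<in>{1..n}. \<alpha> i = 0 then 1 else 0) = (if \<alpha> = (\<lambda>_. 0) then c \<alpha> else 0)" by simp
    qed
    also have "\<dots> = c (\<lambda>_. 0)" using fin by simp
    finally show ?thesis ..
  qed
  show ?thesis
  proof (cases "\<exists>c. is_laurent_expansion n r f c")
    case True
    then have "(THE z. \<exists>c. is_laurent_expansion n r f c \<and> z = c (\<lambda>_. 0)) = fourier_integral n r f"
      using c0 by (intro the_equality) metis+
    then show ?thesis using True by (simp add: CT_def)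
  qed (simp add: CT_def)
qed

subsection \<open>The weight function and its symmetries\<close>

definition index_pairs :: "nat \<Rightarrow> (nat \<times> nat) set" where
  "index_pairs n = {(i, j). 1 \<le> i \<and> i < j \<and> j \<le> n}"

lemma finite_index_pairs: "finite (index_pairs n)"
  by (rule finite_subset[of _ "{1..n} \<times> {1..n}"]) (auto simp: index_pairs_def)

text \<open>\<open>A\<close> and \<open>C\<close> stand for (z;q)_a and (z;q)_b without removable
  singularities. The recursion needs only their holomorphy and their q-difference equations.
  \<open>C\<close> is evaluated at q / x_i, of modulus q / r, whence the bound on
  \<open>RC\<close>.\<close>

locale morris_setup = macdonald_params +
  fixes a b r RA RC :: real and A C :: "complex \<Rightarrow> complex"
  assumes r_pos: "0 < r" and RA: "r < RA" and RC: "q / r < RC"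
    and A_hol: "A holomorphic_on ball 0 RA" and C_hol: "C holomorphic_on ball 0 RC"
    and A_rel: "\<And>z. norm z < RA \<Longrightarrow> A z * (1 - of_real (q powr a) * z) = (1 - z) * A (of_real q * z)"
    and C_rel: "\<And>z. norm z < RC \<Longrightarrow> C z * (1 - of_real (q powr b) * z) = (1 - z) * C (of_real q * z)"
begin

definition pair_weight :: "complex \<Rightarrow> complex" where
  "pair_weight z = qpoch z q lam * qpoch (of_real q / z) q lam"

text \<open>On the unit circle this is \<open>pair_weight z\<close> times (1 - t z) / (1 - z), away
  from z = 1: the part of the pair factor that is invariant under z -> 1 / z, that is, under
  exchange of the two variables.\<close>

definition pair_weight_reg :: "complex \<Rightarrow> complex" where
  "pair_weight_reg z = qpoch (z * of_real q) q lam * qpoch (of_real q / z) q lam"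

definition var_weight :: "complex \<Rightarrow> complex" where
  "var_weight z = A z * C (of_real q / z)"

definition weight_fn :: point_fn where
  "weight_fn x = (\<Prod>i=1..n. var_weight (x i)) * W_weight n q lam x"

definition weighted_CT :: "point_fn \<Rightarrow> complex" where
  "weighted_CT f = fourier_integral n r (\<lambda>x. f x * weight_fn x)"

lemma W_weight_eq: "W_weight n q lam x = (\<Prod>(i, j)\<in>index_pairs n. pair_weight (x i / x j))"
  unfolding W_weight_def pair_weight_def index_pairs_def by (intro prod.cong) auto

lemma t_powr: "q powr lam = t" "q powr (- lam) = 1 / t"
  using t_eq q_pos by (simp_all add: powr_minus inverse_eq_divide)

lemma pair_weight_holomorphic: "pair_weight holomorphic_on {z. q * t < norm z \<and> norm z < 1 / t}"
proof -
  have "(\<lambda>z. qpoch z q lam) holomorphic_on {z. q * t < norm z \<and> norm z < 1 / t}"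
    by (rule qpoch_holomorphic[OF q_pos q_less_1]) (auto simp: t_powr)
  moreover have "(\<lambda>z. qpoch (of_real q / z) q lam) holomorphic_on {z. q * t < norm z \<and> norm z < 1 / t}"
  proof (rule qpoch_holomorphic[OF q_pos q_less_1])
    have nz: "z \<noteq> 0" if "z \<in> {z. q * t < norm z \<and> norm z < 1 / t}" for z :: complex
    proof
      assume "z = 0"
      then show False using that mult_pos_pos[OF q_pos t_pos] by simp
    qed
    then show "(\<lambda>z. of_real q / z) holomorphic_on {z. q * t < norm z \<and> norm z < 1 / t}"
      by (intro holomorphic_intros) auto
    fix z :: complex assume z: "z \<in> {z. q * t < norm z \<and> norm z < 1 / t}"
    then have "norm z > 0" using nz by auto
    then have "q / norm z < 1 / t" using z t_pos by (simp add: field_simps)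
    then show "norm (of_real q / z) < q powr - lam" using q_pos by (simp add: norm_divide t_powr)
  qed
  ultimately show ?thesis unfolding pair_weight_def by (intro holomorphic_intros)
qed

lemma pair_weight_reg_holomorphic: "pair_weight_reg holomorphic_on {z. q * t < norm z \<and> norm z < 1 / (q * t)}"
proof -
  let ?S = "{z::complex. q * t < norm z \<and> norm z < 1 / (q * t)}"
  have pos: "norm z > 0" if "z \<in> ?S" for z using that mult_pos_pos[OF q_pos t_pos] by auto
  have "(\<lambda>z. qpoch (z * of_real q) q lam) holomorphic_on ?S"
  proof (rule qpoch_holomorphic[OF q_pos q_less_1])
    fix z :: complex assume "z \<in> ?S"
    then have "norm z * q < 1 / t" using q_pos t_pos by (simp add: field_simps)
    then show "norm (z * of_real q) < q powr - lam" using q_pos by (simp add: norm_mult t_powr)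
  qed (intro holomorphic_intros)
  moreover have "(\<lambda>z. qpoch (of_real q / z) q lam) holomorphic_on ?S"
  proof (rule qpoch_holomorphic[OF q_pos q_less_1])
    show "(\<lambda>z. of_real q / z) holomorphic_on ?S"
      using pos by (intro holomorphic_intros) force
    fix z :: complex assume z: "z \<in> ?S"
    then have "q / norm z < 1 / t" using pos[OF z] t_pos by (simp add: field_simps)
    then show "norm (of_real q / z) < q powr - lam" using q_pos by (simp add: norm_divide t_powr)
  qed
  ultimately show ?thesis unfolding pair_weight_reg_def by (intro holomorphic_intros)
qed

lemma pair_weight_shift: "pair_weight (of_real q * z) = pair_weight (1 / z)"
  using q_pos by (simp add: pair_weight_def mult.commute)

lemma pair_weight_reg_inverse: "pair_weight_reg (1 / z) = pair_weight_reg z"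
  by (simp add: pair_weight_reg_def mult.commute)

lemma pair_weight_pair_weight_reg:
  assumes "norm z = 1"
  shows "pair_weight z * (1 - of_real t * z) = pair_weight_reg z * (1 - z)"
proof -
  have n: "norm (z * complex_of_real t) < 1" using assms t_pos t_less_1 by (simp add: norm_mult)
  define u where "u = z * complex_of_real t"
  have nz: "qpoch_inf u q \<noteq> 0" using qpoch_inf_nonzero[OF q_pos q_less_1 n] by (simp add: u_def)
  have zq: "z * of_real q * complex_of_real t = u * of_real q" by (simp add: u_def)
  have "1 - u \<noteq> 0" "qpoch_inf (u * of_real q) q \<noteq> 0"
    using nz qpoch_inf_shift[OF q_pos q_less_1, of u] by auto
  then have "qpoch z q lam * (1 - u) = qpoch (z * of_real q) q lam * (1 - z)"
    unfolding qpoch_def t_powr qpoch_inf_shift[OF q_pos q_less_1, of z] u_def[symmetric]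
      qpoch_inf_shift[OF q_pos q_less_1, of u] zq by simp
  moreover have "of_real t * z = u" by (simp add: u_def)
  ultimately show ?thesis unfolding pair_weight_def pair_weight_reg_def by (simp add: mult_ac)
qed

text \<open>Pairs without index 1 are merely shifted. A pair (1, j) acquires the ratio q x_n /
  x_(j-1), which \<open>pair_weight_shift\<close> turns into the factor of the pair (j - 1,
  n).\<close>

lemma W_weight_rot: "W_weight n q lam (rot x) = W_weight n q lam x"
  unfolding W_weight_eq
proof (rule prod.reindex_bij_witness[where
      i = "\<lambda>(k, l). if l = n then (1, Suc k) else (Suc k, Suc l)" and
      j = "\<lambda>(i, j). if i = 1 then (j - 1, n) else (i - 1, j - 1)"])
  fix p assume p: "p \<in> index_pairs n"
  obtain i j where ij: "p = (i, j)" "1 \<le> i" "i < j" "j \<le> n" using p by (auto simp: index_pairs_def)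
  obtain k where k: "j = Suc k" "k \<in> {1..<n}" using ij by (cases j) auto
  show "(case p of (i, j) \<Rightarrow> if i = 1 then (j - 1, n) else (i - 1, j - 1)) \<in> index_pairs n"
    "(case case p of (i, j) \<Rightarrow> if i = 1 then (j - 1, n) else (i - 1, j - 1) of
       (k, l) \<Rightarrow> if l = n then (1, Suc k) else (Suc k, Suc l)) = p"
    using ij by (auto simp: index_pairs_def)
  show "(case p of (k, l) \<Rightarrow> if l = n then (1, Suc k) else (Suc k, Suc l)) \<in> index_pairs n"
    "(case case p of (k, l) \<Rightarrow> if l = n then (1, Suc k) else (Suc k, Suc l) of
       (i, j) \<Rightarrow> if i = 1 then (j - 1, n) else (i - 1, j - 1)) = p"
    using ij by (auto simp: index_pairs_def)
  show "(case case p of (i, j) \<Rightarrow> if i = 1 then (j - 1, n) else (i - 1, j - 1) of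
      (i, j) \<Rightarrow> pair_weight (x i / x j)) = (case p of (i, j) \<Rightarrow> pair_weight (rot x i / rot x j))"
  proof (cases "i = 1")
    case True
    then show ?thesis
      using pair_weight_shift[of "x n / x k"] rot_simps(2)[OF k(2), of x] by (simp add: ij(1) k(1) rot_simps(1)[unfolded One_nat_def])
  next
    case False
    then obtain l where l: "i = Suc l" "l \<in> {1..<n}" using ij by (cases i) auto
    then show ?thesis
      using False rot_simps(2)[OF k(2), of x] rot_simps(2)[OF l(2), of x] by (simp add: ij(1) k(1))
  qed
qed

lemma torus_norm: "norm (torus_point r \<theta> i) = r"
  using r_pos by (simp add: torus_point_def norm_mult)

definition torus_point_at :: "real \<Rightarrow> (nat \<Rightarrow> real) \<Rightarrow> nat \<Rightarrow> complex" where
  "torus_point_at \<rho> \<theta> = (torus_point r \<theta>)(1 := of_real \<rho> * cis (2 * pi * \<theta> 1))"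

lemma torus_point_at_r: "torus_point_at r \<theta> = torus_point r \<theta>"
  by (auto simp: torus_point_at_def torus_point_def)

lemma cube_fn_torus_point_at_component:
  assumes g: "continuous_on S g" and i: "i \<in> {1..n}" and S: "\<And>z. norm z = (if i = 1 then \<rho> else r) \<Longrightarrow> z \<in> S" and \<rho>: "\<rho> > 0"
  shows "cube_fn n (\<lambda>\<theta>. g (torus_point_at \<rho> \<theta> i))"
proof -
  have "continuous_on UNIV (\<lambda>y. g (of_real (if i = 1 then \<rho> else r) * cis (2 * pi * y)))"
    by (rule continuous_on_compose2[OF g]) (use \<rho> r_pos in \<open>auto intro!: continuous_intros S simp: norm_mult\<close>)
  from cube_fn_component[OF this i] show ?thesis
    by (simp add: torus_point_at_def torus_point_def cong: if_cong split del: if_split) (cases "i = 1"; simp)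
qed

lemma cube_fn_torus_point_at_poly:
  assumes "poly_fn f" "\<rho> > 0"
  shows "cube_fn n (\<lambda>\<theta>. f (torus_point_at \<rho> \<theta>))"
proof -
  obtain S c where S: "f = (\<lambda>x. \<Sum>\<nu>\<in>S. c \<nu> * monomial_fn n \<nu> x)"
    using assms unfolding poly_fn_def fspan_def by blast
  have "cube_fn n (\<lambda>\<theta>. torus_point_at \<rho> \<theta> i)" if "i \<in> {1..n}" for i
    by (rule cube_fn_torus_point_at_component[of UNIV "\<lambda>z. z"]) (use that assms in auto)
  then show ?thesis unfolding S monomial_fn_def
    by (intro cube_fn_sum cube_fn_mult cube_fn_const cube_fn_prod cube_fn_power)
qed

lemma cube_fn_torus_point_at_ratio:
  assumes g: "continuous_on S g" and ij: "1 \<le> i" "i < j" "j \<le> n" and \<rho>: "\<rho> > 0"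
    and S: "\<And>z. norm z = 1 \<or> norm z = \<rho> / r \<Longrightarrow> z \<in> S"
  shows "cube_fn n (\<lambda>\<theta>. g (torus_point_at \<rho> \<theta> i / torus_point_at \<rho> \<theta> j))"
proof -
  define c where "c = (if i = 1 then \<rho> / r else 1)"
  have c: "c > 0" using \<rho> r_pos by (simp add: c_def)
  have "continuous_on UNIV (\<lambda>y. g (of_real c * cis (2 * pi * y)))"
    by (rule continuous_on_compose2[OF g])
      (use \<rho> r_pos in \<open>auto intro!: continuous_intros S simp: norm_mult norm_divide c_def\<close>)
  from cube_fn_difference[OF this, of i n j]
  have "cube_fn n (\<lambda>\<theta>. g (of_real c * cis (2 * pi * (\<theta> i - \<theta> j))))" using ij by simp
  moreover have "torus_point_at \<rho> \<theta> i / torus_point_at \<rho> \<theta> j = of_real c * cis (2 * pi * (\<theta> i - \<theta> j))" for \<theta>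
    using ij r_pos by (auto simp: torus_point_at_def torus_point_def c_def right_diff_distrib cis_divide[symmetric])
  ultimately show ?thesis by simp
qed

lemma unit_annulus: "q * t < 1" "1 < 1 / t" "q * t < q" "1 < 1 / (q * t)"
proof -
  show "q * t < q" using q_pos t_less_1 by simp
  then show "q * t < 1" using q_less_1 by simp
  show "1 < 1 / t" using t_pos t_less_1 by simp
  show "1 < 1 / (q * t)" using \<open>q * t < 1\<close> q_pos t_pos by simp
qed

lemma cube_fn_W:
  assumes "q * r \<le> \<rho>" "\<rho> \<le> r"
  shows "cube_fn n (\<lambda>\<theta>. W_weight n q lam (torus_point_at \<rho> \<theta>))"
  unfolding W_weight_eq split_def
proof (rule cube_fn_prod)
  have pos: "q * r > 0" using q_pos r_pos by simp
  fix p assume "p \<in> index_pairs n"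
  then obtain i j where p: "p = (i, j)" "1 \<le> i" "i < j" "j \<le> n" by (auto simp: index_pairs_def)
  have "cube_fn n (\<lambda>\<theta>. pair_weight (torus_point_at \<rho> \<theta> i / torus_point_at \<rho> \<theta> j))"
  proof (rule cube_fn_torus_point_at_ratio[OF holomorphic_on_imp_continuous_on[OF pair_weight_holomorphic] p(2-4)])
    show "\<rho> > 0" using assms pos by linarith
    fix z :: complex assume "norm z = 1 \<or> norm z = \<rho> / r"
    moreover have "q \<le> \<rho> / r" "\<rho> / r \<le> 1" using assms r_pos by (simp_all add: field_simps)
    ultimately show "z \<in> {z. q * t < norm z \<and> norm z < 1 / t}"
      using unit_annulus by auto
  qed
  then show "cube_fn n (\<lambda>\<theta>. pair_weight (torus_point_at \<rho> \<theta> (fst p) / torus_point_at \<rho> \<theta> (snd p)))" by (simp add: p)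
qed

lemma var_weight_holomorphic: "var_weight holomorphic_on {z. q / RC < norm z \<and> norm z < RA}"
proof -
  let ?S = "{z::complex. q / RC < norm z \<and> norm z < RA}"
  have RC0: "RC > 0" using RC q_pos r_pos by (meson divide_pos_pos order_less_trans)
  have z0: "norm z > 0" if "z \<in> ?S" for z using that divide_pos_pos[OF q_pos RC0] by auto
  have "(\<lambda>z. C (of_real q / z)) holomorphic_on ?S"
  proof (rule holomorphic_on_compose_gen[of "\<lambda>z. of_real q / z" ?S C "ball 0 RC", unfolded o_def])
    show "(\<lambda>z. of_real q / z) holomorphic_on ?S"
      using z0 by (intro holomorphic_intros) force
    show "(\<lambda>z. of_real q / z) ` ?S \<subseteq> ball 0 RC"
    proof
      fix w assume "w \<in> (\<lambda>z. of_real q / z) ` ?S"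
      then obtain z where z: "z \<in> ?S" "w = of_real q / z" by blast
      then have "q / norm z < RC" using z0[OF z(1)] RC0 by (simp add: field_simps)
      then show "w \<in> ball 0 RC" using q_pos by (simp add: z norm_divide)
    qed
  qed (rule C_hol)
  moreover have "A holomorphic_on ?S" by (rule holomorphic_on_subset[OF A_hol]) auto
  ultimately show ?thesis unfolding var_weight_def by (intro holomorphic_intros)
qed

lemma r_annulus: "q / RC < r"
proof -
  have "RC > 0" using RC q_pos r_pos by (meson divide_pos_pos order_less_trans)
  then show ?thesis using RC r_pos by (simp add: field_simps)
qed

lemma cube_fn_var_weight: 
  assumes "i \<in> {1..n}" "i \<noteq> 1 \<or> \<rho> = r" "\<rho> > 0" shows "cube_fn n (\<lambda>\<theta>. var_weight (torus_point_at \<rho> \<theta> i))"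
  by (rule cube_fn_torus_point_at_component[OF holomorphic_on_imp_continuous_on[OF var_weight_holomorphic] assms(1)])
    (use r_annulus RA assms in auto)

lemma cube_fn_weight_fn: "cube_fn n (\<lambda>\<theta>. weight_fn (torus_point r \<theta>))"
  unfolding weight_fn_def torus_point_at_r[symmetric]
  by (intro cube_fn_mult cube_fn_prod cube_fn_var_weight cube_fn_W) (use r_pos q_less_1 in auto)

lemma cube_fn_poly_weight_fn: "poly_fn f \<Longrightarrow> cube_fn n (\<lambda>\<theta>. f (torus_point r \<theta>) * weight_fn (torus_point r \<theta>))"
  using cube_fn_mult[OF cube_fn_torus_point_at_poly[OF _ r_pos] cube_fn_weight_fn] unfolding torus_point_at_r .

lemma weighted_CT_linear:
  assumes "poly_fn f" "poly_fn g"
  shows "weighted_CT (\<lambda>x. c * f x - d * g x) = c * weighted_CT f - d * weighted_CT g"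
proof -
  have "weighted_CT (\<lambda>x. c * f x - d * g x) = cube_integral n (\<lambda>\<theta>. c * (f (torus_point r \<theta>) * weight_fn (torus_point r \<theta>)) -
      d * (g (torus_point r \<theta>) * weight_fn (torus_point r \<theta>)))"
    unfolding weighted_CT_def fourier_integral_eq by (simp add: algebra_simps)
  also have "\<dots> = c * weighted_CT f - d * weighted_CT g"
    unfolding weighted_CT_def fourier_integral_eq
    by (subst cube_integral_diff)
      (simp_all add: cube_fn_mult[OF cube_fn_const] cube_fn_poly_weight_fn assms cube_integral_scale)
  finally show ?thesis .
qed

lemma weighted_CT_scale: "weighted_CT (\<lambda>x. c * f x) = c * weighted_CT f"
  unfolding weighted_CT_def fourier_integral_eq mult.assoc cube_integral_scale ..

lemma torus_permute:
  assumes "\<theta> \<in> cube n" "\<And>k. k \<in> {1..n} \<Longrightarrow> \<sigma> k \<in> {1..n}" "\<And>k. k \<notin> {1..n} \<Longrightarrow> \<sigma> k = k"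
  shows "torus_point r (\<lambda>k\<in>{1..n}. \<theta> (\<sigma> k)) = (\<lambda>k. torus_point r \<theta> (\<sigma> k))"
proof
  fix k
  show "torus_point r (\<lambda>k\<in>{1..n}. \<theta> (\<sigma> k)) k = torus_point r \<theta> (\<sigma> k)"
  proof (cases "k \<in> {1..n}")
    case False
    then have "\<theta> k = undefined" using assms(1) by (auto simp: cube_def PiE_iff extensional_def)
    then show ?thesis using assms(3)[OF False] False by (simp add: torus_point_def restrict_def)
  qed (simp add: torus_point_def)
qed

lemma cube_integral_swap:
  assumes i: "i \<in> {1..<n}" and F: "cube_fn n (\<lambda>\<theta>. F (torus_point r \<theta>))"
  shows "cube_integral n (\<lambda>\<theta>. F (swap_pt i (torus_point r \<theta>))) = cube_integral n (\<lambda>\<theta>. F (torus_point r \<theta>))"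
proof -
  define \<sigma> where "\<sigma> = Transposition.transpose i (Suc i)"
  have \<sigma>: "bij_betw \<sigma> {1..n} {1..n}"
    unfolding \<sigma>_def by (rule bij_betw_transpose_iff) (use i in auto)
  have "swap_pt i (torus_point r \<theta>) = torus_point r (\<lambda>k\<in>{1..n}. \<theta> (\<sigma> k))" if "\<theta> \<in> cube n" for \<theta>
  proof -
    have "torus_point r (\<lambda>k\<in>{1..n}. \<theta> (\<sigma> k)) = (\<lambda>k. torus_point r \<theta> (\<sigma> k))"
      by (rule torus_permute[OF that]) (use i bij_betwE[OF \<sigma>] in \<open>auto simp: \<sigma>_def Transposition.transpose_def\<close>)
    then show ?thesis by (auto simp: \<sigma>_def Transposition.transpose_def swap_pt_def)
  qed
  then have "cube_integral n (\<lambda>\<theta>. F (swap_pt i (torus_point r \<theta>))) =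
      cube_integral n (\<lambda>\<theta>. F (torus_point r (\<lambda>k\<in>{1..n}. \<theta> (\<sigma> k))))"
    by (intro cube_integral_cong) simp
  also have "\<dots> = cube_integral n (\<lambda>\<theta>. F (torus_point r \<theta>))"
    by (rule cube_integral_permute[OF \<sigma>]) (use F in \<open>simp add: cube_fn_def\<close>)
  finally show ?thesis .
qed

text \<open>With z = x_i / x_(i+1), the weight is a function \<open>Z\<close> symmetric in x_i,
  x_(i+1) times (1 - z) / (1 - t z). The coefficient of s_i - 1 in T_i is the reciprocal of that
  quotient, so this term becomes Z (s_i f - f), whose integral vanishes by symmetry.\<close>

lemma weighted_CT_T:
  assumes f: "poly_fn f" and g: "poly_fn g" and i: "i \<in> {1..<n}"
    and T: "\<And>x. x i \<noteq> x (Suc i) \<Longrightarrow> g x = T_op t i f x"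
  shows "weighted_CT g = of_real t * weighted_CT f"
proof -
  define P where "P = index_pairs n - {(i, Suc i)}"
  have ipair: "(i, Suc i) \<in> index_pairs n" using i by (auto simp: index_pairs_def)
  have finP: "finite P" using finite_index_pairs by (simp add: P_def)
  define Z where "Z = (\<lambda>x. (\<Prod>k=1..n. var_weight (x k)) * ((\<Prod>(k, l)\<in>P. pair_weight (x k / x l)) * pair_weight_reg (x i / x (Suc i))))"
  define \<sigma> where "\<sigma> = Transposition.transpose i (Suc i)"
  have s: "swap_pt i x k = x (\<sigma> k)" for x :: "nat \<Rightarrow> complex" and k
    by (auto simp: swap_pt_def \<sigma>_def Transposition.transpose_def)
  have \<sigma>\<sigma>: "\<sigma> (\<sigma> k) = k" for k by (simp add: \<sigma>_def)
  have Zs: "Z (swap_pt i x) = Z x" for x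
  proof -
    have "(\<Prod>k=1..n. var_weight (swap_pt i x k)) = (\<Prod>k=1..n. var_weight (x k))"
    proof -
      have \<sigma>: "bij_betw \<sigma> {1..n} {1..n}"
        unfolding \<sigma>_def by (rule bij_betw_transpose_iff) (use i in auto)
      show ?thesis unfolding s by (rule prod.reindex_bij_betw[OF \<sigma>, of "\<lambda>k. var_weight (x k)"])
    qed
    moreover have "(\<Prod>(k, l)\<in>P. pair_weight (swap_pt i x k / swap_pt i x l)) = (\<Prod>(k, l)\<in>P. pair_weight (x k / x l))"
    proof -
      have "map_prod \<sigma> \<sigma> p \<in> P" if "p \<in> P" for p
        using i that by (cases p) (auto simp: P_def index_pairs_def \<sigma>_def Transposition.transpose_def split: if_splits)
      then show ?thesis
        by (intro prod.reindex_bij_witness[where i = "map_prod \<sigma> \<sigma>" and j = "map_prod \<sigma> \<sigma>"])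
          (auto simp: \<sigma>\<sigma> s)
    qed
    moreover have "pair_weight_reg (swap_pt i x i / swap_pt i x (Suc i)) = pair_weight_reg (x i / x (Suc i))"
      using pair_weight_reg_inverse[of "x i / x (Suc i)"] by simp
    ultimately show ?thesis unfolding Z_def by simp
  qed
  have Zc: "cube_fn n (\<lambda>\<theta>. Z (torus_point r \<theta>))"
    unfolding Z_def torus_point_at_r[symmetric]
  proof (intro cube_fn_mult cube_fn_prod)
    show "cube_fn n (\<lambda>\<theta>. var_weight (torus_point_at r \<theta> k))" if "k \<in> {1..n}" for k by (rule cube_fn_var_weight) (use that r_pos in auto)
    show "cube_fn n (\<lambda>\<theta>. pair_weight_reg (torus_point_at r \<theta> i / torus_point_at r \<theta> (Suc i)))"
      by (rule cube_fn_torus_point_at_ratio[OF holomorphic_on_imp_continuous_on[OF pair_weight_reg_holomorphic]])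
        (use i r_pos unit_annulus in auto)
    fix p assume "p \<in> P"
    then obtain k l where p: "p = (k, l)" "1 \<le> k" "k < l" "l \<le> n" by (auto simp: P_def index_pairs_def)
    have "cube_fn n (\<lambda>\<theta>. pair_weight (torus_point_at r \<theta> k / torus_point_at r \<theta> l))"
      by (rule cube_fn_torus_point_at_ratio[OF holomorphic_on_imp_continuous_on[OF pair_weight_holomorphic] p(2-4)])
        (use r_pos unit_annulus in auto)
    then show "cube_fn n (\<lambda>\<theta>. case p of (k, l) \<Rightarrow> pair_weight (torus_point_at r \<theta> k / torus_point_at r \<theta> l))" by (simp add: p)
  qed
  have key: "g x * weight_fn x = of_real t * (f x * weight_fn x) + (Z (swap_pt i x) * f (swap_pt i x) - Z x * f x)"
    if "x = torus_point r \<theta>" for x \<theta>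
  proof -
    define z where "z = x i / x (Suc i)"
    define Q where "Q = (\<Prod>k=1..n. var_weight (x k)) * (\<Prod>(k, l)\<in>P. pair_weight (x k / x l))"
    have x0: "x i \<noteq> 0" "x (Suc i) \<noteq> 0" using torus_norm[of \<theta>] r_pos that by (metis norm_zero less_irrefl)+
    have nz: "norm z = 1" using torus_norm[of \<theta>] r_pos by (simp add: z_def that norm_divide)
    have W: "W_weight n q lam x = pair_weight z * (\<Prod>(k, l)\<in>P. pair_weight (x k / x l))"
      unfolding W_weight_eq P_def prod.remove[OF finite_index_pairs ipair] by (simp add: z_def)
    have weight_fn: "weight_fn x = Q * pair_weight z" unfolding weight_fn_def W Q_def by (simp add: mult_ac)
    have Z: "Z x = Q * pair_weight_reg z" unfolding Z_def Q_def z_def by (simp add: mult_ac)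
    have tz: "1 - of_real t * z \<noteq> 0"
    proof
      assume "1 - of_real t * z = 0"
      then have "norm (of_real t * z) = 1" by (metis eq_iff_diff_eq_0 norm_one)
      then show False using nz t_pos t_less_1 by (simp add: norm_mult)
    qed
    have VS: "pair_weight z * (1 - of_real t * z) = pair_weight_reg z * (1 - z)" by (rule pair_weight_pair_weight_reg[OF nz])
    show ?thesis
    proof (cases "x i = x (Suc i)")
      \<comment> \<open>The hypothesis says nothing about g here, but the weight vanishes at z = 1,
        so its value is irrelevant.\<close>
      case True
      then have "z = 1" using x0 by (simp add: z_def)
      then have "weight_fn x = 0" using VS tz unfolding weight_fn by simp
      moreover have "swap_pt i x = x" using True by (auto simp: swap_pt_def)
      ultimately show ?thesis by simp
    next
      case False
      then have z1: "1 - z \<noteq> 0" using x0 by (simp add: z_def)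
      have "hecke_coeff (x i) (x (Suc i)) * (1 - z) = 1 - of_real t * z"
        using False x0 unfolding hecke_coeff_def z_def by (simp add: divide_simps) (simp add: algebra_simps)
      then have "pair_weight z * (hecke_coeff (x i) (x (Suc i)) * (1 - z)) = pair_weight_reg z * (1 - z)" using VS by simp
      then have "pair_weight z * hecke_coeff (x i) (x (Suc i)) = pair_weight_reg z" using z1 by simp
      then have "g x * (Q * pair_weight z) = of_real t * (f x * (Q * pair_weight z)) + Q * pair_weight_reg z * (f (swap_pt i x) - f x)"
        unfolding T[OF False] T_op_hecke_coeff by (simp add: algebra_simps)
      then show ?thesis unfolding Zs weight_fn Z by (simp add: algebra_simps)
    qed
  qed
  have cf: "cube_fn n (\<lambda>\<theta>. f (torus_point r \<theta>))" using cube_fn_torus_point_at_poly[OF f r_pos] unfolding torus_point_at_r .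
  have cZf: "cube_fn n (\<lambda>\<theta>. Z (torus_point r \<theta>) * f (torus_point r \<theta>))"
    by (rule cube_fn_mult[OF Zc cf])
  have cfs: "cube_fn n (\<lambda>\<theta>. f (swap_pt i (torus_point r \<theta>)))"
  proof -
    obtain S c where S: "f = (\<lambda>x. \<Sum>\<nu>\<in>S. c \<nu> * monomial_fn n \<nu> x)"
      using f unfolding poly_fn_def fspan_def by blast
    have "cube_fn n (\<lambda>\<theta>. torus_point r \<theta> k)" if "k \<in> {1..n}" for k
      using cube_fn_torus_point_at_component[of UNIV "\<lambda>z. z" k r] that r_pos by (simp add: torus_point_at_r)
    moreover have "\<sigma> k \<in> {1..n}" if "k \<in> {1..n}" for k
      using that i by (auto simp: \<sigma>_def Transposition.transpose_def)
    ultimately show ?thesis unfolding S monomial_fn_def s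
      by (intro cube_fn_sum cube_fn_mult cube_fn_const cube_fn_prod cube_fn_power) blast
  qed
  have cZfs: "cube_fn n (\<lambda>\<theta>. Z (swap_pt i (torus_point r \<theta>)) * f (swap_pt i (torus_point r \<theta>)))"
    unfolding Zs by (rule cube_fn_mult[OF Zc cfs])
  have "weighted_CT g = cube_integral n (\<lambda>\<theta>. of_real t * (f (torus_point r \<theta>) * weight_fn (torus_point r \<theta>)) +
      (Z (swap_pt i (torus_point r \<theta>)) * f (swap_pt i (torus_point r \<theta>)) - Z (torus_point r \<theta>) * f (torus_point r \<theta>)))"
    unfolding weighted_CT_def fourier_integral_eq key[OF refl] ..
  also have "\<dots> = of_real t * weighted_CT f + (cube_integral n (\<lambda>\<theta>. Z (swap_pt i (torus_point r \<theta>)) * f (swap_pt i (torus_point r \<theta>))) -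
      cube_integral n (\<lambda>\<theta>. Z (torus_point r \<theta>) * f (torus_point r \<theta>)))"
    unfolding weighted_CT_def fourier_integral_eq
    by (subst cube_integral_add)
      (simp_all add: cube_fn_mult[OF cube_fn_const] cube_fn_poly_weight_fn f cube_fn_diff cZfs cZf cube_integral_scale cube_integral_diff)
  also have "cube_integral n (\<lambda>\<theta>. Z (swap_pt i (torus_point r \<theta>)) * f (swap_pt i (torus_point r \<theta>))) =
      cube_integral n (\<lambda>\<theta>. Z (torus_point r \<theta>) * f (torus_point r \<theta>))"
    by (rule cube_integral_swap[OF i, of "\<lambda>x. Z x * f x"]) (rule cZf)
  finally show ?thesis by simp
qed

end

section \<open>Moving the contour of the first variable\<close>

context morris_setup
begin

text \<open>Built so that both q-difference equations apply. At z = q x_n the equation of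
  \<open>A\<close> gives q (1 - q^a x_n) \<open>var_weight\<close> (x_n); at z = x_1 the equation of
  \<open>C\<close> gives (q^(b+1) - x_1) \<open>var_weight\<close> (x_1). The factor q - z supplies
  the 1 - x_n in one case and -x_1 (1 - q / x_1) in the other.\<close>

definition shifted_var_weight :: "complex \<Rightarrow> complex" where
  "shifted_var_weight z = (of_real q - z) * A z * C (of_real (q\<^sup>2) / z)"

definition shift_fn :: "point_fn \<Rightarrow> point_fn" where
  "shift_fn h y = h y * (shifted_var_weight (y 1) * ((\<Prod>j=2..n. var_weight (y j)) * W_weight n q lam y))"

lemma RC_pos: "RC > 0"
  using RC q_pos r_pos by (meson divide_pos_pos order_less_trans)

lemma shifted_var_weight_holomorphic: "shifted_var_weight holomorphic_on {z. q\<^sup>2 / RC < norm z \<and> norm z < RA}"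
proof -
  let ?S = "{z::complex. q\<^sup>2 / RC < norm z \<and> norm z < RA}"
  have z0: "norm z > 0" if "z \<in> ?S" for z
  proof -
    have "q\<^sup>2 / RC > 0" using q_pos RC_pos by simp
    then show ?thesis using that by auto
  qed
  have "(\<lambda>z. C (of_real (q\<^sup>2) / z)) holomorphic_on ?S"
  proof (rule holomorphic_on_compose_gen[of "\<lambda>z. of_real (q\<^sup>2) / z" ?S C "ball 0 RC", unfolded o_def])
    show "(\<lambda>z. of_real (q\<^sup>2) / z) holomorphic_on ?S"
      using z0 by (intro holomorphic_intros) force
    show "(\<lambda>z. of_real (q\<^sup>2) / z) ` ?S \<subseteq> ball 0 RC"
    proof
      fix w assume "w \<in> (\<lambda>z. of_real (q\<^sup>2) / z) ` ?S"
      then obtain z where z: "z \<in> ?S" "w = of_real (q\<^sup>2) / z" by blast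
      then have "q\<^sup>2 / norm z < RC" using z0[OF z(1)] RC_pos by (simp add: field_simps)
      then show "w \<in> ball 0 RC" by (simp add: z norm_divide norm_power)
    qed
  qed (rule C_hol)
  moreover have "A holomorphic_on ?S" by (rule holomorphic_on_subset[OF A_hol]) auto
  ultimately show ?thesis unfolding shifted_var_weight_def by (intro holomorphic_intros)
qed

lemma shift_annulus: "q\<^sup>2 / RC < q * r"
  using mult_strict_left_mono[OF r_annulus q_pos] by (simp add: power2_eq_square)

lemma cube_fn_shift_fn:
  assumes h: "poly_fn h" and \<rho>: "q * r \<le> \<rho>" "\<rho> \<le> r"
  shows "cube_fn n (\<lambda>\<theta>. shift_fn h (torus_point_at \<rho> \<theta>))"
proof -
  have pos: "\<rho> > 0" using mult_pos_pos[OF q_pos r_pos] \<rho> by linarith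
  have "cube_fn n (\<lambda>\<theta>. shifted_var_weight (torus_point_at \<rho> \<theta> 1))"
    by (rule cube_fn_torus_point_at_component[OF holomorphic_on_imp_continuous_on[OF shifted_var_weight_holomorphic]])
      (use n_pos pos \<rho> RA shift_annulus in auto)
  moreover have "cube_fn n (\<lambda>\<theta>. \<Prod>j=2..n. var_weight (torus_point_at \<rho> \<theta> j))"
    by (intro cube_fn_prod cube_fn_var_weight) (use pos in auto)
  ultimately show ?thesis unfolding shift_fn_def
    by (intro cube_fn_mult cube_fn_W \<rho> cube_fn_torus_point_at_poly[OF h pos])
qed

text \<open>With the other variables fixed, the integrand is holomorphic in the first one on an
  annulus that contains both circles, of radii q r and r; no residue is crossed.\<close>

lemma shift_fn_integral:
  assumes h: "poly_fn h"
  shows "cube_integral n (\<lambda>\<theta>. shift_fn h (torus_point_at (q * r) \<theta>)) = cube_integral n (\<lambda>\<theta>. shift_fn h (torus_point_at r \<theta>))"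
proof (rule cube_integral_first_coordinate[OF n_pos])
  have qr: "q * r \<le> r" "q * r \<le> q * r" using q_less_1 r_pos by auto
  show "cube_fn n (\<lambda>\<theta>. shift_fn h (torus_point_at (q * r) \<theta>))" by (rule cube_fn_shift_fn[OF h]) (use qr in auto)
  show "cube_fn n (\<lambda>\<theta>. shift_fn h (torus_point_at r \<theta>))" by (rule cube_fn_shift_fn[OF h]) (use qr in auto)
  fix \<theta> :: "nat \<Rightarrow> real"
  define X where "X = torus_point r \<theta>"
  define g where "g = (\<lambda>z. shift_fn h (X(1 := z)))"
  \<comment> \<open>The first entry of each bound comes from the annulus of
    \<open>pair_weight (z / X j)\<close> with |X j| = r, the second from
    \<open>shifted_var_weight\<close>.\<close>
  define R1 R2 where "R1 = max (q * t * r) (q\<^sup>2 / RC)" and "R2 = min (r / t) RA"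
  let ?S = "{z::complex. R1 < norm z \<and> norm z < R2}"
  have torus_point_at: "torus_point_at \<rho> (\<theta>(1 := y)) = X(1 := of_real \<rho> * cis (2 * pi * y))" for \<rho> y
    by (auto simp: torus_point_at_def X_def torus_point_def)
  have Xn: "norm (X k) = r" for k unfolding X_def by (rule torus_norm)
  have "g holomorphic_on ?S"
  proof -
    have Xk: "(\<lambda>z. (X(1 := z)) k) holomorphic_on ?S" for k by (cases "k = 1") auto
    obtain T c where T: "h = (\<lambda>x. \<Sum>\<nu>\<in>T. c \<nu> * monomial_fn n \<nu> x)"
      using h unfolding poly_fn_def fspan_def by blast
    have "(\<lambda>z. h (X(1 := z))) holomorphic_on ?S"
      unfolding T monomial_fn_def by (intro holomorphic_intros Xk)
    moreover have "shifted_var_weight holomorphic_on ?S"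
      by (rule holomorphic_on_subset[OF shifted_var_weight_holomorphic]) (auto simp: R1_def R2_def)
    moreover have "(\<lambda>z. \<Prod>j=2..n. var_weight ((X(1 := z)) j)) holomorphic_on ?S"
      by (intro holomorphic_on_prod) auto
    moreover have "(\<lambda>z. W_weight n q lam (X(1 := z))) holomorphic_on ?S"
      unfolding W_weight_eq
    proof (rule holomorphic_on_prod)
      fix p assume "p \<in> index_pairs n"
      then obtain i j where p: "p = (i, j)" "1 \<le> i" "i < j" "j \<le> n" by (auto simp: index_pairs_def)
      show "(\<lambda>z. case p of (i, j) \<Rightarrow> pair_weight ((X(1 := z)) i / (X(1 := z)) j)) holomorphic_on ?S"
      proof (cases "i = 1")
        case True
        have "(\<lambda>z. pair_weight (z / X j)) holomorphic_on ?S"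
        proof (rule holomorphic_on_compose_gen[OF _ pair_weight_holomorphic, unfolded o_def])
          have "X j \<noteq> 0" using Xn[of j] r_pos by auto
          then show "(\<lambda>z. z / X j) holomorphic_on ?S" by (intro holomorphic_intros) auto
          show "(\<lambda>z. z / X j) ` ?S \<subseteq> {z. q * t < norm z \<and> norm z < 1 / t}"
            using r_pos t_pos by (auto simp: norm_divide Xn R1_def R2_def field_simps)
        qed
        then show ?thesis using True p by simp
      qed (use p in auto)
    qed
    ultimately show ?thesis unfolding g_def shift_fn_def fun_upd_same by (intro holomorphic_on_mult)
  qed
  then have "(\<integral>y. indicator {-1/2..1/2} y *\<^sub>R g (of_real (q * r) * cis (2 * pi * y)) \<partial>lborel) =
      (\<integral>y. indicator {-1/2..1/2} y *\<^sub>R g (of_real r * cis (2 * pi * y)) \<partial>lborel)"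
  proof (rule circle_integral_radius)
    have a: "q * t * r < q * r" using mult_strict_right_mono[OF unit_annulus(3) r_pos] .
    have b: "q * r < r" using q_less_1 r_pos by simp
    have c: "r < r / t" using t_pos t_less_1 r_pos by (simp add: field_simps)
    show "0 \<le> R1" using q_pos t_pos r_pos by (simp add: R1_def le_max_iff_disj)
    show "R1 < q * r" "R1 < r" "q * r < R2" "r < R2"
      using a b c shift_annulus RA by (auto simp: R1_def R2_def)
  qed
  then show "(\<integral>y. indicator {-1/2..1/2} y *\<^sub>R shift_fn h (torus_point_at (q * r) (\<theta>(1 := y))) \<partial>lborel) =
      (\<integral>y. indicator {-1/2..1/2} y *\<^sub>R shift_fn h (torus_point_at r (\<theta>(1 := y))) \<partial>lborel)"
    unfolding torus_point_at g_def .
qed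

text \<open>On angles \<open>rot\<close> is a cyclic permutation, which preserves the measure; on
  radii it moves only the first coordinate, from r to q r.\<close>

lemma cube_integral_rot:
  assumes F: "cube_fn n (\<lambda>\<theta>. F (torus_point_at (q * r) \<theta>))"
  shows "cube_integral n (\<lambda>\<theta>. F (rot (torus_point r \<theta>))) = cube_integral n (\<lambda>\<theta>. F (torus_point_at (q * r) \<theta>))"
proof -
  define \<sigma> where "\<sigma> = (\<lambda>k. if k = 1 then n else if k \<in> {2..n} then k - 1 else k)"
  have \<sigma>: "bij_betw \<sigma> {1..n} {1..n}"
    by (rule bij_betwI[where g = "\<lambda>k. if k = n then 1 else Suc k"]) (use n_pos in \<open>auto simp: \<sigma>_def\<close>)
  have "rot (torus_point r \<theta>) = torus_point_at (q * r) (\<lambda>k\<in>{1..n}. \<theta> (\<sigma> k))" if "\<theta> \<in> cube n" for \<theta>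
  proof -
    have "torus_point r (\<lambda>k\<in>{1..n}. \<theta> (\<sigma> k)) = (\<lambda>k. torus_point r \<theta> (\<sigma> k))"
      by (rule torus_permute[OF that]) (use n_pos in \<open>auto simp: \<sigma>_def\<close>)
    then show ?thesis
      using n_pos by (auto simp: torus_point_at_def rot_def \<sigma>_def torus_point_def)
  qed
  then have "cube_integral n (\<lambda>\<theta>. F (rot (torus_point r \<theta>))) =
      cube_integral n (\<lambda>\<theta>. F (torus_point_at (q * r) (\<lambda>k\<in>{1..n}. \<theta> (\<sigma> k))))"
    by (intro cube_integral_cong) simp
  also have "\<dots> = cube_integral n (\<lambda>\<theta>. F (torus_point_at (q * r) \<theta>))"
    by (rule cube_integral_permute[OF \<sigma>]) (use F in \<open>simp add: cube_fn_def\<close>)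
  finally show ?thesis .
qed

lemma shift_fn_rot:
  assumes x: "x = torus_point r \<theta>"
  shows "shift_fn h (rot x) = of_real q * (h (rot x) * weight_fn x) - of_real (q * q powr a) * (x n * h (rot x) * weight_fn x)"
proof -
  have xn: "norm (x n) = r" "x n \<noteq> 0" using torus_norm[of \<theta> n] r_pos x by auto
  have "C (of_real (q\<^sup>2) / (of_real q * x n)) = C (of_real q / x n)"
    using q_pos by (simp add: power2_eq_square)
  then have u: "shifted_var_weight (rot x 1) = (of_real q - of_real q * x n) * A (of_real q * x n) * C (of_real q / x n)"
    unfolding shifted_var_weight_def rot_simps(1) by simp
  have "A (x n) * (1 - of_real (q powr a) * x n) = (1 - x n) * A (of_real q * x n)"
    by (rule A_rel) (use xn RA in simp)
  then have u: "shifted_var_weight (rot x 1) = of_real q * ((1 - of_real (q powr a) * x n) * var_weight (x n))"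
    unfolding u var_weight_def by algebra
  obtain m where m: "n = Suc m" using n_pos by (cases n) auto
  have "(\<Prod>j=2..n. var_weight (rot x j)) = (\<Prod>j=Suc 1..Suc m. var_weight (rot x j))" by (simp add: m numeral_2_eq_2)
  also have "\<dots> = (\<Prod>j=1..m. var_weight (rot x (Suc j)))" by (rule prod.shift_bounds_cl_Suc_ivl)
  also have "\<dots> = (\<Prod>j=1..m. var_weight (x j))"
  proof (rule prod.cong[OF refl])
    fix j assume "j \<in> {1..m}"
    then have "j \<in> {1..<n}" using m by simp
    then show "var_weight (rot x (Suc j)) = var_weight (x j)" by (simp only: rot_simps(2))
  qed
  finally have p: "(\<Prod>j=2..n. var_weight (rot x j)) = (\<Prod>j=1..m. var_weight (x j))" .
  have "weight_fn x = var_weight (x n) * ((\<Prod>j=1..m. var_weight (x j)) * W_weight n q lam x)"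
  proof -
    have "prod f {1..n} = prod f {1..m} * f n" for f :: "nat \<Rightarrow> complex" unfolding m by simp
    then show ?thesis unfolding weight_fn_def by simp
  qed
  then show ?thesis unfolding shift_fn_def u p W_weight_rot by (simp add: algebra_simps)
qed

lemma shift_fn_torus:
  assumes x: "x = torus_point r \<theta>"
  shows "shift_fn h x = of_real (q powr (b + 1)) * (h x * weight_fn x) - x 1 * h x * weight_fn x"
proof -
  have x1: "norm (x 1) = r" "x 1 \<noteq> 0" using torus_norm[of \<theta> 1] r_pos x by auto
  define B where "B = complex_of_real (q powr b)"
  define z where "z = of_real q / x 1"
  have "norm z < RC" using x1 RC q_pos by (simp add: z_def norm_divide)
  then have rel: "C z * (1 - B * z) = (1 - z) * C (of_real q * z)" unfolding B_def by (rule C_rel)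
  have zx: "z * x 1 = of_real q" using x1 by (simp add: z_def)
  have "of_real q * z = of_real (q\<^sup>2) / x 1" by (simp add: z_def power2_eq_square)
  then have "shifted_var_weight (x 1) = (of_real q - x 1) * A (x 1) * C (of_real q * z)" by (simp add: shifted_var_weight_def)
  also have "\<dots> = (B * of_real q - x 1) * var_weight (x 1)"
    unfolding var_weight_def z_def[symmetric] using rel zx by algebra
  also have "B * of_real q = of_real (q powr (b + 1))"
    using q_pos by (simp add: B_def powr_add)
  finally have u: "shifted_var_weight (x 1) = (of_real (q powr (b + 1)) - x 1) * var_weight (x 1)" .
  have "weight_fn x = var_weight (x 1) * ((\<Prod>j=2..n. var_weight (x j)) * W_weight n q lam x)"
    unfolding weight_fn_def prod.atLeast_Suc_atMost[OF n_pos] by (simp add: numeral_2_eq_2)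
  then show ?thesis unfolding shift_fn_def u by (simp add: algebra_simps)
qed

lemma weighted_CT_rot:
  assumes h: "poly_fn h"
  shows "of_real q * weighted_CT (\<lambda>x. h (rot x)) - of_real (q * q powr a) * weighted_CT (\<lambda>x. x n * h (rot x)) =
    of_real (q powr (b + 1)) * weighted_CT h - weighted_CT (\<lambda>x. x 1 * h x)"
proof -
  note [simp del] = of_real_mult
  have r1: "1 \<in> {1..n}" using n_pos by simp
  have qr: "q * r \<le> r" "q * r \<le> q * r" using q_less_1 r_pos by auto
  have "of_real q * weighted_CT (\<lambda>x. h (rot x)) - of_real (q * q powr a) * weighted_CT (\<lambda>x. x n * h (rot x)) =
    weighted_CT (\<lambda>x. of_real q * h (rot x) - of_real (q * q powr a) * (x n * h (rot x)))"
    by (rule weighted_CT_linear[symmetric]) (rule poly_fn_rot[OF h] poly_fn_mult_rot[OF h])+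
  also have "\<dots> = cube_integral n (\<lambda>\<theta>. shift_fn h (rot (torus_point r \<theta>)))"
    unfolding weighted_CT_def fourier_integral_eq shift_fn_rot[OF refl] by (simp add: left_diff_distrib mult.assoc)
  also have "\<dots> = cube_integral n (\<lambda>\<theta>. shift_fn h (torus_point_at (q * r) \<theta>))"
    by (rule cube_integral_rot[OF cube_fn_shift_fn[OF h]]) (use qr in auto)
  also have "\<dots> = cube_integral n (\<lambda>\<theta>. shift_fn h (torus_point r \<theta>))"
    unfolding shift_fn_integral[OF h] torus_point_at_r ..
  also have "\<dots> = weighted_CT (\<lambda>x. of_real (q powr (b + 1)) * h x - 1 * (x 1 * h x))"
    unfolding weighted_CT_def fourier_integral_eq shift_fn_torus[OF refl] by (simp add: left_diff_distrib mult.assoc)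
  also have "\<dots> = of_real (q powr (b + 1)) * weighted_CT h - 1 * weighted_CT (\<lambda>x. x 1 * h x)"
    by (rule weighted_CT_linear[OF h poly_fn_mult_var[OF h r1]])
  finally show ?thesis by simp
qed

end

subsection \<open>Functionals compatible with the Hecke operators\<close>

context macdonald_params
begin

text \<open>T_i f enters through a polynomial g that agrees with it off x_i = x_(i+1), because
  \<open>T_op\<close> does not have the value of that polynomial on the hyperplane.\<close>

definition T_invariant :: "(point_fn \<Rightarrow> complex) \<Rightarrow> bool" where
  "T_invariant \<Lambda> \<longleftrightarrow>
    (\<forall>f g c d. poly_fn f \<longrightarrow> poly_fn g \<longrightarrow> \<Lambda> (\<lambda>x. c * f x - d * g x) = c * \<Lambda> f - d * \<Lambda> g) \<and>
    (\<forall>f g i. poly_fn f \<longrightarrow> poly_fn g \<longrightarrow> i \<in> {1..<n} \<longrightarrow> (\<forall>x. x i \<noteq> x (Suc i) \<longrightarrow> g x = T_op t i f x) \<longrightarrow>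
      \<Lambda> g = of_real t * \<Lambda> f)"

lemma T_invariant_scale:
  assumes "T_invariant \<Lambda>" "poly_fn f" shows "\<Lambda> (\<lambda>x. c * f x) = c * \<Lambda> f"
proof -
  have "\<Lambda> (\<lambda>x. c * f x - 0 * f x) = c * \<Lambda> f - 0 * \<Lambda> f"
    using assms unfolding T_invariant_def by blast
  then show ?thesis by simp
qed

lemma mask_poly_eq:
  assumes "poly_fn f" "poly_fn g" "mask f = mask g" shows "f = g"
proof
  fix x
  have "f x - g x = 0"
  proof (rule poly_fn_eq_0[OF poly_fn_diff[OF assms(1,2)]])
    show "f y - g y = 0" if "gen y" for y using fun_cong[OF assms(3), of y] that by (simp add: mask_def)
  qed
  then show "f x = g x" by simp
qed

text \<open>A T_invariant functional is controlled only on polynomials, whereas the operator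
  identities concern masked functions. This lifts a word in the T_j to an actual polynomial; each
  letter contributes a factor t.\<close>

lemma poly_TTs:
  assumes \<Lambda>: "T_invariant \<Lambda>" and f: "poly_fn f" and js: "set js \<subseteq> {1..<n}"
  obtains g where "poly_fn g" "mask g = TTs js (mask f)" "\<Lambda> g = of_real t ^ length js * \<Lambda> f"
proof -
  have "\<exists>g. poly_fn g \<and> mask g = TTs js (mask f) \<and> \<Lambda> g = of_real t ^ length js * \<Lambda> f"
    using js
  proof (induction js)
    case Nil
    then show ?case using f by auto
  next
    case (Cons j js)
    then obtain g where g: "poly_fn g" "mask g = TTs js (mask f)" "\<Lambda> g = of_real t ^ length js * \<Lambda> f" by auto
    have j: "j \<in> {1..<n}" using Cons by simp
    obtain g' where g': "poly_fn g'" "\<And>x. x j \<noteq> x (Suc j) \<Longrightarrow> T_op t j g x = g' x"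
      using poly_fn_T[OF g(1) j] by blast
    have "mask g' = TT j (mask g)"
    proof
      fix x
      show "mask g' x = TT j (mask g) x"
      proof (cases "gen x")
        case True
        then show ?thesis
          using g'(2)[OF swap_pt_neq[OF j True]] gen_swap_pt[OF j, of x] by (simp add: mask_def TT_def T_op_hecke_coeff)
      qed (simp add: mask_def TT_def)
    qed
    moreover have "\<Lambda> g' = of_real t * \<Lambda> g" using \<Lambda> g(1) g' j unfolding T_invariant_def by metis
    ultimately show ?case using g g'(1) by (intro exI[of _ g']) (simp add: mult.assoc)
  qed
  then show ?thesis using that by blast
qed

lemma TTs_OM_E:
  assumes \<eta>: "\<eta> \<in> compositions n"
  shows "TTs [1..<n] (OM (mask (E \<eta>))) = (\<lambda>x. of_real t ^ (n - 1) * eigval \<eta> 1 * mask (E \<eta>) x)"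
proof
  fix x
  have "YY 1 (mask (E \<eta>)) x = eigval \<eta> 1 * mask (E \<eta>) x"
    using E_eigenfn[OF \<eta>] n_pos by (simp add: eigenfn_def)
  then have "of_real (t powi (int 1 - int n)) * TTs [1..<n] (OM (mask (E \<eta>))) x = eigval \<eta> 1 * mask (E \<eta>) x"
    by (simp add: YY_def)
  moreover have "t ^ (n - 1) * t powi (int 1 - int n) = 1"
  proof -
    have "t powi (int 1 - int n) = 1 / t ^ (n - 1)"
      using n_pos t_pos by (simp add: power_int_def inverse_eq_divide power_one_over nat_diff_distrib)
    then show ?thesis using t_pos by simp
  qed
  then have "complex_of_real (t ^ (n - 1)) * of_real (t powi (int 1 - int n)) = 1"
    by (metis of_real_1 of_real_mult)
  ultimately show "TTs [1..<n] (OM (mask (E \<eta>))) x = of_real t ^ (n - 1) * eigval \<eta> 1 * mask (E \<eta>) x"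
    by (metis mult.assoc mult_1 of_real_power)
qed

lemma OM_mask: "OM (mask f) = mask (\<lambda>x. f (rot x))"
  by (auto simp: OM_def mask_def gen_rot)

lemma XX_mask: "XX j (mask f) = mask (\<lambda>x. x j * f x)"
  by (auto simp: XX_def mask_def)

text \<open>Y_1 = t^(1-n) T_1 ... T_(n-1) \<omega> contains no inverses, and under the functional
  the n - 1 factors t from the T_j cancel the normalisation.\<close>

lemma invariant_E_rot:
  assumes \<Lambda>: "T_invariant \<Lambda>" and \<eta>: "\<eta> \<in> compositions n"
  shows "\<Lambda> (\<lambda>x. E \<eta> (rot x)) = eigval \<eta> 1 * \<Lambda> (E \<eta>)"
proof -
  have p: "poly_fn (\<lambda>x. E \<eta> (rot x))" by (rule poly_fn_rot[OF poly_fn_E[OF \<eta>]])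
  obtain g where g: "poly_fn g" "mask g = TTs [1..<n] (mask (\<lambda>x. E \<eta> (rot x)))"
    "\<Lambda> g = of_real t ^ length [1..<n] * \<Lambda> (\<lambda>x. E \<eta> (rot x))"
    by (rule poly_TTs[OF \<Lambda> p, of "[1..<n]"]) auto
  have "mask g = mask (\<lambda>x. of_real t ^ (n - 1) * eigval \<eta> 1 * E \<eta> x)"
    unfolding g(2) OM_mask[symmetric] TTs_OM_E[OF \<eta>] mask_scale ..
  then have "g = (\<lambda>x. of_real t ^ (n - 1) * eigval \<eta> 1 * E \<eta> x)"
    by (rule mask_poly_eq[OF g(1) poly_fn_scale[OF poly_fn_E[OF \<eta>]]])
  then have "\<Lambda> g = of_real t ^ (n - 1) * eigval \<eta> 1 * \<Lambda> (E \<eta>)"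
    using T_invariant_scale[OF \<Lambda> poly_fn_E[OF \<eta>]] by simp
  then have "of_real t ^ (n - 1) * \<Lambda> (\<lambda>x. E \<eta> (rot x)) = of_real t ^ (n - 1) * (eigval \<eta> 1 * \<Lambda> (E \<eta>))"
    using g(3) by (simp add: mult.assoc)
  then show ?thesis using t_pos by simp
qed

lemma TTs_rev_TIs:
  assumes "set js \<subseteq> {1..<n}" shows "TTs (rev js) (TIs js f) = f"
  using assms by (induction js) (simp_all add: TTs_append)

text \<open>Applying all T_j^(-1) to x_n \<omega> E_\<eta> lowers x_n to x_1 and restores the word
  T_1 ... T_(n-1) \<omega>, on which E_\<eta> is an eigenvector. Hence x_n \<omega> E_\<eta> is
  T_(n-1) ... T_1 applied to y x_1 E_\<eta>, with y the eigenvalue of Y_1, and the functional yields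
  t^(n-1).\<close>

lemma invariant_raise_E:
  assumes \<Lambda>: "T_invariant \<Lambda>" and \<eta>: "\<eta> \<in> compositions n"
  shows "\<Lambda> (\<lambda>x. x n * E \<eta> (rot x)) = of_real t ^ (n - 1) * eigval \<eta> 1 * \<Lambda> (\<lambda>x. x 1 * E \<eta> x)"
proof -
  have n1: "1 \<in> {1..n}" using n_pos by simp
  have p: "poly_fn (\<lambda>x. eigval \<eta> 1 * (x 1 * E \<eta> x))"
    by (intro poly_fn_scale poly_fn_mult_var poly_fn_E \<eta> n1)
  obtain m where m: "n = Suc m" using n_pos by (cases n) auto
  then have "m < n" by simp
  from TIs_XX[OF this, of "OM (mask (E \<eta>))", folded m]
  have "TIs [1..<n] (XX n (OM (mask (E \<eta>)))) =
      (\<lambda>x. (1 / of_real t) ^ m * XX 1 (\<lambda>x. of_real t ^ (n - 1) * eigval \<eta> 1 * mask (E \<eta>) x) x)"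
    unfolding TTs_OM_E[OF \<eta>] .
  also have "\<dots> = (\<lambda>x. (1 / of_real t) ^ m * (of_real t ^ (n - 1) * eigval \<eta> 1 * XX 1 (mask (E \<eta>)) x))"
    unfolding XX_scale ..
  also have "\<dots> = (\<lambda>x. eigval \<eta> 1 * XX 1 (mask (E \<eta>)) x)"
  proof -
    have "(1 / complex_of_real t) ^ m * of_real t ^ (n - 1) = 1"
      using t_pos by (simp add: m power_one_over)
    then show ?thesis by (simp only: mult.assoc[symmetric] mult_1_left)
  qed
  also have "\<dots> = mask (\<lambda>x. eigval \<eta> 1 * (x 1 * E \<eta> x))"
    unfolding XX_mask mask_scale ..
  finally have TI: "TIs [1..<n] (XX n (OM (mask (E \<eta>)))) = mask (\<lambda>x. eigval \<eta> 1 * (x 1 * E \<eta> x))" .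
  have "mask (\<lambda>x. x n * E \<eta> (rot x)) = XX n (OM (mask (E \<eta>)))" unfolding OM_mask XX_mask ..
  also have "\<dots> = TTs (rev [1..<n]) (mask (\<lambda>x. eigval \<eta> 1 * (x 1 * E \<eta> x)))"
    unfolding TI[symmetric] by (rule TTs_rev_TIs[symmetric]) auto
  finally have M: "mask (\<lambda>x. x n * E \<eta> (rot x)) = TTs (rev [1..<n]) (mask (\<lambda>x. eigval \<eta> 1 * (x 1 * E \<eta> x)))" .
  obtain g where g: "poly_fn g" "mask g = TTs (rev [1..<n]) (mask (\<lambda>x. eigval \<eta> 1 * (x 1 * E \<eta> x)))"
    "\<Lambda> g = of_real t ^ length (rev [1..<n]) * \<Lambda> (\<lambda>x. eigval \<eta> 1 * (x 1 * E \<eta> x))"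
    by (rule poly_TTs[OF \<Lambda> p, of "rev [1..<n]"]) auto
  have "g = (\<lambda>x. x n * E \<eta> (rot x))"
    by (rule mask_poly_eq[OF g(1) poly_fn_mult_rot[OF poly_fn_E[OF \<eta>]]]) (simp only: g(2) M)
  moreover have "\<Lambda> (\<lambda>x. eigval \<eta> 1 * (x 1 * E \<eta> x)) = eigval \<eta> 1 * \<Lambda> (\<lambda>x. x 1 * E \<eta> x)"
    by (rule T_invariant_scale[OF \<Lambda> poly_fn_mult_var[OF poly_fn_E[OF \<eta>] n1]])
  ultimately show ?thesis using g(3) by simp
qed

lemma invariant_swap_E:
  assumes \<Lambda>: "T_invariant \<Lambda>" and \<eta>: "\<eta> \<in> compositions n" and i: "i \<in> {1..<n}" and less: "\<eta> i < \<eta> (Suc i)"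
  shows "of_real t * \<Lambda> (E (swap_comp i \<eta>)) = (of_real t + swap_coeff \<eta> i) * \<Lambda> (E \<eta>)"
proof -
  obtain g where g: "poly_fn g" "\<And>x. x i \<noteq> x (Suc i) \<Longrightarrow> T_op t i (E \<eta>) x = g x"
    using poly_fn_T[OF poly_fn_E[OF \<eta>] i] by blast
  have Es: "poly_fn (E (swap_comp i \<eta>))" by (rule poly_fn_E[OF swap_comp_compositions[OF i \<eta>]])
  let ?c = "- swap_coeff \<eta> i"
  have "mask g = mask (\<lambda>x. of_real t * E (swap_comp i \<eta>) x - swap_coeff \<eta> i * E \<eta> x)"
  proof
    fix x
    show "mask g x = mask (\<lambda>x. of_real t * E (swap_comp i \<eta>) x - swap_coeff \<eta> i * E \<eta> x) x"
    proof (cases "gen x")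
      case True
      then show ?thesis
        using E_swap[OF \<eta> i less swap_pt_neq[OF i True]] g(2)[OF swap_pt_neq[OF i True]] by (simp add: mask_def)
    qed (simp add: mask_def)
  qed
  then have "g = (\<lambda>x. of_real t * E (swap_comp i \<eta>) x - swap_coeff \<eta> i * E \<eta> x)"
    using poly_fn_linear[OF Es poly_fn_E[OF \<eta>], of "of_real t" ?c]
    by (intro mask_poly_eq[OF g(1)]) simp_all
  moreover have "\<Lambda> (\<lambda>x. of_real t * E (swap_comp i \<eta>) x - swap_coeff \<eta> i * E \<eta> x) =
      of_real t * \<Lambda> (E (swap_comp i \<eta>)) - swap_coeff \<eta> i * \<Lambda> (E \<eta>)"
    using \<Lambda> Es poly_fn_E[OF \<eta>] unfolding T_invariant_def by blast
  moreover have "\<Lambda> g = of_real t * \<Lambda> (E \<eta>)" using \<Lambda> g i poly_fn_E[OF \<eta>] unfolding T_invariant_def by metis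
  ultimately show ?thesis by (simp add: algebra_simps)
qed

definition delta_pt :: "nat \<Rightarrow> complex" where
  "delta_pt i = of_real (t ^ (i - 1))"

text \<open>Consecutive coordinates satisfy t x_i = x_(i+1), so the Hecke coefficient vanishes; t <
  1 keeps the point off the hyperplane x_i = x_(i+1).\<close>

lemma T_invariant_delta: "T_invariant (\<lambda>f. f delta_pt)"
  unfolding T_invariant_def
proof (intro conjI allI impI)
  fix f g :: point_fn and i
  assume i: "i \<in> {1..<n}" and g: "\<forall>x. x i \<noteq> x (Suc i) \<longrightarrow> g x = T_op t i f x"
  obtain j where j: "i = Suc j" using i by (cases i) auto
  have "t ^ Suc j \<noteq> t ^ j" using t_pos t_less_1 by simp
  then have "delta_pt i \<noteq> delta_pt (Suc i)" unfolding delta_pt_def j of_real_eq_iff by simp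
  moreover have "hecke_coeff (delta_pt i) (delta_pt (Suc i)) = 0" unfolding hecke_coeff_def delta_pt_def j by simp
  ultimately show "g delta_pt = of_real t * f delta_pt" using g by (simp add: T_op_hecke_coeff)
qed simp

end

section \<open>The recursion for both sides of the identity\<close>

context morris_setup
begin

lemma T_invariant_weighted_CT: "T_invariant weighted_CT"
  unfolding T_invariant_def using weighted_CT_linear weighted_CT_T by blast

definition num_factor :: "(nat \<Rightarrow> nat) \<Rightarrow> real" where
  "num_factor \<eta> = q_bracket n q t (- b) (sorted_parts n \<eta>)"

definition den_factor :: "(nat \<Rightarrow> nat) \<Rightarrow> real" where
  "den_factor \<eta> = q_bracket n q t (1 + a + lam * (real n - 1)) (sorted_parts n \<eta>)"

text \<open>All parts keep their ranks under raising and only the first one grows, so the bracket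
  gains the single factor with j = \<eta> 1 + 1.\<close>

lemma bracket_raise:
  assumes "\<eta> \<in> compositions n"
  shows "q_bracket n q t u (sorted_parts n (raise_comp n \<eta>)) =
    q_bracket n q t u (sorted_parts n \<eta>) * (t ^ leg' n \<eta> 1 - q powr (real (\<eta> 1) + u))"
proof -
  define F where "F = (\<lambda>l k. \<Prod>j=1..k. t ^ l - q powr (real j - 1 + u))"
  obtain m where m: "n = Suc m" using n_pos by (cases n) auto
  have B: "q_bracket n q t u (sorted_parts n \<nu>) = (\<Prod>k=1..n. F (leg' n \<nu> k) (\<nu> k))" for \<nu>
    unfolding q_bracket_sorted_parts F_def ..
  have "(\<Prod>k=1..n. F (leg' n (raise_comp n \<eta>) k) (raise_comp n \<eta> k)) =
      (\<Prod>k=1..m. F (leg' n (raise_comp n \<eta>) k) (raise_comp n \<eta> k)) * F (leg' n (raise_comp n \<eta>) n) (raise_comp n \<eta> n)"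
  proof -
    have "prod f {1..n} = prod f {1..m} * f n" for f :: "nat \<Rightarrow> real" unfolding m by simp
    then show ?thesis .
  qed
  also have "(\<Prod>k=1..m. F (leg' n (raise_comp n \<eta>) k) (raise_comp n \<eta> k)) = (\<Prod>k=1..m. F (leg' n \<eta> (Suc k)) (\<eta> (Suc k)))"
  proof (rule prod.cong[OF refl])
    fix k assume "k \<in> {1..m}"
    then have k: "k \<in> {1..n}" "k \<noteq> n" "k \<in> {1..<n}" using m by auto
    then show "F (leg' n (raise_comp n \<eta>) k) (raise_comp n \<eta> k) = F (leg' n \<eta> (Suc k)) (\<eta> (Suc k))"
      unfolding leg'_raise_comp[OF k(1)] by (simp add: raise_comp_def)
  qed
  also have "\<dots> = (\<Prod>k=Suc 1..n. F (leg' n \<eta> k) (\<eta> k))"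
    unfolding m by (rule prod.shift_bounds_cl_Suc_ivl[symmetric])
  also have "F (leg' n (raise_comp n \<eta>) n) (raise_comp n \<eta> n) = F (leg' n \<eta> 1) (Suc (\<eta> 1))"
    using leg'_raise_comp[of n n \<eta>] n_pos by (simp add: raise_comp_def)
  also have "F (leg' n \<eta> 1) (Suc (\<eta> 1)) = F (leg' n \<eta> 1) (\<eta> 1) * (t ^ leg' n \<eta> 1 - q powr (real (\<eta> 1) + u))"
    by (simp add: F_def)
  finally show ?thesis
    unfolding B prod.atLeast_Suc_atMost[OF n_pos, of "\<lambda>k. F (leg' n \<eta> k) (\<eta> k)"] by (simp add: mult_ac)
qed

lemma bracket_swap:
  assumes "i \<in> {1..<n}" "\<eta> i < \<eta> (Suc i)"
  shows "q_bracket n q t u (sorted_parts n (swap_comp i \<eta>)) = q_bracket n q t u (sorted_parts n \<eta>)"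
proof -
  define F where "F = (\<lambda>l k. \<Prod>j=1..k. t ^ l - q powr (real j - 1 + u))"
  define \<sigma> where "\<sigma> = Transposition.transpose i (Suc i)"
  have \<sigma>: "bij_betw \<sigma> {1..n} {1..n}"
    unfolding \<sigma>_def by (rule bij_betw_transpose_iff) (use assms in auto)
  have B: "q_bracket n q t u (sorted_parts n \<nu>) = (\<Prod>k=1..n. F (leg' n \<nu> k) (\<nu> k))" for \<nu>
    unfolding q_bracket_sorted_parts F_def ..
  have "(\<Prod>k=1..n. F (leg' n (swap_comp i \<eta>) k) (swap_comp i \<eta> k)) = (\<Prod>k=1..n. F (leg' n \<eta> (\<sigma> k)) (\<eta> (\<sigma> k)))"
  proof (rule prod.cong[OF refl])
    fix k assume "k \<in> {1..n}"
    then have "leg' n (swap_comp i \<eta>) k = leg' n \<eta> (\<sigma> k)"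
      unfolding \<sigma>_def by (intro leg'_swap_comp) (use assms in auto)
    moreover have "swap_comp i \<eta> k = \<eta> (\<sigma> k)" by (auto simp: swap_comp_def \<sigma>_def Transposition.transpose_def)
    ultimately show "F (leg' n (swap_comp i \<eta>) k) (swap_comp i \<eta> k) = F (leg' n \<eta> (\<sigma> k)) (\<eta> (\<sigma> k))" by simp
  qed
  also have "\<dots> = (\<Prod>k=1..n. F (leg' n \<eta> k) (\<eta> k))"
    by (rule prod.reindex_bij_betw[OF \<sigma>, of "\<lambda>k. F (leg' n \<eta> k) (\<eta> k)"])
  finally show ?thesis unfolding B .
qed

text \<open>Two linear relations connect the constant terms of x_n \<omega> E_\<eta> and x_1
  E_\<eta> with that of E_\<eta>: the contour relation and \<open>invariant_raise_E\<close>.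
  Eliminating x_1 E_\<eta> leaves this one.\<close>

lemma weighted_CT_raise:
  assumes \<eta>: "\<eta> \<in> compositions n"
  defines "y \<equiv> eigval \<eta> 1"
  shows "weighted_CT (\<lambda>x. x n * E \<eta> (rot x)) * (1 - of_real (q * q powr a * t ^ (n - 1)) * y) =
    of_real (q * t ^ (n - 1)) * y * (of_real (q powr b) - y) * weighted_CT (E \<eta>)"
proof -
  define L where "L = weighted_CT (\<lambda>x. x n * E \<eta> (rot x))"
  define T where "T = complex_of_real t ^ (n - 1)"
  define L1 where "L1 = weighted_CT (\<lambda>x. x 1 * E \<eta> x)"
  have 1: "of_real q * (y * weighted_CT (E \<eta>)) - of_real (q * q powr a) * L = of_real (q powr (b + 1)) * weighted_CT (E \<eta>) - L1"
    using weighted_CT_rot[OF poly_fn_E[OF \<eta>]] invariant_E_rot[OF T_invariant_weighted_CT \<eta>] by (simp add: L_def L1_def y_def)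
  have 2: "L = T * y * L1" using invariant_raise_E[OF T_invariant_weighted_CT \<eta>] by (simp add: L_def T_def L1_def y_def)
  have qb: "complex_of_real (q powr (b + 1)) = of_real (q powr b) * of_real q"
    using q_pos by (simp add: powr_add)
  have "L * (1 - of_real (q * q powr a) * T * y) = of_real q * T * y * (of_real (q powr b) - y) * weighted_CT (E \<eta>)"
    using 1 2 unfolding qb by algebra
  then show ?thesis by (simp add: L_def T_def)
qed

text \<open>Kept in cross-multiplied form, so that the induction passes through zeros of the
  denominator.\<close>

theorem weighted_CT_E:
  assumes "\<eta> \<in> compositions n"
  shows "weighted_CT (E \<eta>) * of_real (den_factor \<eta>) =
    of_real (q powr ((b + 1) * real (weight n \<eta>))) * E \<eta> delta_pt * of_real (num_factor \<eta>) * weighted_CT (\<lambda>_. 1)"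
  using assms n_pos
proof (induction \<eta> rule: composition_induct)
  case zero
  have "q_bracket n q t u (sorted_parts n (\<lambda>_. 0)) = 1" for u
    unfolding q_bracket_sorted_parts by simp
  then show ?case using q_pos by (simp add: E_zero num_factor_def den_factor_def weight_def)
next
  case (raise \<eta>)
  define l where "l = leg' n \<eta> 1"
  define e where "e = \<eta> 1"
  define y where "y = q powr (real e - lam * real l)"
  have y: "eigval \<eta> 1 = of_real y" by (simp add: eigval_powr y_def e_def l_def)
  have tl: "t ^ l = q powr (lam * real l)"
    using q_pos by (simp add: t_eq powr_powr powr_realpow[symmetric] mult.commute)
  \<comment> \<open>The new bracket factor is t^l times the factor on the left of
    \<open>weighted_CT_raise\<close>. \<open>num\<close> gains the same t^l, and its q^(-b) combines
    with the q^(b+1) of the prefactor to the single q of that recursion.\<close>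
  have den: "den_factor (raise_comp n \<eta>) = den_factor \<eta> * (t ^ l * (1 - q * q powr a * t ^ (n - 1) * y))"
  proof -
    have "t ^ (n - 1) = q powr (lam * (real n - 1))"
      using q_pos n_pos by (simp add: t_eq powr_powr powr_realpow[symmetric] of_nat_diff mult.commute)
    then have "t ^ l * (q * q powr a * t ^ (n - 1) * y) = q powr (real e + (1 + a + lam * (real n - 1)))"
      using q_pos unfolding tl y_def by (simp add: powr_add[symmetric] powr_mult_base algebra_simps)
    then have "t ^ l - q powr (real e + (1 + a + lam * (real n - 1))) = t ^ l * (1 - q * q powr a * t ^ (n - 1) * y)"
      by (simp add: right_diff_distrib)
    then show ?thesis unfolding den_factor_def bracket_raise[OF raise.hyps(1)] l_def[symmetric] e_def[symmetric] by simp
  qed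
  have num: "num_factor (raise_comp n \<eta>) = num_factor \<eta> * (t ^ l * q powr (- b) * (q powr b - y))"
  proof -
    have "t ^ l * q powr (- b) * y = q powr (real e + - b)"
      unfolding tl y_def by (simp add: powr_add[symmetric])
    moreover have "t ^ l * q powr (- b) * q powr b = t ^ l"
      using q_pos by (simp add: mult.assoc powr_add[symmetric])
    ultimately have "t ^ l - q powr (real e + - b) = t ^ l * q powr (- b) * (q powr b - y)"
      by (simp add: right_diff_distrib)
    then show ?thesis unfolding num_factor_def bracket_raise[OF raise.hyps(1)] l_def[symmetric] e_def[symmetric] by simp
  qed
  define c where "c = complex_of_real (1 / q ^ e)"
  define L where "L = weighted_CT (\<lambda>x. x n * E \<eta> (rot x))"
  define P where "P = complex_of_real (q powr ((b + 1) * real (weight n \<eta>)))"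
  have ELL: "weighted_CT (E (raise_comp n \<eta>)) = c * L"
    unfolding E_raise[OF raise.hyps(1)] weighted_CT_scale c_def L_def e_def ..
  \<comment> \<open>The value of E_\<eta> at \<open>rot delta_pt\<close>, a different point, is
    supplied by \<open>invariant_E_rot\<close> for the evaluation functional.\<close>
  have ev: "E (raise_comp n \<eta>) delta_pt = c * (of_real (t ^ (n - 1)) * (of_real y * E \<eta> delta_pt))"
    unfolding E_raise[OF raise.hyps(1)] c_def e_def
    using invariant_E_rot[OF T_invariant_delta raise.hyps(1)] by (simp add: y[unfolded One_nat_def] delta_pt_def)
  have weight_fn: "complex_of_real (q powr ((b + 1) * real (weight n (raise_comp n \<eta>)))) = P * of_real (q powr b * q)"
  proof -
    have "(b + 1) * real (weight n (raise_comp n \<eta>)) = (b + 1) * real (weight n \<eta>) + (b + 1)"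
      unfolding weight_raise_comp[OF n_pos] by (simp add: algebra_simps)
    moreover have "q powr (b + 1) = q powr b * q" using q_pos by (simp add: powr_add)
    ultimately show ?thesis unfolding P_def by (simp add: powr_add)
  qed
  have LR: "L * (1 - of_real (q * q powr a * t ^ (n - 1) * y)) =
      of_real (q * t ^ (n - 1) * y * (q powr b - y)) * weighted_CT (E \<eta>)"
    using weighted_CT_raise[OF raise.hyps(1)] unfolding y L_def by simp
  have IH: "weighted_CT (E \<eta>) * of_real (den_factor \<eta>) = P * E \<eta> delta_pt * of_real (num_factor \<eta>) * weighted_CT (\<lambda>_. 1)"
    using raise.IH unfolding P_def .
  have "weighted_CT (E (raise_comp n \<eta>)) * of_real (den_factor (raise_comp n \<eta>)) =
      c * of_real (t ^ l) * (L * (1 - of_real (q * q powr a * t ^ (n - 1) * y))) * of_real (den_factor \<eta>)"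
    unfolding ELL den by simp
  also have "\<dots> = c * of_real (t ^ l) * of_real (q * t ^ (n - 1) * y * (q powr b - y)) * (weighted_CT (E \<eta>) * of_real (den_factor \<eta>))"
    unfolding LR by simp
  also have "\<dots> = c * of_real (t ^ l) * of_real (q * t ^ (n - 1) * y * (q powr b - y)) *
      (P * E \<eta> delta_pt * of_real (num_factor \<eta>) * weighted_CT (\<lambda>_. 1))"
    unfolding IH ..
  also have "\<dots> = P * of_real (q powr b * q) * (c * (of_real (t ^ (n - 1)) * (of_real y * E \<eta> delta_pt))) *
      of_real (num_factor \<eta> * (t ^ l * q powr (- b) * (q powr b - y))) * weighted_CT (\<lambda>_. 1)"
  proof -
    have "complex_of_real (q powr b) * of_real (q powr (- b)) = 1"
      using q_pos unfolding of_real_mult[symmetric] powr_add[symmetric] by simp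
    then show ?thesis unfolding of_real_mult by algebra
  qed
  finally show ?case unfolding weight_fn ev num .
next
  case (swap \<eta> i)
  have w: "weight n (swap_comp i \<eta>) = weight n \<eta>"
    unfolding weight_pair[OF swap.hyps(2), of "swap_comp i \<eta>"] weight_pair[OF swap.hyps(2), of \<eta>]
    by (simp add: swap_comp_def)
  have nd: "num_factor (swap_comp i \<eta>) = num_factor \<eta>" "den_factor (swap_comp i \<eta>) = den_factor \<eta>"
    unfolding num_factor_def den_factor_def by (rule bracket_swap[OF swap.hyps(2,3)])+
  define k where "k = (of_real t + swap_coeff \<eta> i) / of_real t"
  have t0: "complex_of_real t \<noteq> 0" using t_pos by simp
  have 1: "weighted_CT (E (swap_comp i \<eta>)) = k * weighted_CT (E \<eta>)"
    using invariant_swap_E[OF T_invariant_weighted_CT swap.hyps(1-3)] t0 by (simp add: k_def nonzero_eq_divide_eq mult.commute)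
  have 2: "E (swap_comp i \<eta>) delta_pt = k * E \<eta> delta_pt"
    using invariant_swap_E[OF T_invariant_delta swap.hyps(1-3)] t0 by (simp add: k_def nonzero_eq_divide_eq mult.commute)
  show ?case unfolding 1 2 w nd using swap.IH by (simp add: mult_ac)
qed

end

subsection \<open>Dependence on the parameter \<open>a\<close>\<close>

lemma cube_integral_tendsto:
  assumes G: "\<And>k. cube_fn n (G k)" and H: "cube_fn n H"
    and B: "\<And>k \<theta>. \<theta> \<in> cube n \<Longrightarrow> norm (G k \<theta>) \<le> B"
    and lim: "\<And>\<theta>. \<theta> \<in> cube n \<Longrightarrow> (\<lambda>k. G k \<theta>) \<longlonglongrightarrow> H \<theta>"
  shows "(\<lambda>k::nat. cube_integral n (G k)) \<longlonglongrightarrow> cube_integral n H"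
  unfolding cube_integral_def
proof (rule integral_dominated_convergence[where w = "\<lambda>\<theta>. indicator (cube n) \<theta> *\<^sub>R B"])
  show "(\<lambda>\<theta>. indicator (cube n) \<theta> *\<^sub>R H \<theta>) \<in> borel_measurable (lborel_n n)"
    "(\<lambda>\<theta>. indicator (cube n) \<theta> *\<^sub>R G k \<theta>) \<in> borel_measurable (lborel_n n)" for k
    using cube_fn_integrable[OF H] cube_fn_integrable[OF G] by auto
  show "integrable (lborel_n n) (\<lambda>\<theta>. indicat_real (cube n) \<theta> *\<^sub>R B)"
    using cube_sets emeasure_cube by (intro integrableI_bounded_set_indicator[where B = "\<bar>B\<bar>"]) auto
  show "AE \<theta> in lborel_n n. (\<lambda>k. indicator (cube n) \<theta> *\<^sub>R G k \<theta>) \<longlonglongrightarrow> indicator (cube n) \<theta> *\<^sub>R H \<theta>"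
    using lim by (intro AE_I2) (auto simp: indicator_def)
  show "AE \<theta> in lborel_n n. norm (indicator (cube n) \<theta> *\<^sub>R G k \<theta>) \<le> indicat_real (cube n) \<theta> *\<^sub>R B" for k
    using B by (intro AE_I2) (auto simp: indicator_def)
qed

text \<open>The bound is uniform in c' because z q^c' stays in one closed disc without zeros of the
  denominator. It dominates the integrands when a varies.\<close>

lemma qpoch_bounded:
  assumes q: "0 < q" "q < 1" and \<rho>: "\<rho> > 0" "\<rho> < q powr (- c)"
  obtains B where "\<And>z c'. norm z = \<rho> \<Longrightarrow> c' \<ge> c \<Longrightarrow> norm (qpoch z q c') \<le> B"
proof -
  have lt: "\<rho> * q powr c < 1"
  proof -
    have "\<rho> * q powr c < q powr (- c) * q powr c"
      using q \<rho>(2) by (intro mult_strict_right_mono) auto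
    then show ?thesis using q by (simp add: powr_add[symmetric])
  qed
  have nz: "qpoch_inf z q \<noteq> 0" if "z \<in> cball 0 (\<rho> * q powr c)" for z
    by (rule qpoch_inf_nonzero[OF q]) (use that lt in simp)
  have "bounded ((\<lambda>z. inverse (qpoch_inf z q)) ` cball 0 (\<rho> * q powr c))"
    by (intro compact_imp_bounded compact_continuous_image continuous_on_inverse
        holomorphic_on_imp_continuous_on[OF qpoch_inf_holomorphic[OF q]]) (use nz in auto)
  then obtain B1 where B1: "\<And>z. z \<in> cball 0 (\<rho> * q powr c) \<Longrightarrow> norm (inverse (qpoch_inf z q)) \<le> B1"
    unfolding bounded_iff by blast
  have "bounded ((\<lambda>z. qpoch_inf z q) ` cball 0 \<rho>)"
    by (intro compact_imp_bounded compact_continuous_image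
        holomorphic_on_imp_continuous_on[OF qpoch_inf_holomorphic[OF q]]) auto
  then obtain B2 where B2: "\<And>z. z \<in> cball 0 \<rho> \<Longrightarrow> norm (qpoch_inf z q) \<le> B2"
    unfolding bounded_iff by blast
  show ?thesis
  proof
    fix z :: complex and c' assume z: "norm z = \<rho>" and c': "c' \<ge> c"
    have "q powr c' \<le> q powr c" using powr_mono'[OF c'] q by simp
    then have in1: "z * of_real (q powr c') \<in> cball 0 (\<rho> * q powr c)"
      using q \<rho> by (simp add: norm_mult z mult_left_mono)
    have "norm (qpoch z q c') = norm (qpoch_inf z q) * norm (inverse (qpoch_inf (z * of_real (q powr c')) q))"
      by (simp add: qpoch_def divide_inverse norm_mult)
    also have "\<dots> \<le> B2 * B1"
      by (rule mult_mono[OF B2 B1[OF in1]]) (use z B2[of z] in \<open>auto intro: order_trans[OF norm_ge_zero]\<close>)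
    finally show "norm (qpoch z q c') \<le> B2 * B1" .
  qed
qed

lemma qpoch_tendsto:
  assumes q: "0 < q" "q < 1" and \<rho>: "norm z < q powr (- c)" and a: "(\<lambda>k. a k) \<longlonglongrightarrow> c"
  shows "(\<lambda>k::nat. qpoch z q (a k)) \<longlonglongrightarrow> qpoch z q c"
proof -
  have "norm z * q powr c < q powr (- c) * q powr c"
    using q \<rho> by (intro mult_strict_right_mono) auto
  then have "norm (z * complex_of_real (q powr c)) < 1"
    using q by (simp add: norm_mult powr_add[symmetric])
  then have nz: "qpoch_inf (z * complex_of_real (q powr c)) q \<noteq> 0" by (rule qpoch_inf_nonzero[OF q])
  have lim: "(\<lambda>k. z * complex_of_real (q powr a k)) \<longlonglongrightarrow> z * complex_of_real (q powr c)"
    using q by (intro tendsto_intros a) auto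
  have "isCont (\<lambda>z. qpoch_inf z q) (z * complex_of_real (q powr c))"
    using holomorphic_on_imp_continuous_on[OF qpoch_inf_holomorphic[OF q, of UNIV]]
    by (simp add: continuous_on_eq_continuous_at)
  then have "(\<lambda>k. qpoch_inf (z * complex_of_real (q powr a k)) q) \<longlonglongrightarrow> qpoch_inf (z * complex_of_real (q powr c)) q"
    using lim by (rule isCont_tendsto_compose)
  then show ?thesis unfolding qpoch_def by (intro tendsto_intros nz)
qed

lemma qpoch_power_measurable:
  assumes "0 < q" "q < 1" "f \<in> borel_measurable M"
  shows "(\<lambda>x. qpoch (f x) q c) \<in> borel_measurable M"
proof -
  note [measurable] = qpoch_inf_measurable[OF assms(1,2)] assms(3)
  show ?thesis unfolding qpoch_def by measurable
qed

lemma torus_point_measurable: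
  assumes "i \<in> {1..n}" shows "(\<lambda>\<theta>. torus_point r \<theta> i) \<in> borel_measurable (lborel_n n)"
proof -
  have "continuous_on UNIV (\<lambda>y. of_real r * cis (2 * pi * y))" by (intro continuous_intros)
  from cube_fn_component[OF this assms] show ?thesis unfolding cube_fn_def torus_point_def by blast
qed

lemma morris_weight_measurable:
  assumes q: "0 < q" "q < 1"
  shows "(\<lambda>\<theta>. morris_factor n q a b (torus_point r \<theta>)) \<in> borel_measurable (lborel_n n)"
    "(\<lambda>\<theta>. W_weight n q lam (torus_point r \<theta>)) \<in> borel_measurable (lborel_n n)"
proof -
  note tm = torus_point_measurable[where r = r and n = n]
  show "(\<lambda>\<theta>. morris_factor n q a b (torus_point r \<theta>)) \<in> borel_measurable (lborel_n n)"
    unfolding morris_factor_def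
    by (intro borel_measurable_prod borel_measurable_times qpoch_power_measurable q tm borel_measurable_divide) auto
  show "(\<lambda>\<theta>. W_weight n q lam (torus_point r \<theta>)) \<in> borel_measurable (lborel_n n)"
    unfolding W_weight_def split_def
    by (intro borel_measurable_prod borel_measurable_times qpoch_power_measurable q tm borel_measurable_divide) auto
qed

text \<open>\<open>A\<close> and \<open>C\<close> can differ from the q-factorials only where some
  x_i equals r, that is \<theta>_i = 0, a null set.\<close>

lemma (in morris_setup) CT_eq_weighted_CT:
  assumes A: "\<And>z. norm z = r \<Longrightarrow> z \<noteq> of_real r \<Longrightarrow> A z = qpoch z q a"
    and C: "\<And>z. norm z = q / r \<Longrightarrow> z \<noteq> of_real (q / r) \<Longrightarrow> C z = qpoch z q b"
    and f: "poly_fn f"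
  shows "CT n r (\<lambda>x. morris_factor n q a b x * f x * W_weight n q lam x) = weighted_CT f"
proof -
  have q: "0 < q" "q < 1" by (rule q_pos q_less_1)+
  have fm: "(\<lambda>\<theta>. f (torus_point r \<theta>)) \<in> borel_measurable (lborel_n n)"
    using cube_fn_torus_point_at_poly[OF f r_pos] unfolding torus_point_at_r cube_fn_def by blast
  have m: "(\<lambda>\<theta>. morris_factor n q a b (torus_point r \<theta>) * f (torus_point r \<theta>) * W_weight n q lam (torus_point r \<theta>))
      \<in> borel_measurable (lborel_n n)"
    by (intro borel_measurable_times morris_weight_measurable q fm)
  have "CT n r (\<lambda>x. morris_factor n q a b x * f x * W_weight n q lam x) =
      cube_integral n (\<lambda>\<theta>. morris_factor n q a b (torus_point r \<theta>) * f (torus_point r \<theta>) * W_weight n q lam (torus_point r \<theta>))"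
    unfolding CT_eq_fourier_integral[OF r_pos m] fourier_integral_eq ..
  also have "\<dots> = cube_integral n (\<lambda>\<theta>. f (torus_point r \<theta>) * weight_fn (torus_point r \<theta>))"
  proof (rule cube_integral_cong_AE[OF _ m])
    show "(\<lambda>\<theta>. f (torus_point r \<theta>) * weight_fn (torus_point r \<theta>)) \<in> borel_measurable (lborel_n n)"
      using cube_fn_poly_weight_fn[OF f] unfolding cube_fn_def by blast
    show "AE \<theta> in lborel_n n. \<theta> \<in> cube n \<longrightarrow>
        morris_factor n q a b (torus_point r \<theta>) * f (torus_point r \<theta>) * W_weight n q lam (torus_point r \<theta>) =
        f (torus_point r \<theta>) * weight_fn (torus_point r \<theta>)"
      using cube_AE_nonzero[of n]
    proof eventually_elim
      fix \<theta> :: "nat \<Rightarrow> real" assume nz: "\<forall>i\<in>{1..n}. \<theta> i \<noteq> 0"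
      show "\<theta> \<in> cube n \<longrightarrow>
        morris_factor n q a b (torus_point r \<theta>) * f (torus_point r \<theta>) * W_weight n q lam (torus_point r \<theta>) =
        f (torus_point r \<theta>) * weight_fn (torus_point r \<theta>)"
      proof
        assume \<theta>: "\<theta> \<in> cube n"
        have "qpoch (torus_point r \<theta> i) q a * qpoch (of_real q / torus_point r \<theta> i) q b = var_weight (torus_point r \<theta> i)"
          if i: "i \<in> {1..n}" for i
        proof -
          let ?z = "torus_point r \<theta> i"
          have "\<theta> i \<in> {-1/2..1/2}" using \<theta> i unfolding cube_def PiE_iff by blast
          then have \<theta>i: "\<bar>2 * pi * \<theta> i\<bar> \<le> pi" "2 * pi * \<theta> i \<noteq> 0"
            using nz i by (auto simp: abs_mult abs_le_iff)
          have "cis (2 * pi * \<theta> i) \<noteq> 1"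
          proof
            assume "cis (2 * pi * \<theta> i) = 1"
            then have "cos (2 * pi * \<theta> i) = 1" by (simp add: complex_eq_iff)
            then obtain k :: int where "2 * pi * \<theta> i = of_int k * 2 * pi" unfolding cos_one_2pi_int by blast
            then have "\<theta> i = of_int k" by simp
            then show False using \<open>\<theta> i \<in> {-1/2..1/2}\<close> nz i by (cases "k = 0") auto
          qed
          then have zr: "?z \<noteq> of_real r" using r_pos by (simp add: torus_point_def)
          have zn: "norm ?z = r" by (rule torus_norm)
          then have z0: "?z \<noteq> 0" using r_pos by auto
          have "of_real q / ?z \<noteq> of_real (q / r)" using zr z0 r_pos q_pos by (simp add: field_simps)
          moreover have "norm (of_real q / ?z) = q / r" using zn q_pos by (simp add: norm_divide)
          ultimately show ?thesis unfolding var_weight_def using A[OF zn zr] C by simp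
        qed
        then have "morris_factor n q a b (torus_point r \<theta>) = (\<Prod>i=1..n. var_weight (torus_point r \<theta> i))"
          unfolding morris_factor_def by (intro prod.cong) auto
        then show "morris_factor n q a b (torus_point r \<theta>) * f (torus_point r \<theta>) * W_weight n q lam (torus_point r \<theta>) =
          f (torus_point r \<theta>) * weight_fn (torus_point r \<theta>)"
          by (simp add: weight_fn_def)
      qed
    qed
  qed
  also have "\<dots> = weighted_CT f" unfolding weighted_CT_def fourier_integral_eq ..
  finally show ?thesis .
qed

lemma morris_setup_qpoch:
  assumes mp: "macdonald_params n q lam t" and r: "0 < r" "r < q powr (- a)"
    and RC: "q / r < RC" "C holomorphic_on ball 0 RC"
      "\<And>z. norm z < RC \<Longrightarrow> C z * (1 - of_real (q powr b) * z) = (1 - z) * C (of_real q * z)"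
  obtains RA where "morris_setup n q lam t a b r RA RC (\<lambda>z. qpoch z q a) C"
proof -
  interpret macdonald_params n q lam t by (rule mp)
  obtain A R where A: "r < R" "A holomorphic_on ball 0 R"
    "\<And>z. norm z < R \<Longrightarrow> A z * (1 - of_real (q powr a) * z) = (1 - z) * A (of_real q * z)"
    "\<And>z. norm z = r \<Longrightarrow> z \<noteq> of_real r \<Longrightarrow> A z = qpoch z q a"
    "r < q powr (- a) \<Longrightarrow> A = (\<lambda>z. qpoch z q a)"
    by (rule qpoch_regularization[OF q_pos q_less_1 r(1) disjI2[OF r(2)]]) (rule that)
  have "morris_setup n q lam t a b r R RC A C"
    by (intro morris_setup.intro mp morris_setup_axioms.intro) (fact r(1) A(1-3) RC)+
  then show ?thesis unfolding A(5)[OF r(2)] by (rule that)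
qed

text \<open>
  Both sides of \<open>weighted_CT_E\<close> vanish at a zero of the denominator. There the value of the functional is
  the limit of its values at the parameters \<open>a + 1/(k+1)\<close>, which are zero for large \<open>k\<close>.
\<close>

lemma (in morris_setup) weighted_CT_E_zero_denominator:
  assumes A: "A = (\<lambda>z. qpoch z q a)" and ra: "r < q powr (- a)" and \<eta>: "\<eta> \<in> compositions n"
    and num: "E \<eta> delta_pt * of_real (num_factor \<eta>) = 0"
  shows "weighted_CT (E \<eta>) = 0"
proof -
  \<comment> \<open>Approaching a from above keeps r < q^(-a'), so every parameter value still
    satisfies the hypotheses of the setting.\<close>
  define s where "s = (\<lambda>k::nat. a + 1 / real (Suc k))"
  define D where "D = (\<lambda>a'. q_bracket n q t (1 + a' + lam * (real n - 1)) (sorted_parts n \<eta>))"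
  define G where "G = (\<lambda>a' \<theta>. E \<eta> (torus_point r \<theta>) * ((\<Prod>i=1..n. qpoch (torus_point r \<theta> i) q a' *
      C (of_real q / torus_point r \<theta> i)) * W_weight n q lam (torus_point r \<theta>)))"
  have mp: "macdonald_params n q lam t" by unfold_locales
  have sa: "s k \<ge> a" for k by (simp add: s_def)
  have rs: "r < q powr (- a')" if "a' \<ge> a" for a'
  proof -
    have "q powr (- a) \<le> q powr (- a')" using powr_mono'[of "- a'" "- a" q] that q_pos q_less_1 by simp
    then show ?thesis using ra by simp
  qed
  have lims: "s \<longlonglongrightarrow> a"
    unfolding s_def using tendsto_add[OF tendsto_const LIMSEQ_inverse_real_of_nat, of a] by (simp add: inverse_eq_divide)
  \<comment> \<open>The numerator bracket does not contain a, so the assumption \<open>num\<close>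
    persists for a', and a nonzero denominator then forces the constant term to vanish.\<close>
  have zero: "cube_integral n (G a') = 0" if a': "a' \<ge> a" "D a' \<noteq> 0" for a'
  proof -
    obtain RA' where m: "morris_setup n q lam t a' b r RA' RC (\<lambda>z. qpoch z q a') C"
      using morris_setup_qpoch[OF mp r_pos rs[OF a'(1)] RC C_hol C_rel] by blast
    interpret m: morris_setup n q lam t a' b r RA' RC "\<lambda>z. qpoch z q a'" C by (rule m)
    have "m.weighted_CT (E \<eta>) * of_real (D a') = 0"
      using m.weighted_CT_E[OF \<eta>] num unfolding D_def m.den_factor_def m.num_factor_def num_factor_def by simp
    then have "m.weighted_CT (E \<eta>) = 0" using a'(2) by simp
    then show ?thesis unfolding m.weighted_CT_def fourier_integral_eq m.weight_fn_def m.var_weight_def G_def .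
  qed
  have cube_G: "cube_fn n (G a')" if a': "a' \<ge> a" for a'
  proof -
    obtain RA' where m: "morris_setup n q lam t a' b r RA' RC (\<lambda>z. qpoch z q a') C"
      using morris_setup_qpoch[OF mp r_pos rs[OF a'] RC C_hol C_rel] by blast
    interpret m: morris_setup n q lam t a' b r RA' RC "\<lambda>z. qpoch z q a'" C by (rule m)
    show ?thesis using m.cube_fn_poly_weight_fn[OF poly_fn_E[OF \<eta>]] unfolding m.weight_fn_def m.var_weight_def G_def .
  qed
  define H where "H = (\<lambda>\<theta>. E \<eta> (torus_point r \<theta>) * ((\<Prod>i=1..n. C (of_real q / torus_point r \<theta> i)) * W_weight n q lam (torus_point r \<theta>)))"
  have GH: "G a' \<theta> = (\<Prod>i=1..n. qpoch (torus_point r \<theta> i) q a') * H \<theta>" for a' \<theta>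
    by (simp add: G_def H_def prod.distrib mult_ac)
  have cube_H: "cube_fn n H"
  proof -
    have "continuous_on {z::complex. q / RC < norm z} (\<lambda>z. C (of_real q / z))"
    proof (rule continuous_on_compose2[OF holomorphic_on_imp_continuous_on[OF C_hol]])
      have RC0: "RC > 0" by (rule RC_pos)
      have z0: "norm z > 0" if "z \<in> {z::complex. q / RC < norm z}" for z
        using that divide_pos_pos[OF q_pos RC0] by auto
      show "continuous_on {z::complex. q / RC < norm z} (\<lambda>z. of_real q / z)"
        by (intro continuous_intros) (use z0 in force)
      show "(\<lambda>z. of_real q / z) ` {z::complex. q / RC < norm z} \<subseteq> ball 0 RC"
      proof
        fix w assume "w \<in> (\<lambda>z. of_real q / z) ` {z::complex. q / RC < norm z}"
        then obtain z where z: "q / RC < norm z" "w = of_real q / z" by blast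
        then have "q / norm z < RC" using z0[of z] RC0 by (simp add: field_simps)
        then show "w \<in> ball 0 RC" using q_pos by (simp add: z norm_divide)
      qed
    qed
    then have "cube_fn n (\<lambda>\<theta>. C (of_real q / torus_point_at r \<theta> i))" if "i \<in> {1..n}" for i
      by (rule cube_fn_torus_point_at_component[OF _ that]) (use r_annulus r_pos in auto)
    then show ?thesis unfolding H_def torus_point_at_r[symmetric]
      by (intro cube_fn_mult cube_fn_prod cube_fn_torus_point_at_poly[OF poly_fn_E[OF \<eta>] r_pos] cube_fn_W)
        (use q_less_1 r_pos in auto)
  qed
  obtain BH where BH: "\<And>\<theta>. \<theta> \<in> cube n \<Longrightarrow> norm (H \<theta>) \<le> BH" using cube_H unfolding cube_fn_def by blast
  obtain B where B: "\<And>z c'. norm z = r \<Longrightarrow> c' \<ge> a \<Longrightarrow> norm (qpoch z q c') \<le> B"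
    using qpoch_bounded[OF q_pos q_less_1 r_pos ra] by blast
  have lim: "(\<lambda>k. cube_integral n (G (s k))) \<longlonglongrightarrow> cube_integral n (G a)"
  proof (rule cube_integral_tendsto[where B = "B ^ n * BH"])
    show "cube_fn n (G (s k))" for k by (rule cube_G[OF sa])
    show "cube_fn n (G a)" by (rule cube_G) simp
    fix \<theta> assume \<theta>: "\<theta> \<in> cube n"
    show "(\<lambda>k. G (s k) \<theta>) \<longlonglongrightarrow> G a \<theta>"
      unfolding GH by (intro tendsto_mult_right tendsto_prod qpoch_tendsto[OF q_pos q_less_1 _ lims])
        (use torus_norm ra in simp)
    fix k
    have "norm (\<Prod>i=1..n. qpoch (torus_point r \<theta> i) q (s k)) \<le> (\<Prod>i=1..n. B)"
      unfolding prod_norm[symmetric] by (rule prod_mono) (use B[OF torus_norm sa] in auto)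
    then show "norm (G (s k) \<theta>) \<le> B ^ n * BH"
      unfolding GH norm_mult using BH[OF \<theta>] by (intro mult_mono) (auto intro: order_trans[OF norm_ge_zero])
  qed
  have fin: "finite {k. D (s k) = 0}"
  proof -
    \<comment> \<open>Each factor of the denominator is injective in a' and has at most one zero, so
      the sequence meets only finitely many zeros.\<close>
    have fact: "finite {a'. t ^ l - q powr (real j - 1 + (1 + a' + lam * (real n - 1))) = 0}" for l j
    proof -
      have "x = y" if "x \<in> {a'. t ^ l - q powr (real j - 1 + (1 + a' + lam * (real n - 1))) = 0}"
        "y \<in> {a'. t ^ l - q powr (real j - 1 + (1 + a' + lam * (real n - 1))) = 0}" for x y
      proof -
        have "q powr (real j - 1 + (1 + x + lam * (real n - 1))) = q powr (real j - 1 + (1 + y + lam * (real n - 1)))"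
          using that by simp
        then show ?thesis using q_pos q_less_1 by (simp add: powr_inj)
      qed
      then show ?thesis by (rule finite_subsingleton)
    qed
    have "{a'. D a' = 0} \<subseteq> (\<Union>k\<in>{1..n}. \<Union>j\<in>{1..\<eta> k}. {a'. t ^ leg' n \<eta> k - q powr (real j - 1 + (1 + a' + lam * (real n - 1))) = 0})"
      unfolding D_def q_bracket_sorted_parts by auto
    moreover have "finite \<dots>" using fact by (intro finite_UN_I) auto
    ultimately have "finite {a'. D a' = 0}" by (rule finite_subset)
    moreover have "inj s" by (rule injI) (simp add: s_def)
    ultimately have "finite (s -` {a'. D a' = 0})" by (intro finite_vimageI)
    then show ?thesis by (simp add: vimage_def)
  qed
  then obtain K where K: "\<And>k. D (s k) = 0 \<Longrightarrow> k < K"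
    unfolding finite_nat_set_iff_bounded by blast
  have "\<forall>\<^sub>F k in sequentially. cube_integral n (G (s k)) = 0"
    using eventually_ge_at_top[of K] by eventually_elim (use K zero[OF sa] in force)
  then have "(\<lambda>k. cube_integral n (G (s k))) \<longlonglongrightarrow> 0" by (rule tendsto_eventually)
  then have "cube_integral n (G a) = 0" using lim LIMSEQ_unique by blast
  moreover have "weighted_CT (E \<eta>) = cube_integral n (G a)"
    unfolding weighted_CT_def fourier_integral_eq weight_fn_def var_weight_def G_def by (simp only: A)
  ultimately show ?thesis by simp
qed

theorem proposition4p7:
  fixes n :: nat and q t lam a b r :: real and \<eta> :: "nat \<Rightarrow> nat"
  assumes "n \<ge> 1" and "0 < q" and "q < 1" and "lam > 0" and "t = q powr lam"
    and "\<eta> \<in> compositions n"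
    and "r > 0"
    and "a \<in> \<nat> \<or> r < q powr (- a)"
    and "b \<in> \<nat> \<or> q powr (b + 1) < r"
    and "CT n r (\<lambda>x. morris_factor n q a b x * W_weight n q lam x) \<noteq> 0"
  shows "CT n r (\<lambda>x. morris_factor n q a b x * nonsym_macdonald n q t \<eta> x * W_weight n q lam x) /
         CT n r (\<lambda>x. morris_factor n q a b x * W_weight n q lam x) =
         of_real (q powr ((b + 1) * real (weight n \<eta>))) *
         nonsym_macdonald n q t \<eta> (\<lambda>i. of_real (t ^ (i - 1))) *
         of_real (q_bracket n q t (- b) (sorted_parts n \<eta>) /
                  q_bracket n q t (1 + a + lam * (real n - 1)) (sorted_parts n \<eta>))"
proof -
  have "b \<in> \<nat> \<or> q / r < q powr (- b)"
  proof -
    have "q / r < q powr (- b)" if "q powr (b + 1) < r"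
    proof -
      have "q powr (b + 1) * q powr (- b) < r * q powr (- b)"
        using that assms(2) by (intro mult_strict_right_mono) auto
      moreover have "q powr (b + 1) * q powr (- b) = q"
        using assms(2) by (simp add: powr_add[symmetric])
      ultimately show ?thesis using assms(7) by (simp add: field_simps)
    qed
    then show ?thesis using assms(9) by blast
  qed
  note qb = qpoch_regularization[OF assms(2,3) divide_pos_pos[OF assms(2,7)] this]
  obtain C RC where C: "q / r < RC" "C holomorphic_on ball 0 RC"
    "\<And>z. norm z < RC \<Longrightarrow> C z * (1 - of_real (q powr b) * z) = (1 - z) * C (of_real q * z)"
    "\<And>z. norm z = q / r \<Longrightarrow> z \<noteq> of_real (q / r) \<Longrightarrow> C z = qpoch z q b"
    "q / r < q powr (- b) \<Longrightarrow> C = (\<lambda>z. qpoch z q b)"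
    by (rule qb) (rule that)
  obtain A RA where A: "r < RA" "A holomorphic_on ball 0 RA"
    "\<And>z. norm z < RA \<Longrightarrow> A z * (1 - of_real (q powr a) * z) = (1 - z) * A (of_real q * z)"
    "\<And>z. norm z = r \<Longrightarrow> z \<noteq> of_real r \<Longrightarrow> A z = qpoch z q a"
    "r < q powr (- a) \<Longrightarrow> A = (\<lambda>z. qpoch z q a)"
    by (rule qpoch_regularization[OF assms(2,3,7,8)]) (rule that)
  interpret morris_setup n q lam t a b r RA RC A C
    by unfold_locales (fact assms(1-5,7) A(1-3) C(1-3))+
  have "poly_fn (E (\<lambda>_. 0))" by (rule poly_fn_E) (simp add: compositions_def)
  then have p1: "poly_fn (\<lambda>_. 1)" unfolding E_zero .
  have CT1: "CT n r (\<lambda>x. morris_factor n q a b x * W_weight n q lam x) = weighted_CT (\<lambda>_. 1)"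
    using CT_eq_weighted_CT[OF A(4) C(4) p1] by simp
  have CTE: "CT n r (\<lambda>x. morris_factor n q a b x * E \<eta> x * W_weight n q lam x) = weighted_CT (E \<eta>)"
    by (rule CT_eq_weighted_CT[OF A(4) C(4) poly_fn_E[OF assms(6)]])
  have L1: "weighted_CT (\<lambda>_. 1) \<noteq> 0" using assms(10) unfolding CT1 .
  have delta: "(\<lambda>i. of_real (t ^ (i - 1))) = delta_pt" by (simp add: delta_pt_def fun_eq_iff)
  define Q where "Q = complex_of_real (q powr ((b + 1) * real (weight n \<eta>)))"
  have Q0: "Q \<noteq> 0" using assms(2) by (simp add: Q_def)
  have main: "weighted_CT (E \<eta>) * of_real (den_factor \<eta>) = Q * E \<eta> delta_pt * of_real (num_factor \<eta>) * weighted_CT (\<lambda>_. 1)"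
    unfolding Q_def by (rule weighted_CT_E[OF assms(6)])
  have "weighted_CT (E \<eta>) / weighted_CT (\<lambda>_. 1) = Q * E \<eta> delta_pt * of_real (num_factor \<eta> / den_factor \<eta>)"
  proof (cases "den_factor \<eta> = 0")
    case False
    then show ?thesis using main L1 by (simp add: field_simps)
  next
    case True
    \<comment> \<open>The right side is 0 here by the convention x / 0 = 0, so the constant term
      must be shown to vanish. A zero of the denominator requires lam l = j + a + lam (n - 1) with j
      \<ge> 1 and l \<le> n - 1, hence a < 0. So a is not a natural number, and the radius
      hypothesis makes \<open>A\<close> the q-factorial itself.\<close>
    have "r < q powr (- a)"
    proof -
      have "\<exists>k\<in>{1..n}. \<exists>j\<in>{1..\<eta> k}. t ^ leg' n \<eta> k = q powr (real j - 1 + (1 + a + lam * (real n - 1)))"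
        using True unfolding den_factor_def q_bracket_sorted_parts by auto
      then obtain k j where kj: "k \<in> {1..n}" "j \<ge> 1"
        "t ^ leg' n \<eta> k = q powr (real j - 1 + (1 + a + lam * (real n - 1)))" by auto
      have "t ^ leg' n \<eta> k = q powr (lam * real (leg' n \<eta> k))"
        using q_pos by (simp add: t_eq powr_powr powr_realpow[symmetric] mult.commute)
      then have "lam * real (leg' n \<eta> k) = real j - 1 + (1 + a + lam * (real n - 1))"
        using kj(3) q_pos q_less_1 by (simp add: powr_inj)
      moreover have "lam * real (leg' n \<eta> k) \<le> lam * (real n - 1)"
        using leg'_lt[OF kj(1), of \<eta>] lam_pos by (intro mult_left_mono) auto
      ultimately have "a < 0" using kj(2) by simp
      then have "a \<notin> \<nat>" by (auto elim: Nats_cases)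
      then show ?thesis using assms(8) by blast
    qed
    moreover have "E \<eta> delta_pt * of_real (num_factor \<eta>) = 0" using main True Q0 L1 by simp
    ultimately have "weighted_CT (E \<eta>) = 0" using weighted_CT_E_zero_denominator[OF A(5)] assms(6) by blast
    then show ?thesis using True by simp
  qed
  then show ?thesis unfolding CT1 CTE delta Q_def num_factor_def den_factor_def .
qed

end
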